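(* Let $q=2^m$ with $m$ odd, and let $A,B\in\mathbf{F}_q$ with $A^2+A+1+B\neq 0$. Let $N(A,B)$ be the number of $S_4$-orbits of solutions $(x_1,x_2,x_3,x_4)\in\mathbf{F}_q^4$ with pairwise distinct $x_i$ of the system $$x_1+x_2+x_3+x_4=1,\qquad x_1^3+x_2^3+x_3^3+x_4^3=A,\qquad x_1^5+x_2^5+x_3^5+x_4^5=B.$$ Then $$\frac{q-11-2\sqrt{2q}-8[2\sqrt{q}]}{24}\ \leq\ N(A,B)\ \leq\ \frac{q+1+2\sqrt{2q}+8[2\sqrt{q}]}{24}.$$
   Context: $[x]$ denotes the integer part of the real number $x$. The symmetric group $S_4$ acts on solutions by permuting $x_1,\dots,x_4$. *)

theory Defs
  imports "HOL-Analysis.Finite_Cartesian_Product" "HOL-Combinatorics.Permutations"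
begin

definition permute_coords :: "('n \<Rightarrow> 'n) \<Rightarrow> 'a ^ 'n \<Rightarrow> 'a ^ ('n::finite)" where
  "permute_coords p x = (\<chi> i. x $ (inv p i))"

definition sym_orbit :: "'a ^ 'n \<Rightarrow> ('a ^ ('n::finite)) set" where
  "sym_orbit x = {permute_coords p x | p. p permutes (UNIV :: 'n set)}"

text \<open>Coordinates are indexed by the four-element type \<^typ>\<open>4\<close>.\<close>

definition distinct_solutions :: "'a::field \<Rightarrow> 'a \<Rightarrow> ('a ^ 4) set" where
  "distinct_solutions A B =
     {x. (\<forall>i j. i \<noteq> j \<longrightarrow> x $ i \<noteq> x $ j) \<and>
         (\<Sum>i\<in>UNIV. x $ i) = 1 \<and>
         (\<Sum>i\<in>UNIV. (x $ i) ^ 3) = A \<and>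
         (\<Sum>i\<in>UNIV. (x $ i) ^ 5) = B}"

definition num_orbits :: "'a::field \<Rightarrow> 'a \<Rightarrow> nat" where
  "num_orbits A B = card (sym_orbit ` distinct_solutions A B)"

end

(*
  Put a = A + 1 and c = A^2 + A + 1 + B. By Newton's identities in characteristic two, the
  orbits correspond to the s for which the quartic (T^2 + s)(T^2 + T + a) + c has four roots
  in F_q. All these quartics are separable (the cover x |-> x^2 + c / (x^2 + x + a) of the affine
  line is unramified), so the regular character of S_4 expresses 24 N through the numbers of
  roots, of ordered pairs of roots, of roots of the resolvent cubic, and through the sign character.
  With the additive character chi and e = chi(a), summing these over s gives
    24 N = q - 5 - 6 e + 2 e C + 2 e K + 3 T,
  where K is the sum of chi(x + c/x) and T the sum of chi(c (x^3 + 1/x)) over x /= 0, and C is the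
  sum of chi(c (x^3 + x)) over all x. For odd m one has C^2 = 0 or 2 q, and Weil's bound gives
  |K| <= 2 sqrt q and |T| <= 4 sqrt q; congruences modulo 8 improve the latter to what is needed.

  Weil's bound is proved by Stepanov's method for y^2 + x y = f(x) over F_(q^n), n even, in the
  form without derivatives (an auxiliary function that is a sqrt(q^n)-th power), together with the
  rationality of the L-function, whose inverse roots are then at most sqrt q in absolute value.
*)

theory Submission
  imports Defs "HOL-Computational_Algebra.Computational_Algebra" "HOL-Library.Product_Plus"
    "HOL-Algebra.Algebraic_Closure_Type" "HOL-Number_Theory.Residues"
begin

hide_const (open) Divisibility.prime Polynomials.degree Polynomials.lead_coeff Coset.order
  up_ring.coeff up_ring.monom

subsection \<open>Fields of characteristic two\<close>

text \<open>The constants of the theorem can be read off the formula for \<open>24 N\<close>: q - 5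
  - 6 e is q + 1 or q - 11, C costs 2 sqrt (2 q), and K and T together cost 2 k + 3 (2 k) = 8 k with
  k = [2 sqrt q]. The obstacle is T: Weil's bound only gives |T| <= [4 sqrt q] <= 2 k + 1, one more
  than the budget. Serre's refinement of Weil's bound would remove the excess; here the integrality
  of N does, for q >= 32. K is 3 modulo 4, and then divisibility of 24 N by 8 forces T to be 7
  modulo 8; at the critical values |T| = 2 k + 1 this keeps K far enough from its own extreme for
  the total to fit. For Weil's bound it suffices to bound the sums over large even extensions up to
  a constant factor, because the L-function has fixed degree; hence the crude size condition in
  Stepanov's argument. Even degrees make sqrt (q^n) a power of two, so that raising to it is
  additive. Stepanov's method bounds point numbers only from above; lower bounds come from a
  quadratic twist.\<close>

locale char2 =
  fixes ty :: "'k::field itself"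
  assumes CHAR2: "CHAR('k) = 2"
begin

lemma two_eq_0 [simp]: "(2::'k) = 0"
  using of_nat_CHAR[where 'a='k] by (simp add: CHAR2)

lemma add_self [simp]: "x + x = (0::'k)"
  by (metis mult_2 mult_zero_left two_eq_0)

lemma add_self_left [simp]: "x + (x + y) = (y::'k)"
  by (simp flip: add.assoc)

lemma uminus_eq [simp]: "- x = (x::'k)"
  by (metis add_self add_eq_0_iff)

lemma diff_eq [simp]: "x - y = x + (y::'k)"
  by (metis diff_conv_add_uminus uminus_eq)

lemma numeral_Bit0_eq [simp]: "numeral (num.Bit0 n) = (0::'k)"
  by (metis add_self numeral_Bit0)

lemma numeral_Bit1_eq [simp]: "numeral (num.Bit1 n) = (1::'k)"
  by (metis add_self add_0 numeral_Bit1)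

lemma add_eq_0_iff2: "x + y = 0 \<longleftrightarrow> x = (y::'k)"
  by (metis add_eq_0_iff uminus_eq)

lemma add_swap_iff: "x + y = z \<longleftrightarrow> x = y + (z::'k)"
  by (metis add.commute add_self_left)

lemma frob_add: "(x + y) ^ (2 ^ n) = x ^ (2 ^ n) + (y::'k) ^ (2 ^ n)"
  using freshmans_dream'[where 'a='k, of "2 ^ n" n] by (simp add: CHAR2)

lemma frob_sum: "(\<Sum>i\<in>A. f i) ^ (2 ^ n) = (\<Sum>i\<in>A. (f i :: 'k) ^ (2 ^ n))"
  using freshmans_dream_sum'[where 'a='k, of "2 ^ n" n f A] by (simp add: CHAR2)

lemma sq_add: "(x + y)\<^sup>2 = x\<^sup>2 + (y::'k)\<^sup>2"
  using frob_add[of x y 1] by simp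

lemma frob_eq_iff [simp]: "x ^ (2 ^ n) = y ^ (2 ^ n) \<longleftrightarrow> x = (y::'k)"
proof
  assume "x ^ (2 ^ n) = y ^ (2 ^ n)"
  then have "(x + y) ^ (2 ^ n) = 0" by (simp add: frob_add)
  then show "x = y" by (simp add: add_eq_0_iff2)
qed simp

lemma sq_eq_iff [simp]: "x\<^sup>2 = y\<^sup>2 \<longleftrightarrow> x = (y::'k)"
  using frob_eq_iff[of x 1 y] by simp

text \<open>For \<open>n > 0\<close> the field with \<open>2 ^ n\<close> elements, if
  \<open>'k\<close> contains it. It is a subset and not a type so that all extensions needed for the
  L-function sit in one algebraic closure.\<close>

definition F :: "nat \<Rightarrow> 'k set" where
  "F n = {x. x ^ (2 ^ n) = x}"

lemma F_iff: "x \<in> F n \<longleftrightarrow> x ^ (2 ^ n) = x"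
  by (simp add: F_def)

lemma F_0 [simp]: "0 \<in> F n" and F_1 [simp]: "1 \<in> F n"
  by (simp_all add: F_def power_0_left)

lemma F_add [intro]: "x \<in> F n \<Longrightarrow> y \<in> F n \<Longrightarrow> x + y \<in> F n"
  by (simp add: F_def frob_add)

lemma F_mult [intro]: "x \<in> F n \<Longrightarrow> y \<in> F n \<Longrightarrow> x * y \<in> F n"
  by (simp add: F_def power_mult_distrib)

lemma F_divide [intro]: "x \<in> F n \<Longrightarrow> y \<in> F n \<Longrightarrow> x / y \<in> F n"
  by (simp add: F_def power_divide)

lemma F_power [intro]: "x \<in> F n \<Longrightarrow> x ^ k \<in> F n"
  by (induction k) auto

lemma F_sum [intro]: "(\<And>i. i \<in> A \<Longrightarrow> f i \<in> F n) \<Longrightarrow> (\<Sum>i\<in>A. f i) \<in> F n"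
  by (induction A rule: infinite_finite_induct) auto

lemma F_sq_iff [simp]: "x\<^sup>2 \<in> F n \<longleftrightarrow> x \<in> F n"
proof -
  have "x\<^sup>2 \<in> F n \<longleftrightarrow> (x ^ (2 ^ n))\<^sup>2 = x\<^sup>2"
    by (simp add: F_def mult.commute flip: power_mult)
  then show ?thesis by (simp only: sq_eq_iff F_iff)
qed

lemma F_sqrt: assumes "x \<in> F n" "n > 0" obtains y where "y \<in> F n" "y\<^sup>2 = x"
proof
  have *: "(x ^ (2 ^ (n - 1)))\<^sup>2 = x"
    unfolding power_mult[symmetric] power_Suc2[symmetric] using assms by (simp add: F_iff)
  then show "x ^ (2 ^ (n - 1)) \<in> F n" "(x ^ (2 ^ (n - 1)))\<^sup>2 = x"
    using assms by auto
qed

lemma F_dvd: assumes "n dvd k" "x \<in> F n" shows "x \<in> F k"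
proof -
  obtain j where k: "k = n * j" using assms by blast
  have "x ^ (2 ^ (n * j)) = x"
  proof (induction j)
    case (Suc j)
    have "x ^ (2 ^ (n * Suc j)) = (x ^ (2 ^ (n * j))) ^ (2 ^ n)"
      by (simp add: power_add mult.commute flip: power_mult)
    then show ?case using Suc assms by (simp add: F_iff)
  qed simp
  then show ?thesis by (simp add: k F_iff)
qed

section \<open>Trace and additive character\<close>

definition tr :: "nat \<Rightarrow> 'k \<Rightarrow> 'k" where
  "tr n x = (\<Sum>i<n. x ^ (2 ^ i))"

lemma tr_0 [simp]: "tr n 0 = 0"
  by (simp add: tr_def power_0_left)

lemma tr_add: "tr n (x + y) = tr n x + tr n y"
  by (simp add: tr_def frob_add sum.distrib)

text \<open>The sum telescopes. Since \<open>v\<close> need not lie in \<open>F n\<close>, the trace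
  of \<open>v\<^sup>2 + v\<close> tells whether Frobenius fixes a solution \<open>v\<close> found in
  an extension; the sign character is read off in this way.\<close>

lemma tr_artin_schreier: "tr n (v\<^sup>2 + v) = v ^ (2 ^ n) + v"
proof (induction n)
  case (Suc n)
  have "tr (Suc n) (v\<^sup>2 + v) = tr n (v\<^sup>2 + v) + (v ^ 2 ^ Suc n + v ^ (2 ^ n))"
    by (simp add: tr_def frob_add flip: power_mult)
  then show ?case using Suc by (simp add: algebra_simps)
qed (simp add: tr_def)

lemma tr_sq: "x \<in> F n \<Longrightarrow> tr n (x\<^sup>2) = tr n x"
  using tr_artin_schreier[of n x] by (simp add: F_iff tr_add add_eq_0_iff2)

lemma tr_square: "(tr n x)\<^sup>2 = tr n (x\<^sup>2)"
  using frob_sum[of "\<lambda>i. x ^ (2 ^ i)" "{..<n}" 1]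
  by (simp add: tr_def mult.commute flip: power_mult)

lemma tr_cases: assumes "x \<in> F n" shows "tr n x = 0 \<or> tr n x = 1"
proof -
  have "(tr n x)\<^sup>2 = tr n x" using assms by (simp add: tr_square tr_sq)
  then show ?thesis by (simp add: power2_eq_square)
qed

text \<open>On \<open>F n\<close> this is x -> (-1)^(tr x), integer-valued so that congruences
  between character sums make sense.\<close>

definition chi :: "nat \<Rightarrow> 'k \<Rightarrow> int" where
  "chi n x = (if tr n x = 0 then 1 else - 1)"

lemma chi_0 [simp]: "chi n 0 = 1"
  by (simp add: chi_def)

lemma chi_add: "x \<in> F n \<Longrightarrow> y \<in> F n \<Longrightarrow> chi n (x + y) = chi n x * chi n y"
  using tr_cases[of x n] tr_cases[of y n] by (auto simp: chi_def tr_add)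

lemma chi_sq: "x \<in> F n \<Longrightarrow> chi n (x\<^sup>2) = chi n x"
  by (simp add: chi_def tr_sq)

lemma chi_cases: "chi n x = 1 \<or> chi n x = - 1"
  by (simp add: chi_def)

lemma chi_artin_schreier [simp]: "v \<in> F n \<Longrightarrow> chi n (v\<^sup>2 + v) = 1"
  by (simp add: chi_def tr_artin_schreier F_iff)

lemma chi_eqI: "x \<in> F n \<Longrightarrow> y \<in> F n \<Longrightarrow> v \<in> F n \<Longrightarrow> x + y = v\<^sup>2 + v \<Longrightarrow> chi n x = chi n y"
  by (metis add_swap_iff chi_add chi_artin_schreier mult.right_neutral F_add)

end

section \<open>Character sums and Artin-Schreier equations over a finite field\<close>

locale fin2 = char2 ty for ty :: "'k::field itself" +
  fixes n :: nat
  assumes n_pos: "n > 0" and card_F: "card (F n) = 2 ^ n"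
begin

lemma finite_F [simp, intro]: "finite (F n)"
  using card_F by (metis card.infinite power_not_zero zero_neq_numeral)

text \<open>The trace is a nonzero polynomial of degree \<open>2 ^ (n - 1)\<close>, which bounds its
  zeros.\<close>

lemma card_tr_0: "card {x \<in> F n. tr n x = 0} \<le> 2 ^ (n - 1)"
proof -
  define p :: "'k poly" where "p = (\<Sum>i<n. monom 1 (2 ^ i))"
  have poly_p: "poly p x = tr n x" for x
    by (simp add: p_def poly_sum poly_monom tr_def)
  have "coeff p (2 ^ (n - 1)) = (\<Sum>i<n. if i = n - 1 then 1 else 0)"
    unfolding p_def coeff_sum by (intro sum.cong) auto
  also have "\<dots> = 1" using n_pos by simp
  finally have "p \<noteq> 0" by auto
  moreover have "degree p \<le> 2 ^ (n - 1)"
    unfolding p_def using n_pos by (intro degree_sum_le order.trans[OF degree_monom_le]) auto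
  ultimately have "card {x. poly p x = 0} \<le> 2 ^ (n - 1)"
    using card_poly_roots_bound[of p] by simp
  moreover have "card {x \<in> F n. tr n x = 0} \<le> card {x. poly p x = 0}"
    using \<open>p \<noteq> 0\<close> by (intro card_mono poly_roots_finite) (auto simp: poly_p)
  ultimately show ?thesis by simp
qed

lemma exists_tr_1: obtains w where "w \<in> F n" "tr n w = 1"
proof -
  have "\<not> (\<forall>x\<in>F n. tr n x = 0)"
  proof
    assume "\<forall>x\<in>F n. tr n x = 0"
    then have "{x \<in> F n. tr n x = 0} = F n" by auto
    then have "(2::nat) ^ n \<le> 2 ^ (n - 1)" using card_tr_0 card_F by argo
    then show False using n_pos by (cases n) simp_all
  qed
  then show ?thesis using tr_cases that by blast
qed

lemma sum_F_shift: "y \<in> F n \<Longrightarrow> (\<Sum>x\<in>F n. g (x + y)) = (\<Sum>x\<in>F n. g x)"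
  by (rule sum.reindex_bij_witness[of _ "\<lambda>x. x + y" "\<lambda>x. x + y"]) (auto simp: add.assoc)

lemma sum_F_scale:
  "y \<in> F n \<Longrightarrow> y \<noteq> 0 \<Longrightarrow> (\<Sum>x\<in>F n. g (y * x)) = (\<Sum>x\<in>F n. g x)"
  by (rule sum.reindex_bij_witness[of _ "\<lambda>x. x / y" "\<lambda>x. y * x"]) auto

lemma sum_chi: "(\<Sum>x\<in>F n. chi n x) = 0"
proof -
  obtain w where w: "w \<in> F n" "tr n w = 1" by (rule exists_tr_1)
  have "(\<Sum>x\<in>F n. chi n x) = (\<Sum>x\<in>F n. chi n (x + w))"
    using w by (simp add: sum_F_shift)
  also have "\<dots> = - (\<Sum>x\<in>F n. chi n x)"
    using w by (simp add: chi_add) (simp add: chi_def sum_negf)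
  finally show ?thesis by simp
qed

lemma sum_chi_mult: "y \<in> F n \<Longrightarrow> (\<Sum>x\<in>F n. chi n (y * x)) = (if y = 0 then 2 ^ n else 0)"
  using sum_F_scale[of y "chi n"] by (simp add: sum_chi card_F)

text \<open>Additive Hilbert 90 by counting: the fibres of \<open>v\<^sup>2 + v\<close> have at most
  two elements, so its image has at least \<open>2 ^ (n - 1)\<close>, and by
  \<open>card_tr_0\<close> it fills the elements of trace 0.\<close>

lemma artin_schreier_solvable:
  assumes "z \<in> F n" "tr n z = 0" obtains v where "v \<in> F n" "v\<^sup>2 + v = z"
proof -
  let ?h = "\<lambda>v::'k. v\<^sup>2 + v" and ?Z = "{x \<in> F n. tr n x = 0}"
  have sub: "?h ` F n \<subseteq> ?Z" by (auto simp: tr_artin_schreier) (simp add: F_iff)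
  have "card (F n) = (\<Sum>z\<in>?h ` F n. card {v \<in> F n. ?h v = z})"
    by (subst card_eq_sum, subst sum.image_gen[of "F n" _ ?h]) simp_all
  also have "\<dots> \<le> (\<Sum>z\<in>?h ` F n. 2)"
  proof (rule sum_mono)
    fix z assume "z \<in> ?h ` F n"
    then obtain v0 where "v0 \<in> F n" "z = ?h v0" by auto
    have "v = v0 \<or> v = v0 + 1" if "?h v = z" for v
    proof -
      have "(v + v0) * (v + v0 + 1) = ?h v + ?h v0"
        by (simp add: power2_eq_square algebra_simps)
      then have "(v + v0) * (v + v0 + 1) = 0" using that \<open>z = _\<close> by simp
      then show ?thesis by (metis mult_eq_0_iff add_eq_0_iff2 add.assoc)
    qed
    then have "{v \<in> F n. ?h v = z} \<subseteq> {v0, v0 + 1}" by auto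
    then have "card {v \<in> F n. ?h v = z} \<le> card {v0, v0 + 1}" by (intro card_mono) auto
    also have "\<dots> \<le> 2" by (simp add: card_insert_if)
    finally show "card {v \<in> F n. ?h v = z} \<le> 2" .
  qed
  finally have "2 ^ (n - 1) \<le> card (?h ` F n)"
    unfolding card_F using n_pos by (cases n) simp_all
  then have "?h ` F n = ?Z"
    using card_tr_0 sub by (intro card_seteq) auto
  then have "z \<in> ?h ` F n" using assms by simp
  then show ?thesis using that by (elim imageE) simp
qed

lemma card_artin_schreier:
  assumes "z \<in> F n"
  shows "int (card {v \<in> F n. v\<^sup>2 + v = z}) = 1 + chi n z"
proof (cases "tr n z = 0")
  case True
  obtain v0 where v0: "v0 \<in> F n" "v0\<^sup>2 + v0 = z"
    using artin_schreier_solvable[OF assms True] .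
  have "v\<^sup>2 + v = z \<longleftrightarrow> v \<in> {v0, v0 + 1}" for v
  proof -
    have "(v + v0) * (v + v0 + 1) = (v\<^sup>2 + v) + (v0\<^sup>2 + v0)"
      by (simp add: power2_eq_square algebra_simps)
    then have "v\<^sup>2 + v = z \<longleftrightarrow> (v + v0) * (v + v0 + 1) = 0"
      using v0 by (simp add: add_eq_0_iff2)
    then show ?thesis by (simp add: add_eq_0_iff2 add.assoc)
  qed
  then have "{v \<in> F n. v\<^sup>2 + v = z} = {v0, v0 + 1}" using v0 by auto
  then show ?thesis using True by (simp add: chi_def)
next
  case False
  then have "{v \<in> F n. v\<^sup>2 + v = z} = {}"
    by (auto simp: tr_artin_schreier F_iff)
  then show ?thesis using False by (simp add: chi_def)
qed

lemma card_quadratic: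
  assumes "e \<in> F n" "p \<in> F n" "p \<noteq> 0"
  shows "int (card {d \<in> F n. d\<^sup>2 + p * d = e}) = 1 + chi n (e / p\<^sup>2)"
proof -
  have "card {d \<in> F n. d\<^sup>2 + p * d = e} = card {v \<in> F n. v\<^sup>2 + v = e / p\<^sup>2}"
    by (rule bij_betw_same_card[of "\<lambda>d. d / p"], rule bij_betw_byWitness[of _ "\<lambda>v. p * v"])
      (use assms in \<open>auto simp: field_simps power2_eq_square\<close>)
  then show ?thesis using card_artin_schreier[of "e / p\<^sup>2"] assms by auto
qed

end

subsection \<open>Stepanov's bound for hyperelliptic curves in characteristic two\<close>

context char2
begin

lemma poly_add_self [simp]: "p + p = (0 :: 'k poly)"
  by (rule poly_eqI) (simp only: coeff_add add_self coeff_0)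

lemma poly_two_eq_0 [simp]: "(2 :: 'k poly) = 0"
  using poly_add_self[of 1] by (simp only: one_add_one)

lemma poly_add_self_left [simp]: "p + (p + q) = (q :: 'k poly)"
  by (simp flip: add.assoc)

lemma poly_uminus_eq [simp]: "- p = (p :: 'k poly)"
  by (rule poly_eqI) simp

lemma poly_diff_eq [simp]: "p - q = p + (q :: 'k poly)"
  by (rule poly_eqI) simp

text \<open>The pair \<open>(A, B)\<close> stands for the function \<open>A + B y\<close> on the curve
  \<open>y\<^sup>2 + x y = f x\<close>; its pole order at infinity is the degree of its norm \<open>nm f (A, B)\<close>.\<close>

fun cmul :: "'k poly \<Rightarrow> 'k poly \<times> 'k poly \<Rightarrow> 'k poly \<times> 'k poly \<Rightarrow> 'k poly \<times> 'k poly" where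
  "cmul f (A, B) (C, D) = (A * C + B * D * f, A * D + B * C + [:0, 1:] * B * D)"

text \<open>Squaring on the curve, with the cross term cancelled in characteristic two. Its
  \<open>k\<close>-fold iterate is the additive map raising to the power
  \<open>2 ^ k\<close>.\<close>

fun csq :: "'k poly \<Rightarrow> 'k poly \<times> 'k poly \<Rightarrow> 'k poly \<times> 'k poly" where
  "csq f (A, B) = (A * A + B * B * f, [:0, 1:] * B * B)"

text \<open>The product with the conjugate under the involution y -> y + x of the curve.\<close>

fun nm :: "'k poly \<Rightarrow> 'k poly \<times> 'k poly \<Rightarrow> 'k poly" where
  "nm f (A, B) = A * A + [:0, 1:] * A * B + B * B * f"

fun cev :: "'k poly \<times> 'k poly \<Rightarrow> 'k \<times> 'k \<Rightarrow> 'k" where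
  "cev (A, B) (x, y) = poly A x + poly B x * y"

lemma cmul_add_left: "cmul f (s + t) u = cmul f s u + cmul f t u"
  by (cases s; cases t; cases u) (simp add: algebra_simps)

lemma csq_add: "csq f (s + t) = csq f s + csq f t"
  by (cases s; cases t) (simp add: algebra_simps)

lemma pair_add_eq_0: "s + t = 0 \<Longrightarrow> s = (t :: 'k poly \<times> 'k poly)"
  by (cases s; cases t) (simp add: zero_prod_def, metis add_eq_0_iff poly_uminus_eq)

lemma nm_cmul: "nm f (cmul f s t) = nm f s * nm f t"
proof (cases s; cases t)
  fix A B C D assume "s = (A, B)" "t = (C, D)"
  moreover define x :: "'k poly" where "x = [:0, 1:]"
  ultimately show ?thesis
    by (simp only: nm.simps cmul.simps flip: x_def) (simp add: algebra_simps)
qed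

lemma nm_csq: "nm f (csq f s) = (nm f s)\<^sup>2"
proof -
  have "csq f s = cmul f s s" by (cases s) (simp add: algebra_simps)
  then show ?thesis by (simp add: nm_cmul power2_eq_square)
qed

lemma nm_csq_funpow: "nm f ((csq f ^^ k) s) = nm f s ^ (2 ^ k)"
  by (induction k) (simp_all add: nm_csq mult.commute flip: power_mult)

lemma csq_funpow_add: "(csq f ^^ k) (s + t) = (csq f ^^ k) s + (csq f ^^ k) t"
  by (induction k) (simp_all add: csq_add)

lemma cev_add: "cev (s + t) P = cev s P + cev t P"
  by (cases s; cases t; cases P) (simp add: algebra_simps)

lemma cev_0 [simp]: "cev 0 P = 0"
  by (cases P) (simp add: zero_prod_def)

lemma cev_sum: "cev (\<Sum>i\<in>I. s i) P = (\<Sum>i\<in>I. cev (s i) P)"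
  by (induction I rule: infinite_finite_induct) (simp_all add: cev_add)

definition on_curve :: "'k poly \<Rightarrow> 'k \<times> 'k \<Rightarrow> bool" where
  "on_curve f P \<longleftrightarrow> (snd P)\<^sup>2 + fst P * snd P = poly f (fst P)"

lemma cev_cmul: assumes "on_curve f P" shows "cev (cmul f s t) P = cev s P * cev t P"
proof (cases s; cases t; cases P)
  fix A B C D x y assume [simp]: "s = (A, B)" "t = (C, D)" "P = (x, y)"
  have "poly f x = y * y + x * y"
    using assms by (simp add: on_curve_def power2_eq_square)
  then show ?thesis by (simp add: algebra_simps)
qed

lemma cev_csq_funpow:
  assumes "on_curve f P" shows "cev ((csq f ^^ k) s) P = cev s P ^ (2 ^ k)"
proof (induction k)
  case (Suc k)
  have "csq f t = cmul f t t" for t by (cases t) (simp add: algebra_simps)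
  then show ?case using Suc
    by (simp add: cev_cmul[OF assms] flip: power_add) (simp add: mult_2)
qed simp

text \<open>\<open>wle g d s\<close> says that \<open>s\<close> has pole order at most \<open>d\<close>, as \<open>x\<close> and \<open>y\<close>
  have pole orders \<open>2\<close> and \<open>2 g + 1\<close>.\<close>

definition wle :: "nat \<Rightarrow> nat \<Rightarrow> 'k poly \<times> 'k poly \<Rightarrow> bool" where
  "wle g d s \<longleftrightarrow> (\<forall>i. coeff (fst s) i \<noteq> 0 \<longrightarrow> 2 * i \<le> d) \<and>
     (\<forall>i. coeff (snd s) i \<noteq> 0 \<longrightarrow> 2 * i + 2 * g + 1 \<le> d)"

lemma wle_0 [simp]: "wle g d 0"
  by (simp add: wle_def)

lemma wle_add: "wle g d s \<Longrightarrow> wle g d t \<Longrightarrow> wle g d (s + t)"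
  unfolding wle_def by (simp add: fst_add snd_add) (metis add.left_neutral)

lemma wle_sum: "(\<And>i. i \<in> I \<Longrightarrow> wle g d (s i)) \<Longrightarrow> wle g d (\<Sum>i\<in>I. s i)"
  by (induction I rule: infinite_finite_induct) (simp_all add: wle_add)

lemma wle_mono: "wle g d s \<Longrightarrow> d \<le> e \<Longrightarrow> wle g e s"
  unfolding wle_def by (meson order.trans)

text \<open>The two pole orders \<open>2 * ?a\<close> and \<open>2 * ?b + 2 * g + 1\<close> have
  different parity, so the outer terms of the norm cannot cancel; the cross term, of degree
  \<open>?a + ?b + 1\<close>, stays below the larger one precisely because
  \<open>g \<ge> 1\<close>.\<close>

lemma nm_degree:
  assumes "degree f = 2 * g + 1" "g \<ge> 1" "s \<noteq> 0"
  shows "nm f s \<noteq> 0" "wle g d s \<longleftrightarrow> degree (nm f s) \<le> d"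
proof -
  obtain A B where s: "s = (A, B)" by (cases s)
  have f0: "f \<noteq> 0" using assms by auto
  have nz: "A \<noteq> 0 \<or> B \<noteq> 0" using assms s by (auto simp: zero_prod_def)
  have "nm f s \<noteq> 0 \<and> (wle g d s \<longleftrightarrow> degree (nm f s) \<le> d)"
  proof (cases "A = 0 \<or> B = 0")
    case True
    then show ?thesis
    proof
      assume A: "A = 0"
      then have B: "B \<noteq> 0" using nz by simp
      have "degree (nm f s) = 2 * degree B + 2 * g + 1"
        using A B f0 assms by (simp add: s degree_mult_eq)
      moreover have "wle g d s \<longleftrightarrow> 2 * degree B + 2 * g + 1 \<le> d"
        unfolding wle_def using A B le_degree[of B] by (fastforce simp: s)
      ultimately show ?thesis using A B f0 by (simp add: s)
    next
      assume B: "B = 0"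
      then have A: "A \<noteq> 0" using nz by simp
      have "degree (nm f s) = 2 * degree A"
        using A B by (simp add: s degree_mult_eq)
      moreover have "wle g d s \<longleftrightarrow> 2 * degree A \<le> d"
        unfolding wle_def using A B le_degree[of A] by (fastforce simp: s)
      ultimately show ?thesis using A B by (simp add: s)
    qed
  next
    case False
    let ?a = "degree A" and ?b = "degree B"
    have dA: "degree (A * A) = 2 * ?a" and dB: "degree (B * B * f) = 2 * ?b + 2 * g + 1"
      and dAB: "degree ([:0, 1:] * A * B) = ?a + ?b + 1"
      using False f0 assms by (simp_all add: degree_mult_eq)
    have w: "wle g d s \<longleftrightarrow> 2 * ?a \<le> d \<and> 2 * ?b + 2 * g + 1 \<le> d"
      unfolding wle_def using False le_degree[of A] le_degree[of B] by (fastforce simp: s)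
    have "degree (nm f s) = max (2 * ?a) (2 * ?b + 2 * g + 1)"
    proof (cases "2 * ?a < 2 * ?b + 2 * g + 1")
      case True
      then have "degree (A * A + [:0, 1:] * A * B) < degree (B * B * f)"
        using assms(2) dA dB dAB by (intro degree_add_less) auto
      then have "degree (nm f s) = degree (B * B * f)"
        unfolding s nm.simps by (rule degree_add_eq_right)
      then show ?thesis using True dB by simp
    next
      case le: False
      then have gt: "2 * ?a > 2 * ?b + 2 * g + 1" by presburger
      then have "degree ([:0, 1:] * A * B + B * B * f) < degree (A * A)"
        using assms(2) dA dB dAB by (intro degree_add_less) auto
      then have "degree (nm f s) = degree (A * A)"
        unfolding s nm.simps add.assoc by (rule degree_add_eq_left)
      then show ?thesis using gt dA by simp
    qed
    then show ?thesis using w by (auto simp del: nm.simps)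
  qed
  then show "nm f s \<noteq> 0" "wle g d s \<longleftrightarrow> degree (nm f s) \<le> d" by blast+
qed

lemma nm_0 [simp]: "nm f 0 = 0"
  by (simp add: zero_prod_def)

lemma wle_iff:
  assumes "degree f = 2 * g + 1" "g \<ge> 1"
  shows "wle g d s \<longleftrightarrow> degree (nm f s) \<le> d"
  using nm_degree[OF assms] by (cases "s = 0") auto

lemma nm_eq_0_iff:
  assumes "degree f = 2 * g + 1" "g \<ge> 1"
  shows "nm f s = 0 \<longleftrightarrow> s = 0"
  using nm_degree[OF assms] by (cases "s = 0") auto

lemma wle_cmul_csq:
  assumes "degree f = 2 * g + 1" "g \<ge> 1" "wle g d s" "wle g e t"
  shows "wle g (d + 2 ^ k * e) (cmul f s ((csq f ^^ k) t))"
    and "wle g (2 ^ k * d + e) (cmul f ((csq f ^^ k) s) t)"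
proof -
  have d: "degree (nm f s) \<le> d" "degree (nm f t) \<le> e"
    using assms by (simp_all add: wle_iff[OF assms(1,2)])
  have "degree (nm f s * nm f t ^ (2 ^ k)) \<le> degree (nm f s) + degree (nm f t) * 2 ^ k"
    by (rule order.trans[OF degree_mult_le]) (simp add: degree_power_le)
  also have "\<dots> \<le> d + 2 ^ k * e" using d by (simp add: add_mono)
  finally show "wle g (d + 2 ^ k * e) (cmul f s ((csq f ^^ k) t))"
    by (simp add: wle_iff[OF assms(1,2)] nm_cmul nm_csq_funpow)
  have "degree (nm f s ^ (2 ^ k) * nm f t) \<le> degree (nm f s) * 2 ^ k + degree (nm f t)"
    by (rule order.trans[OF degree_mult_le]) (simp add: degree_power_le)
  also have "\<dots> \<le> 2 ^ k * d + e" using d by (simp add: add_mono)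
  finally show "wle g (2 ^ k * d + e) (cmul f ((csq f ^^ k) s) t)"
    by (simp add: wle_iff[OF assms(1,2)] nm_cmul nm_csq_funpow)
qed

text \<open>The term with index \<open>i\<close> has pole order between \<open>2 ^ k * n\<close> and
  \<open>2 ^ k * n + l\<close>, where \<open>n\<close> is the pole order of \<open>t i\<close>. As
  \<open>l < 2 ^ k\<close>, distinct \<open>n\<close> give disjoint windows, so the nonzero term
  with the largest \<open>n\<close> cannot be cancelled.\<close>

lemma distinct_pole_orders:
  assumes f: "degree f = 2 * g + 1" "g \<ge> 1" and "finite I"
    and s: "\<And>i. i \<in> I \<Longrightarrow> wle g l (s i)" "l < 2 ^ k"
    and t: "\<And>i. i \<in> I \<Longrightarrow> t i \<noteq> 0" "inj_on (\<lambda>i. degree (nm f (t i))) I"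
    and sum: "(\<Sum>i\<in>I. cmul f (s i) ((csq f ^^ k) (t i))) = 0"
    and "i \<in> I"
  shows "s i = 0"
proof (rule ccontr)
  let ?n = "\<lambda>i. degree (nm f (t i))" and ?u = "\<lambda>i. cmul f (s i) ((csq f ^^ k) (t i))"
  define J where "J = {i \<in> I. s i \<noteq> 0}"
  assume "s i \<noteq> 0"
  then have "J \<noteq> {}" "finite J" using assms by (auto simp: J_def)
  then have "Max (?n ` J) \<in> ?n ` J" by (intro Max_in) auto
  then obtain j where "j \<in> J" and max: "Max (?n ` J) = ?n j" by (elim imageE)
  then have j: "j \<in> J" "\<And>i. i \<in> J \<Longrightarrow> ?n i \<le> ?n j"
    using Max_ge[of "?n ` J"] \<open>finite J\<close> unfolding max by auto
  have "j \<in> I" "s j \<noteq> 0" using j by (auto simp: J_def)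
  have nu: "nm f (?u i) = nm f (s i) * nm f (t i) ^ (2 ^ k)" for i
    by (simp add: nm_cmul nm_csq_funpow)
  have deg: "degree (nm f (?u j)) = degree (nm f (s j)) + ?n j * 2 ^ k"
    unfolding nu using \<open>j \<in> I\<close> \<open>s j \<noteq> 0\<close> t(1) nm_eq_0_iff[OF f]
    by (subst degree_mult_eq) (simp_all add: degree_power_eq)
  have small: "wle g (?n j * 2 ^ k - 1) (?u i)" if "i \<in> I - {j}" for i
  proof (cases "s i = 0")
    case True
    then have "nm f (?u i) = 0" unfolding nu by simp
    then show ?thesis unfolding wle_iff[OF f] by simp
  next
    case False
    then have "i \<in> J" using that by (simp add: J_def)
    then have "?n i < ?n j"
      using j(2)[of i] inj_onD[OF t(2), of i j] that \<open>j \<in> I\<close> by force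
    then have "Suc (?n i) * 2 ^ k \<le> ?n j * 2 ^ k" by (intro mult_right_mono) auto
    moreover have "wle g (l + 2 ^ k * ?n i) (?u i)"
      using that s(1) by (intro wle_cmul_csq f) (auto simp: wle_iff[OF f])
    ultimately show ?thesis
      using s(2) by (elim wle_mono) (simp add: algebra_simps)
  qed
  have "0 = ?u j + (\<Sum>i\<in>I - {j}. ?u i)"
    using sum \<open>j \<in> I\<close> \<open>finite I\<close> by (simp add: sum.remove)
  then have uj: "?u j = (\<Sum>i\<in>I - {j}. ?u i)"
    by (metis pair_add_eq_0)
  have "wle g (?n j * 2 ^ k - 1) (\<Sum>i\<in>I - {j}. ?u i)" by (intro wle_sum small)
  then have "wle g (?n j * 2 ^ k - 1) (?u j)" using uj by (simp only:)
  then have le: "degree (nm f (s j)) + ?n j * 2 ^ k \<le> ?n j * 2 ^ k - 1"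
    unfolding wle_iff[OF f] deg .
  \<comment> \<open>Subtraction is truncated, so the inequality is contradictory only if
    \<open>?n j > 0\<close>. In the remaining case every index with nonzero coefficient has pole
    order 0, hence is \<open>j\<close>, and the sum reduces to a single nonzero term.\<close>
  then have "?n j * 2 ^ k = 0" by linarith
  then have "?n j = 0" by simp
  have "?u i = 0" if "i \<in> I - {j}" for i
  proof -
    have "s i = 0"
    proof (rule ccontr)
      assume "s i \<noteq> 0"
      then have "i \<in> J" using that by (simp add: J_def)
      then have "?n i = ?n j" using j(2)[of i] \<open>?n j = 0\<close> by simp
      then show False using inj_onD[OF t(2), of i j] that \<open>j \<in> I\<close> by blast
    qed
    then have "nm f (?u i) = 0" unfolding nu by simp
    then show ?thesis using nm_eq_0_iff[OF f] by blast
  qed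
  then have "(\<Sum>i\<in>I - {j}. ?u i) = 0" by (rule sum.neutral[OF ballI])
  then have "?u j = 0" using uj by (simp only:)
  then have "nm f (s j) * nm f (t j) ^ (2 ^ k) = 0" using nu[of j] by simp
  then show False using \<open>j \<in> I\<close> \<open>s j \<noteq> 0\<close> t(1) nm_eq_0_iff[OF f] by simp
qed

text \<open>A fibre is contained in \<open>{y, y + x}\<close>. If \<open>B\<close> vanishes at
  \<open>x\<close>, so does \<open>A\<close>, and the norm has a double root there; otherwise
  \<open>y\<close> is determined by \<open>A\<close> and \<open>B\<close>, and a simple root
  suffices.\<close>

lemma card_curve_fibre:
  assumes "(A, B) \<noteq> 0" "nm f (A, B) \<noteq> 0"
  shows "finite {y. on_curve f (x, y) \<and> cev (A, B) (x, y) = 0} \<and>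
    card {y. on_curve f (x, y) \<and> cev (A, B) (x, y) = 0} \<le> order x (nm f (A, B))"
    (is "finite ?Y \<and> _")
proof (cases "?Y = {}")
  case False
  then obtain y where y: "on_curve f (x, y)" "poly A x + poly B x * y = 0" by auto
  let ?N = "nm f (A, B)"
  have fx: "poly f x = y * y + x * y"
    using y by (simp add: on_curve_def power2_eq_square)
  have Ax: "poly A x = poly B x * y" using y by (simp add: add_eq_0_iff2)
  have sub: "?Y \<subseteq> {y, y + x}"
  proof
    fix z assume "z \<in> ?Y"
    then have "z * z + x * z = y * y + x * y" by (simp add: on_curve_def power2_eq_square fx)
    moreover have "(z + y) * (z + (y + x)) = (z * z + x * z) + (y * y + x * y)"
      by (simp add: algebra_simps)
    ultimately have "(z + y) * (z + (y + x)) = 0" by simp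
    then show "z \<in> {y, y + x}" by (simp add: add_eq_0_iff2)
  qed
  then have fin: "finite ?Y" by (rule finite_subset) simp
  show ?thesis
  proof (cases "poly B x = 0")
    case True
    then have "[:-x, 1:] dvd A" "[:-x, 1:] dvd B" using Ax poly_eq_0_iff_dvd[of A x] poly_eq_0_iff_dvd[of B x] by auto
    then obtain A' B' where "A = [:-x, 1:] * A'" "B = [:-x, 1:] * B'" by (elim dvdE)
    then have "?N = [:-x, 1:]\<^sup>2 * (A' * A' + [:0, 1:] * A' * B' + B' * B' * f)"
      by (simp only: nm.simps power2_eq_square ring_distribs mult_ac)
    then have "[:-x, 1:]\<^sup>2 dvd ?N" by (simp only: dvd_triv_left)
    then have "2 \<le> order x ?N" using assms(2) order_divides[of x 2 ?N] by blast
    moreover have "card ?Y \<le> card {y, y + x}" using sub by (intro card_mono) auto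
    moreover have "card {y, y + x} \<le> 2" by (simp add: card_insert_if)
    ultimately show ?thesis using fin by linarith
  next
    case False
    have "poly ?N x = 0" by (simp add: Ax fx algebra_simps)
    then have "1 \<le> order x ?N" using assms(2) order_root[of ?N x] by simp
    moreover have "?Y \<subseteq> {y}" using False Ax by (auto simp: add_eq_0_iff2)
    then have "card ?Y \<le> 1" using card_mono[of "{y}" ?Y] by simp
    ultimately show ?thesis using fin by linarith
  qed
next
  case True
  show ?thesis unfolding True by simp
qed

lemma card_curve_zeros:
  assumes "nm f h \<noteq> 0"
  shows "finite {P. on_curve f P \<and> cev h P = 0}"
    and "card {P. on_curve f P \<and> cev h P = 0} \<le> degree (nm f h)"
proof -
  obtain A B where h: "h = (A, B)" by (cases h)
  have "h \<noteq> 0" using assms by auto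
  let ?N = "nm f h"
  define R where "R = {x. poly ?N x = 0}"
  define Y where "Y x = {y. on_curve f (x, y) \<and> cev h (x, y) = 0}" for x
  have Y: "finite (Y x)" "card (Y x) \<le> order x ?N" for x
    using card_curve_fibre[of A B f x] assms \<open>h \<noteq> 0\<close> by (simp_all add: Y_def h del: nm.simps cev.simps)
  have finR: "finite R" using assms by (simp add: R_def poly_roots_finite)
  have "Y x = {}" if "x \<notin> R" for x
  proof -
    have "order x ?N = 0" using that by (simp add: R_def order_0I)
    then show ?thesis using Y[of x] by simp
  qed
  then have eq: "{P. on_curve f P \<and> cev h P = 0} = Sigma R Y"
    by (fastforce simp: Y_def)
  show "finite {P. on_curve f P \<and> cev h P = 0}" using eq finR Y by simp
  have "card (Sigma R Y) = (\<Sum>x\<in>R. card (Y x))" using finR Y by simp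
  also have "\<dots> \<le> (\<Sum>x\<in>R. order x ?N)" by (intro sum_mono Y)
  also have "\<dots> \<le> degree ?N" using sum_order_le_degree[OF assms] by (simp add: R_def)
  finally show "card {P. on_curve f P \<and> cev h P = 0} \<le> degree ?N" using eq by simp
qed

section \<open>Polynomials with coefficients in the finite field\<close>

definition FP :: "nat \<Rightarrow> 'k poly set" where
  "FP n = {p. \<forall>i. coeff p i \<in> F n}"

lemma FP_0 [simp]: "0 \<in> FP n" and FP_X [simp]: "[:0, 1:] \<in> FP n"
  by (auto simp: FP_def coeff_pCons split: nat.split)

lemma FP_monom [simp]: "monom 1 k \<in> FP n"
  by (auto simp: FP_def)

lemma FP_add [intro]: "p \<in> FP n \<Longrightarrow> r \<in> FP n \<Longrightarrow> p + r \<in> FP n"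
  by (auto simp: FP_def)

lemma FP_mult [intro]: "p \<in> FP n \<Longrightarrow> r \<in> FP n \<Longrightarrow> p * r \<in> FP n"
  by (auto simp: FP_def coeff_mult intro!: F_sum)

lemma poly_FP: "p \<in> FP n \<Longrightarrow> x \<in> F n \<Longrightarrow> poly p x \<in> F n"
  unfolding poly_altdef by (auto simp: FP_def)

lemma FP_cmul:
  "f \<in> FP n \<Longrightarrow> s \<in> FP n \<times> FP n \<Longrightarrow> t \<in> FP n \<times> FP n \<Longrightarrow> cmul f s t \<in> FP n \<times> FP n"
  by (cases s; cases t) (auto intro!: FP_add FP_mult simp del: mult_pCons_left)

lemma FP_csq_funpow:
  assumes "f \<in> FP n" "s \<in> FP n \<times> FP n" shows "(csq f ^^ k) s \<in> FP n \<times> FP n"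
proof (induction k)
  case (Suc k)
  have "csq f t \<in> FP n \<times> FP n" if "t \<in> FP n \<times> FP n" for t
    using that assms(1) by (cases t) (auto intro!: FP_add FP_mult simp del: mult_pCons_left)
  then show ?case using Suc by simp
qed (use assms in simp)

lemma FP_sum_pair:
  "(\<And>i. i \<in> I \<Longrightarrow> s i \<in> FP n \<times> FP n) \<Longrightarrow> (\<Sum>i\<in>I. s i) \<in> FP n \<times> FP n"
  by (induction I rule: infinite_finite_induct) (auto simp: zero_prod_def mem_Times_iff fst_add snd_add)

definition FPd :: "nat \<Rightarrow> nat \<Rightarrow> 'k poly set" where
  "FPd n d = {p \<in> FP n. \<forall>i\<ge>d. coeff p i = 0}"

lemma card_FPd: "finite (F n) \<Longrightarrow> finite (FPd n d) \<and> card (FPd n d) = card (F n) ^ d"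
proof -
  assume fin: "finite (F n)"
  have coeff: "coeff (\<Sum>i<d. monom (c i) i) j = (if j < d then c j else 0)" for c :: "nat \<Rightarrow> 'k" and j
    by (simp add: coeff_sum)
  have "bij_betw (\<lambda>p. restrict (coeff p) {..<d}) (FPd n d) ({..<d} \<rightarrow>\<^sub>E F n)"
    by (rule bij_betw_byWitness[of _ "\<lambda>c. \<Sum>i<d. monom (c i) i"])
      (auto simp: FPd_def FP_def coeff restrict_def fun_eq_iff PiE_def extensional_def
         intro!: poly_eqI)
  moreover have "finite ({..<d} \<rightarrow>\<^sub>E F n)" using fin by (simp add: finite_PiE)
  moreover have "card ({..<d} \<rightarrow>\<^sub>E F n) = card (F n) ^ d" by (simp add: card_PiE)
  ultimately show ?thesis using bij_betw_finite bij_betw_same_card by metis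
qed

end

text \<open>Choosing auxiliary functions \<open>h = \<Sum>\<^sub>i s\<^sub>i t\<^sub>i\<^sup>M\<close> with \<open>M\<^sup>2 = q\<close>: since
  \<open>t\<^sub>i\<^sup>q\<close> and \<open>t\<^sub>i\<close> agree at rational points, it suffices that \<open>\<Sum>\<^sub>i s\<^sub>i\<^sup>M t\<^sub>i = 0\<close> identically,
  which the pigeonhole principle provides.\<close>

lemma (in fin2) stepanov_bound:
  assumes n: "n = 2 * k" and f: "degree f = 2 * g + 1" "g \<ge> 1" "f \<in> FP n"
    and large: "(g + 1)\<^sup>2 < 2 ^ k"
  shows "card {P \<in> F n \<times> F n. on_curve f P} \<le> 2 ^ n + (2 * g + 1) * 2 ^ k"
proof -
  define M :: nat where "M = 2 ^ k"
  define H where "H = M div 2"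
  have k: "k > 0" using n n_pos by simp
  then have M: "M = 2 * H" by (cases k) (simp_all add: M_def H_def)
  have MM: "2 ^ n = M * M" by (simp add: n M_def mult_2 power_add)
  have gM: "(g + 1) * (g + 1) < M" using large by (simp add: M_def power2_eq_square)
  have gH: "g < H"
  proof -
    have "2 * (g + 1) \<le> (g + 1) * (g + 1)" using f(2) by (intro mult_right_mono) auto
    then have "2 * (g + 1) < 2 * H" using gM unfolding M by (rule order.strict_trans1)
    then show ?thesis by simp
  qed
  \<comment> \<open>For \<open>i \<in> I\<close> this is the monomial x^j or x^j y of pole order
    exactly \<open>i\<close>.\<close>
  define t :: "nat \<Rightarrow> 'k poly \<times> 'k poly" where
    "t i = (if even i then (monom 1 (i div 2), 0) else (0, monom 1 (i div 2 - g)))" for i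
  \<comment> \<open>The odd numbers below \<open>2 * g + 1\<close> are the gaps of the pole orders;
    without these \<open>g\<close> values, \<open>M + g + 1\<close> orders remain.\<close>
  define I where "I = {i. i \<le> M + 2 * g \<and> (even i \<or> 2 * g + 1 \<le> i)}"
  have I: "finite I" "card I = M + g + 1"
  proof -
    have "I = (\<lambda>j. 2 * j) ` {..H + g} \<union> (\<lambda>j. 2 * j + 1) ` {g..<H + g}"
    proof (intro Set.set_eqI)
      fix i show "i \<in> I \<longleftrightarrow> i \<in> (\<lambda>j. 2 * j) ` {..H + g} \<union> (\<lambda>j. 2 * j + 1) ` {g..<H + g}"
      proof (cases "even i")
        case True
        then show ?thesis by (auto simp: I_def M elim!: evenE)
      next
        case False
        then obtain b where i: "i = 2 * b + 1" by (elim oddE)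
        have "i \<notin> (\<lambda>j. 2 * j) ` {..H + g}" using False by auto
        moreover have "i \<in> (\<lambda>j. 2 * j + 1) ` {g..<H + g} \<longleftrightarrow> g \<le> b \<and> b < H + g"
          unfolding i by auto
        moreover have "i \<in> I \<longleftrightarrow> g \<le> b \<and> b < H + g" using gH by (auto simp: I_def M i)
        ultimately show ?thesis by blast
      qed
    qed
    moreover have "(\<lambda>j. 2 * j) ` {..H + g} \<inter> (\<lambda>j. 2 * j + 1) ` {g..<H + g} = {}"
      by (auto; presburger)
    ultimately show "finite I" "card I = M + g + 1"
      by (simp_all add: card_Un_disjoint card_image inj_on_def M)
  qed
  have t0: "t i \<noteq> 0" for i by (simp add: t_def zero_prod_def)
  have nt: "degree (nm f (t i)) = i" if "i \<in> I" for i
  proof -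
    have "f \<noteq> 0" using f(1) by auto
    show ?thesis
    proof (cases "even i")
      case True
      then show ?thesis by (auto simp: t_def degree_mult_eq degree_monom_eq)
    next
      case False
      then obtain b where "i = 2 * b + 1" by (elim oddE)
      then show ?thesis using that f(1) \<open>f \<noteq> 0\<close>
        by (auto simp: t_def I_def degree_mult_eq degree_monom_eq)
    qed
  qed
  \<comment> \<open>\<open>V\<close> consists of the functions over \<open>F n\<close> of pole order
    at most \<open>M - 1\<close>, of dimension \<open>M - g\<close>; \<open>W\<close> of those of
    order at most \<open>M * M + 2 * g\<close>, of dimension \<open>M * M + g + 1\<close>. The
    domain of \<open>Psi\<close> is larger than \<open>W\<close> once (M - g)(M + g + 1) > M^2 + g +
    1, that is, M > (g + 1)^2: this is the hypothesis \<open>large\<close>.\<close>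
  define V where "V = FPd n H \<times> FPd n (H - g)"
  define W where "W = FPd n (2 * H * H + g + 1) \<times> FPd n (2 * H * H)"
  define Psi where "Psi s = (\<Sum>i\<in>I. cmul f ((csq f ^^ k) (s i)) (t i))" for s
  have V: "wle g (M - 1) v" "v \<in> FP n \<times> FP n" if "v \<in> V" for v
  proof -
    have v: "fst v \<in> FPd n H" "snd v \<in> FPd n (H - g)"
      using that by (auto simp: V_def)
    then show "v \<in> FP n \<times> FP n" by (auto simp: FPd_def mem_Times_iff)
    have "i < H" if "coeff (fst v) i \<noteq> 0" for i
      using v(1) that not_le by (auto simp: FPd_def)
    moreover have "i < H - g" if "coeff (snd v) i \<noteq> 0" for i
      using v(2) that not_le by (auto simp: FPd_def)
    ultimately show "wle g (M - 1) v"
      unfolding wle_def M using gH by fastforce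
  qed
  have WI: "w \<in> W" if w: "wle g (2 ^ k * (M - 1) + (M + 2 * g)) w" "w \<in> FP n \<times> FP n" for w
  proof -
    have e: "2 ^ k * (M - 1) + (M + 2 * g) = 4 * H * H + 2 * g"
      unfolding M_def[symmetric] M using gH by (cases H) (simp_all add: algebra_simps)
    have "coeff (fst w) i = 0" if "i \<ge> 2 * H * H + g + 1" for i
      using w(1) that unfolding e wle_def by force
    moreover have "coeff (snd w) i = 0" if "i \<ge> 2 * H * H" for i
      using w(1) that unfolding e wle_def by force
    ultimately show ?thesis using w(2) by (auto simp: W_def FPd_def mem_Times_iff)
  qed
  have tFP: "t i \<in> FP n \<times> FP n" for i by (simp add: t_def)
  have PsiW: "Psi s \<in> W" if "s \<in> I \<rightarrow>\<^sub>E V" for s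
  proof (rule WI)
    show "wle g (2 ^ k * (M - 1) + (M + 2 * g)) (Psi s)"
      unfolding Psi_def
    proof (intro wle_sum wle_cmul_csq f)
      fix i assume "i \<in> I"
      then show "wle g (M - 1) (s i)" using that V by blast
      show "wle g (M + 2 * g) (t i)"
        using nt[OF \<open>i \<in> I\<close>] \<open>i \<in> I\<close> by (simp add: wle_iff[OF f(1,2)] I_def)
    qed
    show "Psi s \<in> FP n \<times> FP n"
      unfolding Psi_def using that V by (intro FP_sum_pair FP_cmul FP_csq_funpow tFP f) blast+
  qed
  have cFP: "finite (FPd n d)" "card (FPd n d) = (M * M) ^ d" for d
    using card_FPd[OF finite_F, of d] by (simp_all add: card_F MM)
  have "card W < card (I \<rightarrow>\<^sub>E V)"
  proof -
    have "card W = (M * M) ^ (M * H + M * H + g + 1)" 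
      by (simp add: W_def card_cartesian_product cFP flip: power_add) (simp add: M)
    moreover have "card (I \<rightarrow>\<^sub>E V) = (M * M) ^ ((M - g) * (M + g + 1))"
    proof -
      have "H + (H - g) = M - g" using gH M by simp
      then show ?thesis
        using I by (simp only: V_def card_PiE card_cartesian_product cFP prod_constant
          power_add[symmetric] power_mult[symmetric])
    qed
    moreover have "M * H + M * H + g + 1 < (M - g) * (M + g + 1)"
    proof -
      have "g \<le> M" using gH M by simp
      then obtain r where r: "M = g + r" using le_Suc_ex by blast
      have "M * H + M * H = M * M" by (simp add: M)
      then show ?thesis using gM unfolding r by (simp add: algebra_simps)
    qed
    moreover have "M * M > 1" using gM f(2)
      by (metis M MM less_1_mult n_pos one_less_numeral_iff one_less_power semiring_norm(76))
    ultimately show ?thesis by (simp only: power_strict_increasing)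
  qed
  then have "\<not> inj_on Psi (I \<rightarrow>\<^sub>E V)"
    using PsiW card_inj_on_le[of Psi "I \<rightarrow>\<^sub>E V" W] cFP by (auto simp: W_def)
  then obtain s s' where ss: "s \<in> I \<rightarrow>\<^sub>E V" "s' \<in> I \<rightarrow>\<^sub>E V" "Psi s = Psi s'" "s \<noteq> s'"
    by (auto simp: inj_on_def)
  \<comment> \<open>In characteristic two this sum is the difference of the colliding families, so
    it lies in the kernel of the additive map \<open>Psi\<close>.\<close>
  define d where "d i = s i + s' i" for i
  define h where "h = (\<Sum>i\<in>I. cmul f (d i) ((csq f ^^ k) (t i)))"
  have pair_self: "v + v = 0" for v :: "'k poly \<times> 'k poly"
    by (cases v) (simp add: zero_prod_def)
  have d_wle: "wle g (M - 1) (d i)" if "i \<in> I" for i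
    unfolding d_def using ss that V by (intro wle_add) blast+
  have "Psi d = Psi s + Psi s'"
    by (simp add: Psi_def d_def csq_funpow_add cmul_add_left sum.distrib)
  then have Psi_d: "Psi d = 0" using ss(3) pair_self by simp
  have "h \<noteq> 0"
  proof
    assume "h = 0"
    have "d i = 0" if "i \<in> I" for i
    proof (rule distinct_pole_orders[OF f(1,2) I(1), where s = d and t = t and l = "M - 1" and k = k])
      show "M - 1 < 2 ^ k" by (simp add: M_def)
      show "inj_on (\<lambda>i. degree (nm f (t i))) I" using nt by (simp add: inj_on_def)
      show "(\<Sum>i\<in>I. cmul f (d i) ((csq f ^^ k) (t i))) = 0"
        using \<open>h = 0\<close> unfolding h_def .
    qed (use that d_wle t0 in blast)+
    then have "s i = s' i" if "i \<in> I" for i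
      using that pair_add_eq_0 unfolding d_def by blast
    then show False using ss by (metis PiE_ext)
  qed
  then have nh: "nm f h \<noteq> 0" using nm_eq_0_iff[OF f(1,2)] by blast
  have "cev h P = 0" if P: "P \<in> F n \<times> F n" "on_curve f P" for P
  proof -
    have ct: "cev (t i) P ^ (2 ^ n) = cev (t i) P" for i
      using P by (cases P) (auto simp: t_def poly_monom F_iff[symmetric] intro!: F_mult F_power)
    have "cev h P ^ (2 ^ k) = (\<Sum>i\<in>I. cev (d i) P ^ (2 ^ k) * cev (t i) P)"
      unfolding h_def cev_sum frob_sum cev_cmul[OF P(2)] cev_csq_funpow[OF P(2)] power_mult_distrib
      using ct by (simp add: n mult_2 power_add power_mult)
    also have "\<dots> = cev (Psi d) P"
      by (simp add: Psi_def cev_sum cev_cmul[OF P(2)] cev_csq_funpow[OF P(2)])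
    finally show ?thesis using Psi_d by simp
  qed
  then have "card {P \<in> F n \<times> F n. on_curve f P} \<le> card {P. on_curve f P \<and> cev h P = 0}"
    using card_curve_zeros[OF nh] by (intro card_mono) auto
  also have "\<dots> \<le> degree (nm f h)" by (rule card_curve_zeros[OF nh])
  also have "\<dots> \<le> M - 1 + 2 ^ k * (M + 2 * g)"
    unfolding wle_iff[OF f(1,2), symmetric] h_def
  proof (intro wle_sum wle_cmul_csq f d_wle)
    fix i assume "i \<in> I"
    then show "wle g (M + 2 * g) (t i)"
      using nt[OF \<open>i \<in> I\<close>] by (simp add: wle_iff[OF f(1,2)] I_def)
  qed
  also have "\<dots> \<le> 2 ^ n + (2 * g + 1) * 2 ^ k"
    using MM by (simp add: M_def algebra_simps)
  finally show ?thesis .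
qed

subsection \<open>The L-function of an exponential sum\<close>

lemma size_proots_alg_closed:
  fixes p :: "'a::alg_closed_field poly"
  assumes "p \<noteq> 0" shows "size (proots p) = degree p"
proof -
  obtain A where A: "size A = degree p" "p = smult (lead_coeff p) (\<Prod>x\<in>#A. [:-x, 1:])"
    using alg_closed_imp_factorization[OF assms] by blast
  have "proots (\<Prod>x\<in>#A. [:-x, 1:]) = A \<and> (\<Prod>x\<in>#A. [:-x, 1:]) \<noteq> 0"
    by (induction A) (auto simp: proots_mult simp del: mult_pCons_left)
  moreover have "proots p = proots (\<Prod>x\<in>#A. [:-x, 1:])"
    using assms by (subst A(2)) simp
  ultimately show ?thesis using A(1) by simp
qed

lemma sum_order_alg_closed:
  fixes p :: "'a::alg_closed_field poly"
  assumes "p \<noteq> 0"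
  shows "(\<Sum>x | poly p x = 0. order x p) = degree p"
  using size_proots_alg_closed[OF assms] assms by (simp add: size_multiset_overloaded_eq)

lemma prod_lessThan_add:
  fixes f :: "nat \<Rightarrow> 'a::comm_monoid_mult" and b :: nat
  shows "(\<Prod>i<a + b. f i) = (\<Prod>i<a. f i) * (\<Prod>i<b. f (a + i))"
  by (induction b) (simp_all add: mult.assoc)

locale char2_closed = char2 ty for ty :: "'k::alg_closed_field itself"
begin

text \<open>The polynomial T^(2^n) + T has derivative 1, so its roots in the algebraically closed
  field are simple and number \<open>2 ^ n\<close>.\<close>

lemma fin2_closed: assumes "n > 0" shows "fin2 TYPE('k) n"
proof unfold_locales
  define p :: "'k poly" where "p = monom 1 (2 ^ n) + [:0, 1:]"
  have one: "(1::nat) < 2 ^ n" using assms by (intro one_less_power) simp_all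
  have deg: "degree p = 2 ^ n"
    unfolding p_def using one by (subst degree_add_eq_left) (simp_all add: degree_monom_eq)
  have "pderiv p = 1"
    using assms by (simp add: p_def pderiv_add pderiv_monom pderiv_pCons power_0_left)
  have "p \<noteq> 0" using deg one by auto
  have "order x p = 1" if "poly p x = 0" for x
  proof -
    have "\<not> 2 \<le> order x p"
    proof
      assume "2 \<le> order x p"
      then have "[:-x, 1:]\<^sup>2 dvd p" using order_divides by blast
      then obtain h where h: "p = [:-x, 1:] * ([:-x, 1:] * h)"
        by (auto simp only: power2_eq_square mult.assoc elim: dvdE)
      have "poly (pderiv p) x = 0"
        unfolding h by (simp add: pderiv_mult pderiv_pCons del: mult_pCons_left)
      then show False using \<open>pderiv p = 1\<close> by simp
    qed
    moreover have "order x p \<noteq> 0" using that \<open>p \<noteq> 0\<close> order_root by blast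
    ultimately show ?thesis by linarith
  qed
  then have "card {x. poly p x = 0} = 2 ^ n"
    using sum_order_alg_closed[OF \<open>p \<noteq> 0\<close>] deg by simp
  moreover have "{x. poly p x = 0} = F n"
    by (auto simp: p_def poly_monom F_iff add_eq_0_iff2)
  ultimately show "card (F n) = 2 ^ n" by simp
qed (use assms CHAR2 in auto)

end

text \<open>\<open>D\<close> is the sum of the pole orders of \<open>gfun\<close>, 3 or 1 at
  infinity and 1 at 0, and each of them counted with one more minus 2 in total: the degree predicted
  for the L-function. Only the vanishing of its coefficients beyond \<open>D\<close> has to be
  proved.\<close>

locale lseries = char2_closed ty for ty :: "'k::alg_closed_field itself" +
  fixes m :: nat and \<alpha> \<beta> \<gamma> :: 'k and D :: nat
  assumes m_pos: "m > 0"
    and coeffs: "\<alpha> \<in> F m" "\<beta> \<in> F m" "\<gamma> \<in> F m" "\<gamma> \<noteq> 0"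
    and D: "\<alpha> \<noteq> 0 \<and> D = 4 \<or> \<alpha> = 0 \<and> \<beta> \<noteq> 0 \<and> D = 2"
begin

definition gfun :: "'k \<Rightarrow> 'k" where
  "gfun x = \<alpha> * x ^ 3 + \<beta> * x + \<gamma> / x"

definition fr :: "'k poly \<Rightarrow> 'k poly" where
  "fr p = map_poly (\<lambda>x. x ^ (2 ^ m)) p"

lemma coeff_fr [simp]: "coeff (fr p) i = coeff p i ^ (2 ^ m)"
  by (simp add: fr_def coeff_map_poly power_0_left)

lemma FP_iff_fr: "p \<in> FP m \<longleftrightarrow> fr p = p"
  by (auto simp: FP_def F_iff poly_eq_iff)

lemma fr_mult: "fr (p * r) = fr p * fr r"
  by (rule poly_eqI) (simp add: coeff_mult frob_sum power_mult_distrib)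

lemma fr_1 [simp]: "fr 1 = 1"
  by (rule poly_eqI) (simp add: power_0_left)

lemma fr_power: "fr (p ^ k) = fr p ^ k"
  by (induction k) (simp_all add: fr_mult)

lemma fr_prod: "fr (\<Prod>i\<in>I. f i) = (\<Prod>i\<in>I. fr (f i))"
  by (induction I rule: infinite_finite_induct) (simp_all add: fr_mult)

lemma fr_linear: "fr [:a, 1:] = [:a ^ (2 ^ m), 1:]"
  by (rule poly_eqI) (simp add: coeff_pCons power_0_left split: nat.split)

text \<open>These are the effective divisors of degree \<open>n\<close> over the ground field on the
  affine line without 0, the domain on which \<open>gfun\<close> is regular.\<close>

definition MP :: "nat \<Rightarrow> 'k poly set" where
  "MP n = {f \<in> FP m. degree f = n \<and> lead_coeff f = 1 \<and> coeff f 0 \<noteq> 0}"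

lemma MP_nonzero: "f \<in> MP n \<Longrightarrow> f \<noteq> 0"
  by (auto simp: MP_def)

lemma finite_MP: "finite (MP n)"
proof (rule finite_subset)
  interpret fin2 ty m using m_pos by (rule fin2_closed)
  show "MP n \<subseteq> FPd m (Suc n)" by (auto simp: MP_def FPd_def coeff_eq_0)
  show "finite (FPd m (Suc n))" using card_FPd[OF finite_F] by blast
qed

lemma MP_0: "MP 0 = {1}"
  by (auto simp: MP_def FP_def coeff_1 elim!: degree_eq_zeroE)

lemma MP_mult: assumes "f \<in> MP i" "h \<in> MP j" shows "f * h \<in> MP (i + j)"
proof -
  have "degree (f * h) = i + j"
    using assms MP_nonzero by (subst degree_mult_eq) (auto simp: MP_def)
  moreover have "lead_coeff (f * h) = 1"
    using assms by (subst lead_coeff_mult) (auto simp: MP_def)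
  ultimately show ?thesis using assms by (auto simp: MP_def coeff_mult_0)
qed

lemma MP_dvd:
  assumes "p \<in> MP j" "f \<in> MP n" "f = p * h" shows "j \<le> n" "h \<in> MP (n - j)"
proof -
  have nz: "f \<noteq> 0" "p \<noteq> 0" using assms MP_nonzero by blast+
  then have "h \<noteq> 0" unfolding assms(3) by simp
  note nz = nz this
  have "fr p = p" "fr f = f" using assms(1,2) by (simp_all add: MP_def FP_iff_fr)
  then have "p * fr h = p * h" unfolding assms(3) fr_mult by simp
  then have "fr h = h" using nz by simp
  moreover have "n = j + degree h" 
    using assms(1,2) nz unfolding assms(3) by (auto simp: MP_def degree_mult_eq)
  moreover have "lead_coeff h = 1"
    using assms(1,2) lead_coeff_mult[of p h] unfolding assms(3) by (auto simp: MP_def)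
  ultimately show "j \<le> n" "h \<in> MP (n - j)"
    using assms(1,2) unfolding assms(3) by (auto simp: MP_def FP_iff_fr coeff_mult_0)
qed

text \<open>For monic \<open>f\<close> the elementary symmetric functions of its roots. Reversal
  counts coefficients from the top, so that products become convolutions whatever the degrees, and
  indices beyond the degree give 0.\<close>

definition ec :: "'k poly \<Rightarrow> nat \<Rightarrow> 'k" where
  "ec f i = coeff (reflect_poly f) i"

text \<open>By Newton's identities in characteristic two, \<open>lam f\<close> is the sum of \<open>gfun\<close> over the
  roots of \<open>f\<close>.\<close>

definition lam :: "'k poly \<Rightarrow> 'k" where
  "lam f = \<alpha> * (ec f 1 ^ 3 + ec f 1 * ec f 2 + ec f 3) + \<beta> * ec f 1 + \<gamma> * (coeff f 1 / coeff f 0)"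

lemma lam_1 [simp]: "lam 1 = 0"
  by (simp add: lam_def ec_def coeff_1)

text \<open>Sums over roots are additive under products. In characteristic two the third power sum
  is e1^3 + e1 e2 + e3, and the sum of the inverse roots is \<open>coeff f 1 / coeff f 0\<close>;
  additivity is checked on these expressions without using roots.\<close>

lemma lam_mult:
  assumes "lead_coeff f = 1" "lead_coeff h = 1" "coeff f 0 \<noteq> 0" "coeff h 0 \<noteq> 0"
  shows "lam (f * h) = lam f + lam h"
proof -
  have e0: "ec f 0 = 1" "ec h 0 = 1" using assms by (simp_all add: ec_def)
  have ecm: "ec (f * h) i = (\<Sum>j\<le>i. ec f j * ec h (i - j))" for i
    by (simp add: ec_def reflect_poly_mult coeff_mult)
  have e1: "ec (f * h) 1 = ec f 1 + ec h 1"
    by (simp add: ecm e0 add.commute)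
  have e2: "ec (f * h) 2 = ec f 2 + ec f 1 * ec h 1 + ec h 2"
    by (simp add: ecm e0 numeral_2_eq_2 algebra_simps)
  have e3: "ec (f * h) 3 = ec f 3 + ec f 2 * ec h 1 + ec f 1 * ec h 2 + ec h 3"
    by (simp add: ecm e0 numeral_3_eq_3 numeral_2_eq_2 algebra_simps)
  have quot: "coeff (f * h) 1 / coeff (f * h) 0 = coeff f 1 / coeff f 0 + coeff h 1 / coeff h 0"
    using assms(3,4) by (simp add: coeff_mult field_simps)
  show ?thesis
    unfolding lam_def e1 e2 e3 quot by (simp add: power3_eq_cube algebra_simps)
qed

lemma lam_linear: "x \<noteq> 0 \<Longrightarrow> lam [:x, 1:] = gfun x"
  by (simp add: lam_def gfun_def ec_def coeff_reflect_poly coeff_pCons)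

lemma ec_F: "f \<in> FP m \<Longrightarrow> ec f i \<in> F m"
  by (simp add: ec_def coeff_reflect_poly FP_def)

lemma lam_F: "f \<in> FP m \<Longrightarrow> lam f \<in> F m"
  unfolding lam_def using coeffs ec_F[of f]
  by (intro F_add F_mult F_power F_divide) (auto simp: FP_def)

definition psi :: "'k poly \<Rightarrow> int" where
  "psi f = chi m (lam f)"

lemma psi_mult: "f \<in> MP i \<Longrightarrow> h \<in> MP j \<Longrightarrow> psi (f * h) = psi f * psi h"
  unfolding psi_def by (subst lam_mult) (auto simp: MP_def chi_add lam_F)

text \<open>For \<open>x \<in> F (m * j)\<close> the characteristic polynomial of \<open>x\<close>
  over the ground field: the power of the minimal polynomial that has degree
  \<open>j\<close>.\<close>

definition Phi :: "nat \<Rightarrow> 'k \<Rightarrow> 'k poly" where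
  "Phi j x = (\<Prod>i<j. [:x ^ (2 ^ (m * i)), 1:])"

lemma frob_frob: "(x ^ (2 ^ (m * i))) ^ (2 ^ (m * j)) = x ^ (2 ^ (m * (i + j)))" for x :: 'k
  by (simp add: algebra_simps power_add flip: power_mult)

lemma frob_Suc: "(x ^ (2 ^ (m * i))) ^ (2 ^ m) = x ^ (2 ^ (m * Suc i))" for x :: 'k
  using frob_frob[of x i 1] by simp

lemma lead_coeff_Phi: "lead_coeff (Phi j x) = 1" and degree_Phi: "degree (Phi j x) = j"
proof -
  show "degree (Phi j x) = j"
    unfolding Phi_def by (subst degree_prod_eq_sum_degree) auto
  show "lead_coeff (Phi j x) = 1" by (simp add: Phi_def lead_coeff_prod)
qed

lemma coeff_0_Phi: "x \<noteq> 0 \<Longrightarrow> coeff (Phi j x) 0 \<noteq> 0"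
  by (simp add: Phi_def poly_prod flip: poly_0_coeff_0)

lemma Phi_MP: assumes "x \<in> F (m * j)" "x \<noteq> 0" "j > 0" shows "Phi j x \<in> MP j"
proof -
  have "fr (Phi j x) = (\<Prod>i<j. [:x ^ (2 ^ (m * Suc i)), 1:])"
    by (simp only: Phi_def fr_prod fr_linear frob_Suc)
  moreover have "[:x ^ (2 ^ (m * 0)), 1:] * (\<Prod>i<j. [:x ^ (2 ^ (m * Suc i)), 1:]) =
      Phi j x * [:x ^ (2 ^ (m * j)), 1:]"
    unfolding Phi_def prod.lessThan_Suc_shift[of "\<lambda>i. [:x ^ (2 ^ (m * i)), 1:]", symmetric]
    by (rule prod.lessThan_Suc)
  moreover have "x ^ (2 ^ (m * j)) = x" using assms by (simp add: F_iff)
  ultimately have "[:x, 1:] * fr (Phi j x) = [:x, 1:] * Phi j x"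
    by (simp only: mult_0_right power_0 power_one_right) (simp only: mult.commute)
  then have "fr (Phi j x) = Phi j x" by (metis mult_cancel_left one_neq_zero pCons_eq_0_iff)
  then show ?thesis
    using assms by (simp add: MP_def FP_iff_fr degree_Phi lead_coeff_Phi[unfolded degree_Phi] coeff_0_Phi)
qed

lemma gfun_F: "x \<in> F (m * j) \<Longrightarrow> gfun x \<in> F (m * j)"
  unfolding gfun_def using coeffs F_dvd[of m "m * j"] by (intro F_add F_mult F_divide F_power) auto

lemma gfun_frob: "gfun (x ^ (2 ^ (m * i))) = gfun x ^ (2 ^ (m * i))"
proof -
  have "\<alpha> ^ (2 ^ (m * i)) = \<alpha>" "\<beta> ^ (2 ^ (m * i)) = \<beta>" "\<gamma> ^ (2 ^ (m * i)) = \<gamma>"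
    using coeffs F_dvd[of m "m * i"] by (auto simp: F_iff)
  then show ?thesis
    by (simp add: gfun_def frob_add power_mult_distrib power_divide power_mult[symmetric] mult.commute)
qed

lemma tr_tower: "tr m (\<Sum>i<j. z ^ (2 ^ (m * i))) = tr (m * j) z"
proof (induction j)
  case (Suc j)
  have "tr (a + b) z = tr a z + tr b (z ^ (2 ^ a))" for a b
    by (induction b) (simp_all add: tr_def power_add power_mult[symmetric] add.assoc)
  from this[of "m * j" m] show ?case using Suc by (simp add: tr_add add.commute)
qed (simp add: tr_def power_0_left)

lemma psi_Phi: assumes "x \<noteq> 0" shows "psi (Phi j x) = chi (m * j) (gfun x)"
proof -
  have "lam (Phi j x) = (\<Sum>i<j. gfun (x ^ (2 ^ (m * i))))"
  proof (induction j)
    case (Suc j)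
    have "lam (Phi (Suc j) x) = lam (Phi j x * [:x ^ (2 ^ (m * j)), 1:])"
      by (simp add: Phi_def)
    also have "\<dots> = lam (Phi j x) + lam [:x ^ (2 ^ (m * j)), 1:]"
      using assms by (intro lam_mult lead_coeff_Phi coeff_0_Phi) auto
    finally show ?case using Suc assms by (simp add: lam_linear)
  qed (simp add: Phi_def)
  then show ?thesis by (simp add: psi_def chi_def gfun_frob tr_tower)
qed

lemma order_frob:
  assumes "f \<in> FP m" "f \<noteq> 0" shows "order x f \<le> order (x ^ (2 ^ m)) f"
proof -
  have "[:x, 1:] ^ order x f dvd f" using order_1[of x f] by simp
  then obtain h where h: "f = [:x, 1:] ^ order x f * h" by blast
  have "f = fr f" using assms by (simp add: FP_iff_fr)
  also have "\<dots> = [:x ^ (2 ^ m), 1:] ^ order x f * fr h"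
    by (subst h) (simp add: fr_mult fr_power fr_linear)
  finally have "[:x ^ (2 ^ m), 1:] ^ order x f dvd f" by (metis dvd_triv_left)
  then show ?thesis using order_divides[of "x ^ (2 ^ m)" "order x f" f] assms by simp
qed

lemma order_frob_iter:
  assumes "f \<in> FP m" "f \<noteq> 0" shows "order x f \<le> order (x ^ (2 ^ (m * i))) f"
proof (induction i)
  case (Suc i)
  then show ?case using order_frob[OF assms, of "x ^ (2 ^ (m * i))"] by (simp only: frob_Suc)
qed simp

lemma prod_linear_powers_dvd:
  fixes f :: "'k poly"
  assumes "f \<noteq> 0" "finite I" "inj_on r I" "\<And>i. i \<in> I \<Longrightarrow> k \<le> order (r i) f"
  shows "(\<Prod>i\<in>I. [:r i, 1:] ^ k) dvd f"
  using assms(2-)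
proof (induction I)
  case (insert i I)
  let ?P = "\<Prod>i\<in>I. [:r i, 1:] ^ k"
  have "?P dvd f" using insert by simp
  then obtain h where h: "f = ?P * h" by blast
  have "poly ?P (r i) \<noteq> 0"
    using insert by (auto simp: poly_prod prod_zero_iff add_eq_0_iff2 inj_on_def)
  then have "order (r i) f = order (r i) h"
    using assms(1) h by (simp add: order_mult order_0I)
  then have "k \<le> order (r i) h" using insert.prems(2)[of i] by simp
  then have "[:r i, 1:] ^ k dvd h" using order_divides[of "r i" k h] by simp
  then have "[:r i, 1:] ^ k * ?P dvd f" by (subst h) (simp add: mult.commute mult_dvd_mono)
  then show ?case using insert by simp
qed simp

text \<open>Let \<open>d\<close> be the degree of \<open>x\<close> over the ground field. Then
  \<open>x \<in> F (m * j)\<close> means that \<open>d\<close> divides \<open>j\<close>, and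
  \<open>Phi (d * k) x\<close>, being the \<open>k\<close>-th power of the minimal polynomial,
  divides \<open>f\<close> exactly for \<open>k\<close> up to the multiplicity of
  \<open>x\<close>.\<close>

lemma card_Phi_dvd:
  assumes f: "f \<in> MP n" and x: "poly f x = 0"
  shows "card {j \<in> {1..n}. x \<in> F (m * j) \<and> Phi j x dvd f} = order x f"
proof -
  have fm: "f \<in> FP m" "f \<noteq> 0" "degree f = n" using f MP_nonzero by (auto simp: MP_def)
  let ?o = "\<lambda>i. x ^ (2 ^ (m * i))"
  have eq_iff: "?o (i + e) = ?o i \<longleftrightarrow> ?o e = x" for i e
    using frob_eq_iff[of "?o e" "m * i" x] by (simp only: frob_frob add.commute)
  have "order x f > 0" using fm x by (simp add: order_gt_0_iff)
  then have "poly f (?o i) = 0" for i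
    using order_frob_iter[OF fm(1,2), of x i] order_gt_0_iff[OF fm(2), of "?o i"] by linarith
  \<comment> \<open>All conjugates of \<open>x\<close> are roots of \<open>f\<close>, so two of them
    coincide; injectivity of Frobenius turns the coincidence into a return to
    \<open>x\<close>.\<close>
  then have "\<not> inj ?o"
    using finite_subset[OF _ poly_roots_finite[OF fm(2)], of "range ?o"] finite_imageD by blast
  then obtain i i' where ii: "?o i = ?o i'" "i < i'"
    by (auto simp: inj_def) (metis linorder_neqE_nat)
  then have "?o (i' - i) = x" using eq_iff[of i "i' - i"] by simp
  then have ex: "\<exists>d. d > 0 \<and> ?o d = x" using ii by (intro exI[of _ "i' - i"]) simp
  define d where "d = (LEAST d. d > 0 \<and> ?o d = x)"
  have d: "d > 0" "?o d = x" using LeastI_ex[OF ex] by (simp_all add: d_def)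
  have dmin: "d \<le> e" if "e > 0" "?o e = x" for e
    using that by (auto simp: d_def intro: Least_le)
  have dk: "?o (d * k) = x" for k
    using F_dvd[of "m * d" "m * (d * k)" x] d by (simp add: F_iff)
  have Fj: "x \<in> F (m * j) \<longleftrightarrow> d dvd j" for j
  proof
    assume "x \<in> F (m * j)"
    then have "?o (d * (j div d) + j mod d) = x" by (simp add: F_iff)
    then have "?o (j mod d) = x" using eq_iff[of "d * (j div d)" "j mod d"] dk by simp
    then have "j mod d = 0" using dmin[of "j mod d"] d(1) by (metis mod_less_divisor not_le not_gr_zero)
    then show "d dvd j" by (simp add: mod_eq_0_iff_dvd)
  next
    assume "d dvd j" then show "x \<in> F (m * j)" using dk by (auto simp: F_iff)
  qed
  have inj: "inj_on ?o {..<d}"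
  proof -
    have "False" if "i < i'" "i' < d" "?o i = ?o i'" for i i'
      using eq_iff[of i "i' - i"] dmin[of "i' - i"] that by simp
    then show ?thesis by (auto simp: inj_on_def) (metis linorder_neqE_nat)
  qed
  have Phi_power: "Phi (d * k) x = (\<Prod>i<d. [:?o i, 1:] ^ k)" for k
  proof (induction k)
    case (Suc k)
    have "?o (d * k + i) = ?o i" for i
      using frob_frob[of x "d * k" i] dk by simp
    then have "Phi (d * k + d) x = Phi (d * k) x * (\<Prod>i<d. [:?o i, 1:])"
      by (simp only: Phi_def prod_lessThan_add)
    then show ?case
      using Suc by (simp only: prod.distrib mult_Suc_right add.commute power_Suc2)
  qed (simp add: Phi_def)
  have Phi_dvd: "Phi (d * k) x dvd f \<longleftrightarrow> k \<le> order x f" for k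
  proof
    assume "Phi (d * k) x dvd f"
    moreover have "[:?o 0, 1:] ^ k dvd Phi (d * k) x"
      unfolding Phi_power using d(1) by (intro dvd_prodI) auto
    ultimately have "[:x, 1:] ^ k dvd f" by (simp add: dvd_trans)
    then show "k \<le> order x f" using order_divides[of x k f] fm by simp
  next
    assume "k \<le> order x f"
    then show "Phi (d * k) x dvd f"
      unfolding Phi_power using order_frob_iter[OF fm(1,2), of x]
      by (intro prod_linear_powers_dvd fm inj) (auto intro: order.trans)
  qed
  have "{j \<in> {1..n}. x \<in> F (m * j) \<and> Phi j x dvd f} = (\<lambda>k. d * k) ` {1..order x f}"
  proof (intro Set.set_eqI iffI)
    fix j assume "j \<in> {j \<in> {1..n}. x \<in> F (m * j) \<and> Phi j x dvd f}"
    then have j: "j \<ge> 1" "d dvd j" "Phi j x dvd f" using Fj by simp_all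
    then obtain k where k: "j = d * k" by blast
    then have "1 \<le> k" "k \<le> order x f" using j Phi_dvd by (cases k, simp_all)
    then show "j \<in> (\<lambda>k. d * k) ` {1..order x f}" unfolding k by (intro imageI) simp
  next
    fix j assume "j \<in> (\<lambda>k. d * k) ` {1..order x f}"
    then obtain k where k: "j = d * k" "1 \<le> k" "k \<le> order x f"
      by (metis (no_types, lifting) imageE atLeastAtMost_iff)
    then have dvd: "Phi j x dvd f" using Phi_dvd by simp
    then have "j \<le> n" using dvd_imp_degree_le[OF dvd fm(2)] fm(3) by (simp add: degree_Phi)
    then show "j \<in> {j \<in> {1..n}. x \<in> F (m * j) \<and> Phi j x dvd f}"
      using k d(1) dvd Fj by auto
  qed
  moreover have "inj_on (\<lambda>k. d * k) {1..order x f}" using d(1) by (simp add: inj_on_def)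
  ultimately show ?thesis by (simp add: card_image)
qed

lemma finite_F_mult: "j > 0 \<Longrightarrow> finite (F (m * j))"
  using fin2.finite_F[OF fin2_closed[of "m * j"]] m_pos by simp

text \<open>Counted root by root, each root contributes its multiplicity. This identity stands in
  for unique factorization and the logarithmic derivative of the Euler product.\<close>

lemma sum_card_Phi_dvd:
  assumes f: "f \<in> MP n"
  shows "(\<Sum>j\<in>{1..n}. card {x \<in> F (m * j) - {0}. Phi j x dvd f}) = n"
proof -
  have fm: "f \<noteq> 0" "degree f = n" "coeff f 0 \<noteq> 0" using f MP_nonzero by (auto simp: MP_def)
  let ?R = "{x. poly f x = 0}"
  have finR: "finite ?R" using fm by (simp add: poly_roots_finite)
  have eq: "{x \<in> F (m * j) - {0}. Phi j x dvd f} = {x \<in> ?R. x \<in> F (m * j) \<and> Phi j x dvd f}"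
    if "j \<ge> 1" for j
  proof -
    have "poly f x = 0" if "Phi j x dvd f" for x
    proof -
      have "poly (Phi j x) x = 0"
        using \<open>j \<ge> 1\<close> by (auto simp: Phi_def poly_prod prod_zero_iff intro!: bexI[of _ 0])
      then show ?thesis using that poly_eq_0_iff_dvd dvd_trans by blast
    qed
    moreover have "x \<noteq> 0" if "poly f x = 0" for x
      using that fm(3) by (auto simp: poly_0_coeff_0)
    ultimately show ?thesis by blast
  qed
  have "(\<Sum>j\<in>{1..n}. card {x \<in> F (m * j) - {0}. Phi j x dvd f}) =
      (\<Sum>j\<in>{1..n}. \<Sum>x\<in>?R. if x \<in> F (m * j) \<and> Phi j x dvd f then 1 else 0)"
  proof (intro sum.cong refl)
    fix j assume "j \<in> {1..n}"
    then show "card {x \<in> F (m * j) - {0}. Phi j x dvd f} =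
        (\<Sum>x\<in>?R. if x \<in> F (m * j) \<and> Phi j x dvd f then 1 else 0)"
      using finR by (subst eq) (simp_all add: sum.If_cases Int_def)
  qed
  also have "\<dots> = (\<Sum>x\<in>?R. \<Sum>j\<in>{1..n}. if x \<in> F (m * j) \<and> Phi j x dvd f then 1 else 0)"
    by (rule sum.swap)
  also have "\<dots> = (\<Sum>x\<in>?R. order x f)"
    using card_Phi_dvd[OF f] by (intro sum.cong refl) (simp add: sum.If_cases Int_def)
  also have "\<dots> = n" using sum_order_alg_closed[OF fm(1)] fm(2) by simp
  finally show ?thesis .
qed

section \<open>Coefficients of the L-function\<close>

definition acoef :: "nat \<Rightarrow> int" where
  "acoef n = (\<Sum>f\<in>MP n. psi f)"

definition Ssum :: "nat \<Rightarrow> int" where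
  "Ssum j = (\<Sum>x\<in>F (m * j) - {0}. chi (m * j) (gfun x))"

lemma acoef_0: "acoef 0 = 1"
  by (simp add: acoef_def MP_0 psi_def)

text \<open>Coefficientwise this is T L'(T) = L(T) (S_1 T + S_2 T^2 + ...). The factor
  \<open>n\<close> is distributed over pairs \<open>j\<close>, \<open>x\<close> with
  \<open>Phi j x\<close> dividing \<open>f\<close>; writing \<open>f\<close> as
  \<open>Phi j x * h\<close> splits \<open>psi f\<close> into a term of \<open>Ssum j\<close> and a
  term of \<open>acoef (n - j)\<close>.\<close>

lemma acoef_recurrence: "int n * acoef n = (\<Sum>j\<in>{1..n}. Ssum j * acoef (n - j))"
proof -
  have "int n * acoef n = (\<Sum>f\<in>MP n. int n * psi f)"
    by (simp add: acoef_def sum_distrib_left)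
  also have "\<dots> = (\<Sum>f\<in>MP n. \<Sum>j\<in>{1..n}. \<Sum>x\<in>F (m * j) - {0}. if Phi j x dvd f then psi f else 0)"
  proof (rule sum.cong[OF refl])
    fix f assume "f \<in> MP n"
    then have "int n = (\<Sum>j\<in>{1..n}. int (card {x \<in> F (m * j) - {0}. Phi j x dvd f}))"
      using sum_card_Phi_dvd[of f n] by (simp only: of_nat_sum[symmetric])
    then have "int n * psi f = (\<Sum>j\<in>{1..n}. int (card {x \<in> F (m * j) - {0}. Phi j x dvd f}) * psi f)"
      by (simp only: sum_distrib_right)
    also have "\<dots> = (\<Sum>j\<in>{1..n}. \<Sum>x\<in>F (m * j) - {0}. if Phi j x dvd f then psi f else 0)"
    proof (rule sum.cong[OF refl])
      fix j assume "j \<in> {1..n}"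
      then have "finite (F (m * j) - {0})" using finite_F_mult by simp
      then show "int (card {x \<in> F (m * j) - {0}. Phi j x dvd f}) * psi f =
          (\<Sum>x\<in>F (m * j) - {0}. if Phi j x dvd f then psi f else 0)"
        by (simp add: sum.If_cases Int_def)
    qed
    finally show "int n * psi f =
        (\<Sum>j\<in>{1..n}. \<Sum>x\<in>F (m * j) - {0}. if Phi j x dvd f then psi f else 0)" .
  qed
  also have "\<dots> = (\<Sum>j\<in>{1..n}. \<Sum>x\<in>F (m * j) - {0}. \<Sum>f\<in>MP n. if Phi j x dvd f then psi f else 0)"
    by (subst sum.swap) (rule sum.cong[OF refl sum.swap])
  also have "\<dots> = (\<Sum>j\<in>{1..n}. \<Sum>x\<in>F (m * j) - {0}. chi (m * j) (gfun x) * acoef (n - j))"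
  proof (rule sum.cong[OF refl], rule sum.cong[OF refl])
    fix j x assume j: "j \<in> {1..n}" and x: "x \<in> F (m * j) - {0}"
    have Phi: "Phi j x \<in> MP j" using Phi_MP x j by simp
    have "(\<Sum>f\<in>MP n. if Phi j x dvd f then psi f else 0) = (\<Sum>f\<in>{f \<in> MP n. Phi j x dvd f}. psi f)"
      using finite_MP by (simp add: sum.If_cases Int_def)
    also have "\<dots> = (\<Sum>h\<in>MP (n - j). psi (Phi j x * h))"
    proof (rule sum.reindex_cong)
      show "inj_on (\<lambda>h. Phi j x * h) (MP (n - j))"
        using MP_nonzero[OF Phi] by (simp add: inj_on_def)
      show "{f \<in> MP n. Phi j x dvd f} = (\<lambda>h. Phi j x * h) ` MP (n - j)"
      proof (intro Set.set_eqI iffI)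
        fix f assume "f \<in> {f \<in> MP n. Phi j x dvd f}"
        then obtain h where h: "f \<in> MP n" "f = Phi j x * h" by blast
        then show "f \<in> (\<lambda>h. Phi j x * h) ` MP (n - j)" using MP_dvd(2)[OF Phi h] by blast
      next
        fix f assume "f \<in> (\<lambda>h. Phi j x * h) ` MP (n - j)"
        then obtain h where "h \<in> MP (n - j)" "f = Phi j x * h" by blast
        then show "f \<in> {f \<in> MP n. Phi j x dvd f}"
          using MP_mult[OF Phi, of h "n - j"] j by simp
      qed
    qed simp
    also have "\<dots> = (\<Sum>h\<in>MP (n - j). chi (m * j) (gfun x) * psi h)"
      using x by (intro sum.cong refl) (simp add: psi_mult[OF Phi] psi_Phi)
    finally show "(\<Sum>f\<in>MP n. if Phi j x dvd f then psi f else 0) = chi (m * j) (gfun x) * acoef (n - j)"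
      by (simp add: acoef_def sum_distrib_left)
  qed
  also have "\<dots> = (\<Sum>j\<in>{1..n}. Ssum j * acoef (n - j))"
    by (simp add: Ssum_def sum_distrib_right)
  finally show ?thesis .
qed

text \<open>The involution \<open>h\<close> changes only the coefficient of T and shifts
  \<open>lam\<close> by an element of trace 1, so it reverses the sign of \<open>psi\<close>. For
  \<open>n > D\<close> that coefficient is none of the top ones entering \<open>lam\<close>:
  \<open>ec f 1\<close> to \<open>ec f 3\<close>, or \<open>ec f 1\<close> alone if
  \<open>\<alpha> = 0\<close>.\<close>

lemma acoef_eq_0: assumes "n > D" shows "acoef n = 0"
proof -
  interpret fin2 ty m using m_pos by (rule fin2_closed)
  obtain w where w: "w \<in> F m" "tr m w = 1" by (rule exists_tr_1)
  define y where "y = w / \<gamma>"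
  have y: "y \<in> F m" "\<gamma> * y = w" using w coeffs by (auto simp: y_def)
  define h where "h f = f + monom (coeff f 0 * y) 1" for f
  have n: "n \<ge> 3" using assms D by auto
  have ch: "coeff (h f) i = (if i = 1 then coeff f 1 + coeff f 0 * y else coeff f i)" for f i
    by (auto simp: h_def)
  have deg: "degree (h f) = n" if "f \<in> MP n" for f
  proof -
    have "degree (monom (coeff f 0 * y) 1) < degree f"
      using that n by (intro le_less_trans[OF degree_monom_le]) (auto simp: MP_def)
    then show ?thesis using that by (simp add: h_def degree_add_eq_left MP_def)
  qed
  have hMP: "h f \<in> MP n" if "f \<in> MP n" for f
    using that deg[OF that] n y by (auto simp: MP_def FP_def ch)
  have hh: "h (h f) = f" for f by (rule poly_eqI) (simp add: ch)
  have psi: "psi (h f) = - psi f" if f: "f \<in> MP n" for f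
  proof -
    have ec: "ec (h f) i = ec f i" if "n - i \<noteq> 1" for i
      using that f deg[OF f] by (auto simp: ec_def coeff_reflect_poly ch MP_def)
    have "lam (h f) = lam f + \<gamma> * y"
    proof -
      have "ec (h f) 1 = ec f 1" using n by (intro ec) auto
      moreover have "\<alpha> \<noteq> 0 \<Longrightarrow> ec (h f) 2 = ec f 2 \<and> ec (h f) 3 = ec f 3"
        using D assms by (intro conjI ec) auto
      moreover have "coeff (h f) 1 / coeff (h f) 0 = coeff f 1 / coeff f 0 + y"
        using f by (auto simp: ch MP_def field_simps)
      ultimately show ?thesis
        unfolding lam_def by (cases "\<alpha> = 0") (simp_all add: algebra_simps)
    qed
    then show ?thesis
      using f y w lam_F[of f] by (simp add: psi_def chi_add MP_def) (simp add: chi_def)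
  qed
  have "acoef n = (\<Sum>f\<in>MP n. psi (h f))"
    unfolding acoef_def by (rule sum.reindex_bij_witness[of _ h h]) (auto simp: hMP hh)
  also have "\<dots> = - acoef n" by (simp add: acoef_def psi sum_negf)
  finally show ?thesis by simp
qed

end

subsection \<open>From bounds over extensions to the bound over the ground field\<close>

lemma fps_log_deriv_prod_linear:
  fixes xs :: "complex list"
  defines "L \<equiv> \<Prod>\<alpha>\<leftarrow>xs. 1 - fps_const \<alpha> * fps_X"
  shows "fps_X * fps_deriv L = L * Abs_fps (\<lambda>n. if n = 0 then 0 else - (\<Sum>\<alpha>\<leftarrow>xs. \<alpha> ^ n))"
  unfolding L_def
proof (induction xs)
  case Nil
  have "Abs_fps (\<lambda>n. if n = 0 then 0 else - (\<Sum>\<alpha>\<leftarrow>[]. \<alpha> ^ n)) = (0 :: complex fps)"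
    by (simp add: fps_eq_iff)
  then show ?case by simp
next
  case (Cons \<beta> xs)
  let ?L = "\<Prod>\<alpha>\<leftarrow>xs. 1 - fps_const \<alpha> * fps_X :: complex fps"
  let ?s = "\<lambda>xs. Abs_fps (\<lambda>n. if n = 0 then 0 else - (\<Sum>\<alpha>\<leftarrow>xs. \<alpha> ^ n)) :: complex fps"
  let ?t = "Abs_fps (\<lambda>n. if n = 0 then 0 else - (\<beta> ^ n)) :: complex fps"
  have s: "?s (\<beta> # xs) = ?t + ?s xs"
    by (simp add: fps_eq_iff)
  have t: "(1 - fps_const \<beta> * fps_X) * ?t = - (fps_const \<beta> * fps_X)"
  proof (rule fps_ext)
    fix n
    show "fps_nth ((1 - fps_const \<beta> * fps_X) * ?t) n = fps_nth (- (fps_const \<beta> * fps_X)) n"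
      by (cases n) (auto simp: ring_distribs mult.assoc)
  qed
  have "fps_X * fps_deriv ((1 - fps_const \<beta> * fps_X) * ?L) =
      (1 - fps_const \<beta> * fps_X) * (fps_X * fps_deriv ?L) + (- (fps_const \<beta> * fps_X)) * ?L"
    by (simp add: algebra_simps)
  also have "\<dots> = ((1 - fps_const \<beta> * fps_X) * ?L) * (?t + ?s xs)"
    unfolding Cons t[symmetric] by (simp add: algebra_simps)
  finally show ?case unfolding s by simp
qed

lemma power_sums_of_recurrence:
  fixes a S :: "nat \<Rightarrow> int"
  assumes a0: "a 0 = 1" and aD: "\<And>n. n > D \<Longrightarrow> a n = 0"
    and rec: "\<And>n. int n * a n = (\<Sum>j\<in>{1..n}. S j * a (n - j))"
  obtains xs :: "complex list" where "length xs = D"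
    and "\<And>n. n \<ge> 1 \<Longrightarrow> of_int (S n) = - (\<Sum>\<alpha>\<leftarrow>xs. \<alpha> ^ n)"
proof -
  \<comment> \<open>\<open>R\<close> is T^D L(1/T), monic because \<open>a 0 = 1\<close>; its roots
    are the inverse roots of L. If L has degree below \<open>D\<close>, the list is filled up with
    zeros, which do not affect power sums of positive exponent.\<close>
  define R :: "complex poly" where "R = (\<Sum>i\<le>D. monom (of_int (a i)) (D - i))"
  have cR: "coeff R j = (if j \<le> D then of_int (a (D - j)) else 0)" for j
  proof -
    have "coeff R j = (\<Sum>i\<le>D. if i = D - j \<and> j \<le> D then of_int (a i) else 0)"
      unfolding R_def coeff_sum by (intro sum.cong) auto
    also have "\<dots> = (if j \<le> D then of_int (a (D - j)) else 0)"
      by (cases "j \<le> D") (simp_all)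
    finally show ?thesis .
  qed
  have degR: "degree R = D"
    using a0 by (intro antisym degree_le le_degree) (auto simp: cR)
  have lcR: "lead_coeff R = 1" using a0 by (simp add: degR cR)
  then obtain A where A: "size A = D" "R = (\<Prod>x\<in>#A. [:-x, 1:])"
    using alg_closed_imp_factorization[of R] degR by force
  obtain xs where xs: "mset xs = A" using ex_mset by blast
  have R: "R = (\<Prod>x\<leftarrow>xs. [:-x, 1:])" unfolding A(2) xs[symmetric] by (induction xs) simp_all
  define L where "L = Abs_fps (\<lambda>n. of_int (a n) :: complex)"
  have "L = fps_of_poly (reflect_poly R)"
    by (rule fps_ext) (auto simp: L_def coeff_reflect_poly degR cR aD)
  also have "\<dots> = (\<Prod>\<alpha>\<leftarrow>xs. 1 - fps_const \<alpha> * fps_X)"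
    unfolding R
  proof (induction xs)
    case (Cons y ys)
    have "fps_of_poly (reflect_poly [:-y, 1:]) = 1 - fps_const y * fps_X"
      by (simp add: reflect_poly_pCons' fps_of_poly_add fps_of_poly_monom fps_of_poly_const
        reflect_poly_def fps_of_poly_pCons)
    then show ?case using Cons
      by (simp only: list.map prod_list.Cons reflect_poly_mult fps_of_poly_mult)
  qed simp
  finally have L: "L = (\<Prod>\<alpha>\<leftarrow>xs. 1 - fps_const \<alpha> * fps_X)" .
  define T where "T = Abs_fps (\<lambda>n. if n = 0 then 0 else of_int (S n) :: complex)"
  have "fps_X * fps_deriv L = L * T"
  proof (rule fps_ext)
    fix n
    have "fps_nth (T * L) n = (\<Sum>j=0..n. of_int ((if j = 0 then 0 else S j) * a (n - j)))"
      unfolding fps_mult_nth by (intro sum.cong) (auto simp: T_def L_def)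
    also have "\<dots> = of_int (\<Sum>j\<in>{0..n}. (if j = 0 then 0 else S j) * a (n - j))" by simp
    also have "(\<Sum>j\<in>{0..n}. (if j = 0 then 0 else S j) * a (n - j)) = (\<Sum>j\<in>{1..n}. S j * a (n - j))"
      by (rule sum.mono_neutral_cong_right) auto
    also have "\<dots> = int n * a n" by (simp add: rec)
    finally show "fps_nth (fps_X * fps_deriv L) n = fps_nth (L * T) n"
      by (cases n) (simp_all add: L_def mult.commute)
  qed
  then have "L * T = L * Abs_fps (\<lambda>n. if n = 0 then 0 else - (\<Sum>\<alpha>\<leftarrow>xs. \<alpha> ^ n))"
    using fps_log_deriv_prod_linear[of xs] unfolding L by (rule subst)
  moreover have "L \<noteq> 0"
    using a0 by (auto simp: L_def fps_eq_iff intro!: exI[of _ 0])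
  ultimately have T: "T = Abs_fps (\<lambda>n. if n = 0 then 0 else - (\<Sum>\<alpha>\<leftarrow>xs. \<alpha> ^ n))"
    by simp
  have "of_int (S n) = - (\<Sum>\<alpha>\<leftarrow>xs. \<alpha> ^ n)" if "n \<ge> 1" for n
    using arg_cong[OF T, of "\<lambda>f. fps_nth f n"] that by (simp add: T_def)
  moreover have "length xs = D" using A(1) xs by auto
  ultimately show ?thesis using that by blast
qed

lemma not_bounded_by_smaller_power:
  fixes x r :: real
  assumes "0 < r" "r < x" "0 < c"
  shows "\<not> (\<forall>N\<ge>N0. c * x ^ (2 * N) \<le> C * r ^ (2 * N))"
proof
  assume *: "\<forall>N\<ge>N0. c * x ^ (2 * N) \<le> C * r ^ (2 * N)"
  have gt1: "1 < x / r" using assms by simp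
  obtain N1 where N1: "C / c < (x / r) ^ N1" using real_arch_pow[OF gt1] by blast
  define N where "N = max N0 N1"
  have "(x / r) ^ N1 \<le> (x / r) ^ (2 * N)"
    using gt1 by (intro power_increasing) (auto simp: N_def)
  then have "C / c < x ^ (2 * N) / r ^ (2 * N)" using N1 by (simp add: power_divide)
  then have "C * r ^ (2 * N) < c * x ^ (2 * N)" using assms by (simp add: field_simps)
  then show False using * by (auto simp: N_def dest: spec[of _ N])
qed

text \<open>A polynomial \<open>P\<close> vanishing at the squares of all other roots combines
  shifted power sums into a nonzero multiple of \<open>\<alpha>0 ^ (2 * N)\<close>. The combination
  still grows at most like \<open>r ^ (2 * N)\<close>, which excludes
  \<open>norm \<alpha>0 > r\<close>. Only the squares are separated, as only even exponents are
  available.\<close>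

lemma bound_from_even_power_sums:
  fixes xs :: "complex list" and r :: real
  assumes "r > 0"
    and bound: "\<And>k. k \<ge> k0 \<Longrightarrow> norm (\<Sum>\<alpha>\<leftarrow>xs. \<alpha> ^ (2 * k)) \<le> C * r ^ (2 * k)"
    and "\<alpha>0 \<in> set xs"
  shows "norm \<alpha>0 \<le> r"
proof (rule ccontr)
  assume "\<not> norm \<alpha>0 \<le> r"
  define B where "B = (\<lambda>\<alpha>. \<alpha>\<^sup>2) ` set xs - {\<alpha>0\<^sup>2}"
  define P where "P = (\<Prod>\<beta>\<in>B. [:-\<beta>, 1:])"
  have finB: "finite B" by (simp add: B_def)
  have P0: "poly P (\<alpha>0\<^sup>2) \<noteq> 0" using finB by (auto simp: P_def poly_prod B_def)
  have PB: "poly P \<beta> = 0" if "\<beta> \<in> B" for \<beta>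
    using finB that by (auto simp: P_def poly_prod prod_zero_iff)
  define cnt where "cnt = length (filter (\<lambda>\<alpha>. \<alpha>\<^sup>2 = \<alpha>0\<^sup>2) xs)"
  have cnt: "cnt > 0" using assms(3) by (auto simp: cnt_def length_greater_0_conv filter_empty_conv)
  have key: "(\<Sum>\<alpha>\<leftarrow>ys. \<alpha> ^ (2 * N) * poly P (\<alpha>\<^sup>2)) =
      of_nat (length (filter (\<lambda>\<alpha>. \<alpha>\<^sup>2 = \<alpha>0\<^sup>2) ys)) * (\<alpha>0 ^ (2 * N) * poly P (\<alpha>0\<^sup>2))"
    if "set ys \<subseteq> set xs" for ys N
    using that
  proof (induction ys)
    case (Cons y ys)
    have "y ^ (2 * N) * poly P (y\<^sup>2) =
        (if y\<^sup>2 = \<alpha>0\<^sup>2 then \<alpha>0 ^ (2 * N) * poly P (\<alpha>0\<^sup>2) else 0)"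
      using Cons.prems PB by (auto simp: B_def power_mult)
    then show ?case using Cons by (simp add: algebra_simps)
  qed simp
  define C' where "C' = (\<Sum>i\<le>degree P. norm (coeff P i) * C * r ^ (2 * i))"
  have "of_nat cnt * norm (poly P (\<alpha>0\<^sup>2)) * norm \<alpha>0 ^ (2 * N) \<le> C' * r ^ (2 * N)" if "N \<ge> k0" for N
  proof -
    have "of_nat cnt * (\<alpha>0 ^ (2 * N) * poly P (\<alpha>0\<^sup>2)) =
        (\<Sum>\<alpha>\<leftarrow>xs. \<Sum>i\<le>degree P. coeff P i * \<alpha> ^ (2 * (i + N)))"
      unfolding key[OF order_refl, of N, folded cnt_def, symmetric]
      unfolding poly_altdef
      by (intro arg_cong[of _ _ sum_list] map_cong refl)
        (simp add: sum_distrib_left power_add mult_ac flip: power_mult)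
    also have "\<dots> = (\<Sum>i\<le>degree P. coeff P i * (\<Sum>\<alpha>\<leftarrow>xs. \<alpha> ^ (2 * (i + N))))"
      by (induction xs) (simp_all add: sum.distrib algebra_simps)
    also have "norm \<dots> \<le> (\<Sum>i\<le>degree P. norm (coeff P i) * (C * r ^ (2 * (i + N))))"
      using that by (intro sum_norm_le) (auto simp only: norm_mult intro!: mult_left_mono bound norm_ge_zero)
    also have "\<dots> = C' * r ^ (2 * N)"
      by (simp add: C'_def sum_distrib_left power_add algebra_simps)
    finally show ?thesis by (simp add: norm_mult norm_power algebra_simps)
  qed
  then show False
    using not_bounded_by_smaller_power[of r "norm \<alpha>0" "of_nat cnt * norm (poly P (\<alpha>0\<^sup>2))" k0 C']
      \<open>\<not> norm \<alpha>0 \<le> r\<close> assms(1) cnt P0 by simp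
qed

lemma first_power_sum_bound:
  fixes a S :: "nat \<Rightarrow> int" and r :: real and D :: nat
  assumes "a 0 = 1" "\<And>n. n > D \<Longrightarrow> a n = 0"
    and "\<And>n. int n * a n = (\<Sum>j\<in>{1..n}. S j * a (n - j))"
    and "r > 0" and "\<And>k. k \<ge> k0 \<Longrightarrow> \<bar>real_of_int (S (2 * k))\<bar> \<le> C * r ^ (2 * k)"
  shows "\<bar>real_of_int (S 1)\<bar> \<le> D * r"
proof -
  obtain xs :: "complex list" where len: "length xs = D"
    and S: "\<And>n. n \<ge> 1 \<Longrightarrow> of_int (S n) = - (\<Sum>\<alpha>\<leftarrow>xs. \<alpha> ^ n)"
    using power_sums_of_recurrence[OF assms(1-3)] by blast
  have "norm \<alpha> \<le> r" if "\<alpha> \<in> set xs" for \<alpha>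
  proof (rule bound_from_even_power_sums[OF \<open>r > 0\<close> _ that])
    fix k assume "k \<ge> max k0 1"
    then have "norm (of_int (S (2 * k)) :: complex) \<le> C * r ^ (2 * k)"
      using assms(5)[of k] by simp
    then show "norm (\<Sum>\<alpha>\<leftarrow>xs. \<alpha> ^ (2 * k)) \<le> C * r ^ (2 * k)"
      using S[of "2 * k"] \<open>k \<ge> max k0 1\<close> by simp
  qed
  then have "norm (\<Sum>\<alpha>\<leftarrow>xs. \<alpha>) \<le> length xs * r"
  proof (induction xs)
    case (Cons y ys)
    have "norm (y + (\<Sum>\<alpha>\<leftarrow>ys. \<alpha>)) \<le> r + length ys * r"
      using Cons by (intro norm_triangle_le add_mono) auto
    then show ?case by (simp add: algebra_simps)
  qed simp
  moreover have "norm (of_int (S 1) :: complex) = norm (\<Sum>\<alpha>\<leftarrow>xs. \<alpha>)"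
    by (simp add: S)
  ultimately show ?thesis by (simp add: len)
qed

subsection \<open>Weil's bound for the exponential sums\<close>

context lseries
begin

text \<open>The curve with coefficient \<open>w\<close> at x^2 satisfies f(x) / x^2 = w +
  \<open>gfun x\<close>, so its point number is q^(2k) + \<open>chi N w * Ssum (2 * k)\<close>.
  Upper bounds for \<open>w = 0\<close> and for \<open>w\<close> of trace 1 bound the sum from both
  sides. The genus is at most 2, whence the 5 and, through \<open>k \<ge> 4\<close>, the condition
  2^(mk) > 9.\<close>

lemma abs_Ssum_even_le:
  assumes "k \<ge> 4" shows "\<bar>Ssum (2 * k)\<bar> \<le> 5 * 2 ^ (m * k)"
proof -
  define N where "N = m * (2 * k)"
  have N2: "N = 2 * (m * k)" by (simp add: N_def)
  interpret fin2 ty N using m_pos assms by (intro fin2_closed) (simp add: N_def)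
  have Fm: "x \<in> F m \<Longrightarrow> x \<in> F N" for x using F_dvd[of m N] by (simp add: N_def)
  have "m * k \<ge> 4" using assms m_pos by (metis le_trans mult_le_mono1 mult_1 Suc_leI One_nat_def)
  then have "(2::nat) ^ 4 \<le> 2 ^ (m * k)" by (intro power_increasing) auto
  then have large: "(2 + 1)\<^sup>2 < (2::nat) ^ (m * k)" by simp
  have *: "int (2 ^ N) + chi N w * Ssum (2 * k) \<le> int (2 ^ N + 5 * 2 ^ (m * k))"
    if w: "w \<in> F N" for w
  proof -
    define f where "f = [:0, \<gamma>, w, \<beta>, 0, \<alpha>:]"
    define g :: nat where "g = (if \<alpha> = 0 then 1 else 2)"
    have f: "degree f = 2 * g + 1" "g \<ge> 1" "f \<in> FP N"
      using D coeffs Fm w by (auto simp: f_def g_def FP_def coeff_pCons split: nat.split)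
    have g2: "g \<le> 2" by (simp add: g_def)
    then have "(g + 1)\<^sup>2 \<le> (2 + 1)\<^sup>2" by (intro power_mono) auto
    then have g: "(g + 1)\<^sup>2 < 2 ^ (m * k)" using large by linarith
    have "{P \<in> F N \<times> F N. on_curve f P} = Sigma (F N) (\<lambda>x. {y \<in> F N. y\<^sup>2 + x * y = poly f x})"
      by (auto simp: on_curve_def)
    then have "int (card {P \<in> F N \<times> F N. on_curve f P}) =
        (\<Sum>x\<in>F N. int (card {y \<in> F N. y\<^sup>2 + x * y = poly f x}))"
      by simp
    \<comment> \<open>Over x = 0 the two sheets meet in the single point (0, 0); elsewhere division
      by x^2 leads to an Artin-Schreier equation.\<close>
    also have "\<dots> = 1 + (\<Sum>x\<in>F N - {0}. int (card {y \<in> F N. y\<^sup>2 + x * y = poly f x}))"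
    proof -
      have "{y \<in> F N. y\<^sup>2 + 0 * y = poly f 0} = {0}" by (auto simp: f_def)
      then show ?thesis by (simp add: sum.remove[of "F N" 0])
    qed
    also have "(\<Sum>x\<in>F N - {0}. int (card {y \<in> F N. y\<^sup>2 + x * y = poly f x})) =
        (\<Sum>x\<in>F N - {0}. 1 + chi N w * chi N (gfun x))"
    proof (intro sum.cong refl)
      fix x assume x: "x \<in> F N - {0}"
      have "poly f x / x\<^sup>2 = w + gfun x"
        using x by (simp add: f_def gfun_def field_simps power2_eq_square power3_eq_cube)
      moreover have "gfun x \<in> F N" using x gfun_F[of x "2 * k"] by (simp add: N_def)
      ultimately show "int (card {y \<in> F N. y\<^sup>2 + x * y = poly f x}) = 1 + chi N w * chi N (gfun x)"
        using x poly_FP[OF f(3)] w by (subst card_quadratic) (auto simp: chi_add)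
    qed
    also have "\<dots> = int (2 ^ N) - 1 + chi N w * Ssum (2 * k)"
      by (simp add: sum.distrib sum_distrib_left Ssum_def N_def[symmetric] card_F of_nat_diff)
    finally have "int (2 ^ N) + chi N w * Ssum (2 * k) = int (card {P \<in> F N \<times> F N. on_curve f P})"
      by simp
    also have "\<dots> \<le> int (2 ^ N + (2 * g + 1) * 2 ^ (m * k))"
      unfolding of_nat_le_iff by (rule stepanov_bound[OF N2 f g])
    also have "\<dots> \<le> int (2 ^ N + 5 * 2 ^ (m * k))" using g2 by simp
    finally show ?thesis .
  qed
  obtain w where "w \<in> F N" "tr N w = 1" by (rule exists_tr_1)
  then show ?thesis using *[of 0] *[of w] by (simp add: chi_def)
qed

theorem abs_Ssum_1_le: "\<bar>real_of_int (Ssum 1)\<bar> \<le> D * sqrt (2 ^ m)"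
proof (rule first_power_sum_bound[OF acoef_0 acoef_eq_0 acoef_recurrence])
  fix k :: nat assume "4 \<le> k"
  then have "real_of_int \<bar>Ssum (2 * k)\<bar> \<le> real_of_int (5 * 2 ^ (m * k))"
    using abs_Ssum_even_le by (simp only: of_int_le_iff)
  then show "\<bar>real_of_int (Ssum (2 * k))\<bar> \<le> 5 * sqrt (2 ^ m) ^ (2 * k)"
    by (simp add: power_mult)
qed auto

end

section \<open>The Weil bound over a finite field type\<close>

lemma power_card_eq_self:
  fixes x :: "'a::{field, finite}"
  shows "x ^ CARD('a) = x"
proof (cases "x = 0")
  case False
  let ?U = "UNIV - {0 :: 'a}"
  have "(\<Prod>y\<in>?U. x * y) = (\<Prod>y\<in>?U. y)"
    by (rule prod.reindex_bij_witness[of _ "\<lambda>y. y / x" "\<lambda>y. x * y"]) (use False in auto)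
  then have "x ^ card ?U = 1" by (simp add: prod.distrib)
  moreover have "CARD('a) = Suc (card ?U)" by (rule card.remove) simp_all
  ultimately show ?thesis by (simp only: power_Suc mult_1_right)
qed (simp add: finite_UNIV_card_ge_0)

lemma CHAR_eq_2:
  assumes "CARD('a::{field, finite}) = 2 ^ m" shows "CHAR('a) = 2"
proof -
  have "prime CHAR('a)" using finite_imp_CHAR_pos[where 'a='a] prime_CHAR_semidom[where 'a='a] by simp
  moreover have "CHAR('a) dvd 2 ^ m"
    using CHAR_dvd_CARD[where 'a='a] assms by simp
  ultimately show ?thesis by (metis prime_dvd_power primes_dvd_imp_eq two_is_prime_nat)
qed

locale gf2m =
  fixes ty :: "'a::{field, finite} itself" and m :: nat
  assumes m_pos: "m > 0" and card_UNIV: "CARD('a) = 2 ^ m"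
begin

sublocale fin2 ty m
proof unfold_locales
  show CH: "CHAR('a) = 2" using CHAR_eq_2 card_UNIV by blast
  interpret char2 ty using CH by unfold_locales
  have "F m = UNIV" using power_card_eq_self[where 'a='a] card_UNIV by (auto simp: F_iff)
  then show "card (F m) = 2 ^ m" using card_UNIV by simp
qed (use m_pos in auto)

lemma F_UNIV [simp]: "F m = UNIV"
  using power_card_eq_self[where 'a='a] card_UNIV by (auto simp: F_iff)

text \<open>The embedding \<open>to_ac\<close> identifies the type with \<open>K.F m\<close>, since
  the image lies in it and both have \<open>2 ^ m\<close> elements; the sum then becomes
  \<open>L.Ssum 1\<close>.\<close>

theorem weil_bound:
  fixes \<alpha> \<beta> \<gamma> :: 'a and D :: nat
  assumes "\<gamma> \<noteq> 0" and "\<alpha> \<noteq> 0 \<and> D = 4 \<or> \<alpha> = 0 \<and> \<beta> \<noteq> 0 \<and> D = 2"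
  shows "\<bar>real_of_int (\<Sum>x\<in>UNIV - {0}. chi m (\<alpha> * x ^ 3 + \<beta> * x + \<gamma> / x))\<bar> \<le> D * sqrt (2 ^ m)"
proof -
  interpret K: char2_closed "TYPE('a alg_closure)"
    by unfold_locales (simp add: CHAR2)
  have sub: "range to_ac \<subseteq> K.F m"
    using power_card_eq_self[where 'a='a] card_UNIV by (auto simp: K.F_iff simp flip: to_ac_power)
  interpret KF: fin2 "TYPE('a alg_closure)" m using m_pos by (rule K.fin2_closed)
  have range: "range to_ac = K.F m"
    using sub by (intro card_seteq) (auto simp: KF.card_F card_image inj_to_ac card_UNIV)
  interpret L: lseries "TYPE('a alg_closure)" m "to_ac \<alpha>" "to_ac \<beta>" "to_ac \<gamma>" D
    using assms m_pos sub by unfold_locales auto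
  have tr: "K.tr m (to_ac x) = to_ac (tr m x)" for x
    by (simp add: K.tr_def tr_def to_ac_sum)
  have "L.Ssum 1 = (\<Sum>x\<in>to_ac ` (UNIV - {0}). K.chi m (L.gfun x))"
  proof -
    have "K.F (m * 1) - {0} = to_ac ` (UNIV - {0})"
      by (simp add: image_set_diff[OF inj_to_ac] flip: range)
    then show ?thesis by (simp add: L.Ssum_def)
  qed
  also have "\<dots> = (\<Sum>x\<in>UNIV - {0}. K.chi m (L.gfun (to_ac x)))"
    by (subst sum.reindex) (auto simp: inj_on_def)
  also have "\<dots> = (\<Sum>x\<in>UNIV - {0}. chi m (\<alpha> * x ^ 3 + \<beta> * x + \<gamma> / x))"
    by (intro sum.cong refl) (simp add: K.chi_def chi_def L.gfun_def tr
      flip: to_ac_mult to_ac_add to_ac_power to_ac_divide)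
  finally show ?thesis using L.abs_Ssum_1_le by simp
qed

end

subsection \<open>Factorization types of the quartics\<close>

context char2
begin

definition fixed :: "nat \<Rightarrow> 'k \<Rightarrow> int" where
  "fixed m x = (if x ^ (2 ^ m) = x then 1 else 0)"

lemma fixed_frob: "x ^ (2 ^ m) = y \<Longrightarrow> fixed m x = (if y = x then 1 else 0)"
  by (simp add: fixed_def)

text \<open>The conjugates \<open>w\<close> and \<open>w + 1\<close> generate the quadratic extension attached to the sign of
  the permutation of the three roots (Berlekamp's discriminant).\<close>

lemma cubic_sign:
  fixes y1 y2 y3 :: 'k
  assumes dist: "y1 \<noteq> y2" "y2 \<noteq> y3" "y1 \<noteq> y3"
    and perm: "y1 ^ (2 ^ m) \<in> {y1, y2, y3}" "y2 ^ (2 ^ m) \<in> {y1, y2, y3}" "y3 ^ (2 ^ m) \<in> {y1, y2, y3}"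
    and w: "w = (y1\<^sup>2 * y2 + y2\<^sup>2 * y3 + y3\<^sup>2 * y1) / ((y1 + y2) * (y2 + y3) * (y1 + y3))"
  shows "w ^ (2 ^ m) = w \<longleftrightarrow> fixed m y1 + fixed m y2 + fixed m y3 \<noteq> 1"
proof -
  let ?N = "y1\<^sup>2 * y2 + y2\<^sup>2 * y3 + y3\<^sup>2 * y1" and ?N' = "y2\<^sup>2 * y1 + y1\<^sup>2 * y3 + y3\<^sup>2 * y2"
  let ?D = "(y1 + y2) * (y2 + y3) * (y1 + y3)"
  have D: "?D \<noteq> 0" using dist by (simp add: add_eq_0_iff2)
  have NN: "?N + ?N' = ?D" by (simp add: power2_eq_square algebra_simps)
  then have ne: "?N \<noteq> ?N'" using D by (metis add_self)
  have inj: "y1 ^ (2 ^ m) \<noteq> y2 ^ (2 ^ m)" "y2 ^ (2 ^ m) \<noteq> y3 ^ (2 ^ m)" "y1 ^ (2 ^ m) \<noteq> y3 ^ (2 ^ m)"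
    using dist by simp_all
  have wm: "w ^ (2 ^ m) = ((y1 ^ (2 ^ m))\<^sup>2 * y2 ^ (2 ^ m) + (y2 ^ (2 ^ m))\<^sup>2 * y3 ^ (2 ^ m)
      + (y3 ^ (2 ^ m))\<^sup>2 * y1 ^ (2 ^ m)) / ((y1 ^ (2 ^ m) + y2 ^ (2 ^ m)) * (y2 ^ (2 ^ m) + y3 ^ (2 ^ m))
      * (y1 ^ (2 ^ m) + y3 ^ (2 ^ m)))" (is "_ = ?r")
    unfolding w power_divide power_mult_distrib frob_add power_mult[symmetric]
    by (simp only: mult.commute)
  consider (id) "y1 ^ (2 ^ m) = y1" "y2 ^ (2 ^ m) = y2" "y3 ^ (2 ^ m) = y3"
    | (t12) "y1 ^ (2 ^ m) = y2" "y2 ^ (2 ^ m) = y1" "y3 ^ (2 ^ m) = y3"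
    | (t13) "y1 ^ (2 ^ m) = y3" "y2 ^ (2 ^ m) = y2" "y3 ^ (2 ^ m) = y1"
    | (t23) "y1 ^ (2 ^ m) = y1" "y2 ^ (2 ^ m) = y3" "y3 ^ (2 ^ m) = y2"
    | (c1) "y1 ^ (2 ^ m) = y2" "y2 ^ (2 ^ m) = y3" "y3 ^ (2 ^ m) = y1"
    | (c2) "y1 ^ (2 ^ m) = y3" "y2 ^ (2 ^ m) = y1" "y3 ^ (2 ^ m) = y2"
    using perm inj by auto
  then show ?thesis
  proof cases
    case id
    have "?r = w" unfolding id w ..
    then show ?thesis using id wm by (simp add: fixed_def)
  next
    case t12
    have "?r = ?N' / ?D" unfolding t12 by (simp add: ac_simps)
    then have "w ^ (2 ^ m) \<noteq> w" using wm w ne D by simp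
    then show ?thesis using dist t12[THEN fixed_frob] by simp
  next
    case t13
    have "?r = ?N' / ?D" unfolding t13 by (simp add: ac_simps)
    then have "w ^ (2 ^ m) \<noteq> w" using wm w ne D by simp
    then show ?thesis using dist t13[THEN fixed_frob] by simp
  next
    case t23
    have "?r = ?N' / ?D" unfolding t23 by (simp add: ac_simps)
    then have "w ^ (2 ^ m) \<noteq> w" using wm w ne D by simp
    then show ?thesis using dist t23[THEN fixed_frob] by simp
  next
    case c1
    have "?r = w" unfolding c1 w by (simp add: ac_simps)
    then show ?thesis using wm dist c1[THEN fixed_frob] by simp
  next
    case c2
    have "?r = w" unfolding c2 w by (simp add: ac_simps)
    then show ?thesis using wm dist c2[THEN fixed_frob] by simp
  qed
qed

text \<open>Frobenius permutes the four roots, and through S_4 -> S_3 the three values of the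
  resolvent. Both groups give the same sign, and a permutation of three letters is odd exactly if it
  fixes one of them, which explains the test \<open>r = 1\<close>. The identity is then verified for
  all 24 permutations.\<close>

lemma quartic_types:
  fixes x1 x2 x3 x4 :: 'k
  assumes dist: "distinct [x1, x2, x3, x4]"
    and perm: "\<And>x. x \<in> {x1, x2, x3, x4} \<Longrightarrow> x ^ (2 ^ m) \<in> {x1, x2, x3, x4}"
  defines "y1 \<equiv> x1 * x2 + x3 * x4" and "y2 \<equiv> x1 * x3 + x2 * x4" and "y3 \<equiv> x1 * x4 + x2 * x3"
  defines "k \<equiv> fixed m x1 + fixed m x2 + fixed m x3 + fixed m x4"
  defines "r \<equiv> fixed m y1 + fixed m y2 + fixed m y3"
  shows "y1 \<noteq> y2" "y2 \<noteq> y3" "y1 \<noteq> y3"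
    and "y1 ^ (2 ^ m) \<in> {y1, y2, y3}" "y2 ^ (2 ^ m) \<in> {y1, y2, y3}" "y3 ^ (2 ^ m) \<in> {y1, y2, y3}"
    and "24 * (if k = 4 then 1 else 0) = 2 + (if r = 1 then - 1 else 1) - r + 3 * (k * (k - 1)) - 3 * k"
proof -
  have "y1 + y2 = (x1 + x4) * (x2 + x3)" "y2 + y3 = (x1 + x2) * (x3 + x4)"
    "y1 + y3 = (x1 + x3) * (x2 + x4)"
    by (simp_all add: y1_def y2_def y3_def algebra_simps)
  then have "y1 + y2 \<noteq> 0" "y2 + y3 \<noteq> 0" "y1 + y3 \<noteq> 0"
    using dist by (auto simp: add_eq_0_iff2)
  then show d: "y1 \<noteq> y2" "y2 \<noteq> y3" "y1 \<noteq> y3" by (auto simp: add_eq_0_iff2)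
  have inj: "x1 ^ (2 ^ m) \<noteq> x2 ^ (2 ^ m)" "x1 ^ (2 ^ m) \<noteq> x3 ^ (2 ^ m)" "x1 ^ (2 ^ m) \<noteq> x4 ^ (2 ^ m)"
    "x2 ^ (2 ^ m) \<noteq> x3 ^ (2 ^ m)" "x2 ^ (2 ^ m) \<noteq> x4 ^ (2 ^ m)" "x3 ^ (2 ^ m) \<noteq> x4 ^ (2 ^ m)"
    using dist by simp_all
  define th where "th a b c d = a * b + c * d" for a b c d :: 'k
  have th_y: "th x1 x2 x3 x4 = y1" "th x1 x3 x2 x4 = y2" "th x1 x4 x2 x3 = y3"
    by (simp_all add: th_def y1_def y2_def y3_def)
  have th_frob: "(th a b c d) ^ (2 ^ m) = th (a ^ (2 ^ m)) (b ^ (2 ^ m)) (c ^ (2 ^ m)) (d ^ (2 ^ m))"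
    for a b c d by (simp add: th_def frob_add power_mult_distrib)
  have y_frob: "y1 ^ (2 ^ m) = th (x1 ^ (2 ^ m)) (x2 ^ (2 ^ m)) (x3 ^ (2 ^ m)) (x4 ^ (2 ^ m))"
    "y2 ^ (2 ^ m) = th (x1 ^ (2 ^ m)) (x3 ^ (2 ^ m)) (x2 ^ (2 ^ m)) (x4 ^ (2 ^ m))"
    "y3 ^ (2 ^ m) = th (x1 ^ (2 ^ m)) (x4 ^ (2 ^ m)) (x2 ^ (2 ^ m)) (x3 ^ (2 ^ m))"
    unfolding th_y[symmetric] th_frob by (rule refl)+
  have th_sym: "th b a c d = th a b c d" "th a b d c = th a b c d" "th c d a b = th a b c d" for a b c d
    by (simp_all add: th_def ac_simps)
  \<comment> \<open>With \<open>th_y\<close> this covers all 24 arrangements of the roots, so each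
    case is settled by rewriting without expanding \<open>th\<close>.\<close>
  have th_all:
    "th x2 x1 x3 x4 = y1" "th x1 x2 x4 x3 = y1" "th x2 x1 x4 x3 = y1"
    "th x3 x4 x1 x2 = y1" "th x4 x3 x1 x2 = y1" "th x3 x4 x2 x1 = y1" "th x4 x3 x2 x1 = y1"
    "th x3 x1 x2 x4 = y2" "th x1 x3 x4 x2 = y2" "th x3 x1 x4 x2 = y2"
    "th x2 x4 x1 x3 = y2" "th x4 x2 x1 x3 = y2" "th x2 x4 x3 x1 = y2" "th x4 x2 x3 x1 = y2"
    "th x4 x1 x2 x3 = y3" "th x1 x4 x3 x2 = y3" "th x4 x1 x3 x2 = y3"
    "th x2 x3 x1 x4 = y3" "th x3 x2 x1 x4 = y3" "th x2 x3 x4 x1 = y3" "th x3 x2 x4 x1 = y3"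
    unfolding th_y[symmetric] by (simp_all add: th_def ac_simps)
  have dx: "x1 \<noteq> x2" "x1 \<noteq> x3" "x1 \<noteq> x4" "x2 \<noteq> x3" "x2 \<noteq> x4" "x3 \<noteq> x4"
    using dist by auto
  have all: "y1 ^ (2 ^ m) \<in> {y1, y2, y3} \<and> y2 ^ (2 ^ m) \<in> {y1, y2, y3} \<and> y3 ^ (2 ^ m) \<in> {y1, y2, y3} \<and>
    24 * (if k = 4 then 1 else 0) = 2 + (if r = 1 then - 1 else 1) - r + 3 * (k * (k - 1)) - 3 * k"
    if "x1 ^ (2 ^ m) = z1" "x2 ^ (2 ^ m) = z2" "x3 ^ (2 ^ m) = z3" "x4 ^ (2 ^ m) = z4" for z1 z2 z3 z4
  proof -
    have z: "z1 \<in> {x1, x2, x3, x4}" "z2 \<in> {x1, x2, x3, x4}" "z3 \<in> {x1, x2, x3, x4}" "z4 \<in> {x1, x2, x3, x4}"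
      using perm that by auto
    have zd: "z1 \<noteq> z2" "z1 \<noteq> z3" "z1 \<noteq> z4" "z2 \<noteq> z3" "z2 \<noteq> z4" "z3 \<noteq> z4"
      using inj that by auto
    have y: "y1 ^ (2 ^ m) = th z1 z2 z3 z4" "y2 ^ (2 ^ m) = th z1 z3 z2 z4" "y3 ^ (2 ^ m) = th z1 z4 z2 z3"
      using y_frob that by simp_all
    show ?thesis
      unfolding k_def r_def fixed_def that y using z zd
      by (elim insertE emptyE; hypsubst; ((erule notE, rule refl) | simp only: th_y th_all d d[symmetric] dx dx[symmetric] if_True if_False insert_iff simp_thms, simp?))
  qed
  then show "y1 ^ (2 ^ m) \<in> {y1, y2, y3}" "y2 ^ (2 ^ m) \<in> {y1, y2, y3}" "y3 ^ (2 ^ m) \<in> {y1, y2, y3}"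
    "24 * (if k = 4 then 1 else 0) = 2 + (if r = 1 then - 1 else 1) - r + 3 * (k * (k - 1)) - 3 * k"
    by blast+
qed

text \<open>The classical formulas for the resolvent cubic, in which the terms with factor 4 vanish
  in characteristic two.\<close>

lemma resolvent_cubic:
  fixes x1 x2 x3 x4 :: 'k
  assumes e1: "x1 + x2 + x3 + x4 = 1"
    and e2: "x1 * x2 + x1 * x3 + x1 * x4 + x2 * x3 + x2 * x4 + x3 * x4 = t"
    and e3: "x1 * x2 * x3 + x1 * x2 * x4 + x1 * x3 * x4 + x2 * x3 * x4 = s"
    and e4: "x1 * x2 * x3 * x4 = p"
  defines "y1 \<equiv> x1 * x2 + x3 * x4" and "y2 \<equiv> x1 * x3 + x2 * x4" and "y3 \<equiv> x1 * x4 + x2 * x3"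
  shows "y1 + y2 + y3 = t" "y1 * y2 + y1 * y3 + y2 * y3 = s" "y1 * y2 * y3 = s\<^sup>2 + p"
proof -
  show "y1 + y2 + y3 = t" by (simp add: y1_def y2_def y3_def e2[symmetric] ac_simps)
  have "y1 * y2 + y1 * y3 + y2 * y3 = (x1 + x2 + x3 + x4) *
      (x1 * x2 * x3 + x1 * x2 * x4 + x1 * x3 * x4 + x2 * x3 * x4)"
    by (simp add: y1_def y2_def y3_def algebra_simps)
  then show "y1 * y2 + y1 * y3 + y2 * y3 = s" using e1 e3 by simp
  have "y1 * y2 * y3 = (x1 * x2 * x3 + x1 * x2 * x4 + x1 * x3 * x4 + x2 * x3 * x4)\<^sup>2 +
      (x1 + x2 + x3 + x4)\<^sup>2 * (x1 * x2 * x3 * x4)"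
    by (simp add: y1_def y2_def y3_def power2_eq_square algebra_simps)
  then show "y1 * y2 * y3 = s\<^sup>2 + p" using e1 e3 e4 by simp
qed

text \<open>Let N' be the numerator for the reversed cyclic order. Then N + N' is the denominator D,
  so \<open>w\<^sup>2 + w\<close> equals N N' / D^2, which is symmetric in the roots.\<close>

lemma berlekamp_discriminant:
  fixes y1 y2 y3 :: 'k
  assumes "y1 + y2 + y3 = e1" "y1 * y2 + y1 * y3 + y2 * y3 = e2" "y1 * y2 * y3 = e3"
    and "e1 * e2 + e3 \<noteq> 0"
    and w: "w = (y1\<^sup>2 * y2 + y2\<^sup>2 * y3 + y3\<^sup>2 * y1) / ((y1 + y2) * (y2 + y3) * (y1 + y3))"
  shows "w\<^sup>2 + w = (e1 ^ 3 * e3 + e2 ^ 3 + e3\<^sup>2) / (e1 * e2 + e3)\<^sup>2"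
proof -
  define N where "N = y1\<^sup>2 * y2 + y2\<^sup>2 * y3 + y3\<^sup>2 * y1"
  let ?D = "(y1 + y2) * (y2 + y3) * (y1 + y3)"
  have D: "?D = e1 * e2 + e3"
    unfolding assms(1-3)[symmetric] by (simp add: algebra_simps)
  have "N\<^sup>2 + N * ?D = e1 ^ 3 * e3 + e2 ^ 3 + e3\<^sup>2"
    unfolding assms(1-3)[symmetric] N_def by (simp add: power2_eq_square power3_eq_cube algebra_simps)
  moreover have "w\<^sup>2 + w = (N\<^sup>2 + N * ?D) / ?D\<^sup>2"
    using assms(4) unfolding w D N_def[symmetric] by (simp add: power_divide add_divide_distrib power2_eq_square)
  ultimately show ?thesis by (simp only: D)
qed

end

text \<open>The derivative of the quartic is T^2 + s. At a double root it vanishes, and the quartic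
  itself then takes the value \<open>c\<close>, which is not 0.\<close>

lemma (in char2_closed) quartic_splits:
  fixes a s c :: 'k
  assumes "c \<noteq> 0"
  obtains x1 x2 x3 x4 where "distinct [x1, x2, x3, x4]"
    and "\<And>x. (x\<^sup>2 + s) * (x\<^sup>2 + x + a) + c = 0 \<longleftrightarrow> x \<in> {x1, x2, x3, x4}"
    and "x1 + x2 + x3 + x4 = 1"
    and "x1 * x2 + x1 * x3 + x1 * x4 + x2 * x3 + x2 * x4 + x3 * x4 = a + s"
    and "x1 * x2 * x3 + x1 * x2 * x4 + x1 * x3 * x4 + x2 * x3 * x4 = s"
    and "x1 * x2 * x3 * x4 = s * a + c"
proof -
  define p where "p = [:s * a + c, s, a + s, 1, 1:]"
  have poly_p: "poly p x = (x\<^sup>2 + s) * (x\<^sup>2 + x + a) + c" for x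
    by (simp add: p_def power2_eq_square algebra_simps)
  have "p \<noteq> 0" "degree p = 4" "lead_coeff p = 1" by (simp_all add: p_def)
  then obtain A where A: "size A = 4" "p = (\<Prod>x\<in>#A. [:-x, 1:])"
    using alg_closed_imp_factorization[of p] by auto
  obtain xs where xs: "mset xs = A" using ex_mset by blast
  then have "length xs = 4" using A by auto
  then obtain x1 x2 x3 x4 where "xs = [x1, x2, x3, x4]"
    by (auto simp: numeral_eq_Suc length_Suc_conv)
  then have p: "p = [:x1, 1:] * ([:x2, 1:] * ([:x3, 1:] * [:x4, 1:]))"
    using A xs by (auto simp del: mult_pCons_left mult_pCons_right)
  have roots: "(x\<^sup>2 + s) * (x\<^sup>2 + x + a) + c = 0 \<longleftrightarrow> x \<in> {x1, x2, x3, x4}" for x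
    unfolding poly_p[symmetric] p poly_mult mult_eq_0_iff by (auto simp: add_eq_0_iff2)
  have simple: "y \<noteq> z" if "p = [:y, 1:] * ([:z, 1:] * h)" for y z h
  proof
    assume "y = z"
    have "poly (pderiv p) y = 0" "poly p y = 0"
      unfolding that \<open>y = z\<close> by (simp_all add: pderiv_mult pderiv_pCons del: mult_pCons_left)
    then have "y * y + s = 0" "(y * y + s) * (y\<^sup>2 + y + a) + c = 0"
      unfolding poly_p by (simp_all add: p_def pderiv_pCons power2_eq_square algebra_simps)
    then show False using assms by simp
  qed
  have "x1 \<noteq> x2" by (rule simple[of _ _ "[:x3, 1:] * [:x4, 1:]"]) (simp only: p mult_ac)
  moreover have "x1 \<noteq> x3" by (rule simple[of _ _ "[:x2, 1:] * [:x4, 1:]"]) (simp only: p mult_ac)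
  moreover have "x1 \<noteq> x4" by (rule simple[of _ _ "[:x2, 1:] * [:x3, 1:]"]) (simp only: p mult_ac)
  moreover have "x2 \<noteq> x3" by (rule simple[of _ _ "[:x1, 1:] * [:x4, 1:]"]) (simp only: p mult_ac)
  moreover have "x2 \<noteq> x4" by (rule simple[of _ _ "[:x1, 1:] * [:x3, 1:]"]) (simp only: p mult_ac)
  moreover have "x3 \<noteq> x4" by (rule simple[of _ _ "[:x1, 1:] * [:x2, 1:]"]) (simp only: p mult_ac)
  ultimately have dist: "distinct [x1, x2, x3, x4]" by simp
  have "p = [:x1 * x2 * x3 * x4,
      x1 * x2 * x3 + x1 * x2 * x4 + x1 * x3 * x4 + x2 * x3 * x4,
      x1 * x2 + x1 * x3 + x1 * x4 + x2 * x3 + x2 * x4 + x3 * x4, x1 + x2 + x3 + x4, 1:]"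
    unfolding p by (simp add: algebra_simps)
  then have v: "s * a + c = x1 * x2 * x3 * x4"
      "s = x1 * x2 * x3 + x1 * x2 * x4 + x1 * x3 * x4 + x2 * x3 * x4"
      "a + s = x1 * x2 + x1 * x3 + x1 * x4 + x2 * x3 + x2 * x4 + x3 * x4"
      "1 = x1 + x2 + x3 + x4"
    unfolding p_def pCons_eq_iff by blast+
  show ?thesis
    by (rule that[OF dist roots v(4)[symmetric] v(3)[symmetric] v(2)[symmetric] v(1)[symmetric]])
qed

context gf2m
begin

definition rts :: "'a \<Rightarrow> 'a \<Rightarrow> 'a \<Rightarrow> 'a set" where
  "rts a c s = {x. (x\<^sup>2 + s) * (x\<^sup>2 + x + a) + c = 0}"

definition res :: "'a \<Rightarrow> 'a \<Rightarrow> 'a \<Rightarrow> 'a set" where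
  "res a c s = {y. y ^ 3 + (a + s) * y\<^sup>2 + s * y + (s\<^sup>2 + s * a + c) = 0}"

text \<open>Berlekamp's discriminant of the resolvent cubic. Its denominator is the square of the
  product of the pairwise sums of the roots, and that product e1 e2 + e3 collapses to
  \<open>c\<close>.\<close>

definition beta :: "'a \<Rightarrow> 'a \<Rightarrow> 'a \<Rightarrow> 'a" where
  "beta a c s = ((a + s) ^ 3 * (s\<^sup>2 + s * a + c) + s ^ 3 + (s\<^sup>2 + s * a + c)\<^sup>2) / c\<^sup>2"

text \<open>Regular character of the symmetric group of degree four, evaluated at the Frobenius element:
  \<open>24 [id] = 2 + sgn - \<rho> + 3 k (k - 1) - 3 k\<close>, where \<open>k\<close> and \<open>\<rho>\<close> are the numbers of fixed points
  on the roots and on the roots of the resolvent cubic.\<close>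

lemma regular_character:
  fixes a c s :: 'a
  assumes "c \<noteq> 0"
  defines "k \<equiv> int (card (rts a c s))"
  shows "24 * (if k = 4 then 1 else 0) =
    2 + chi m (beta a c s) - int (card (res a c s)) + 3 * (k * (k - 1)) - 3 * k"
proof -
  interpret K: char2_closed "TYPE('a alg_closure)"
    by unfold_locales (simp add: CHAR2)
  interpret KF: fin2 "TYPE('a alg_closure)" m using m_pos by (rule K.fin2_closed)
  have sub: "range to_ac \<subseteq> K.F m"
    using power_card_eq_self[where 'a='a] card_UNIV by (auto simp: K.F_iff simp flip: to_ac_power)
  have range: "range to_ac = K.F m"
    using sub by (intro card_seteq) (auto simp: KF.card_F card_image inj_to_ac card_UNIV)
  have card_fixed: "int (card {x. to_ac x \<in> T}) = (\<Sum>x\<in>T. K.fixed m x)"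
    if "finite T" for T :: "'a alg_closure set"
  proof -
    have "card {x. to_ac x \<in> T} = card (to_ac ` {x. to_ac x \<in> T})"
      by (simp add: card_image inj_on_def)
    also have "to_ac ` {x. to_ac x \<in> T} = T \<inter> {x. x ^ (2 ^ m) = x}"
      using range by (auto simp: K.F_def)
    finally show ?thesis using that by (simp add: K.fixed_def sum.If_cases)
  qed
  let ?a = "to_ac a" and ?c = "to_ac c" and ?s = "to_ac s"
  have c0: "?c \<noteq> 0" using assms by simp
  obtain x1 x2 x3 x4 where dist: "distinct [x1, x2, x3, x4]"
    and roots: "\<And>x. (x\<^sup>2 + ?s) * (x\<^sup>2 + x + ?a) + ?c = 0 \<longleftrightarrow> x \<in> {x1, x2, x3, x4}"
    and vieta: "x1 + x2 + x3 + x4 = 1"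
      "x1 * x2 + x1 * x3 + x1 * x4 + x2 * x3 + x2 * x4 + x3 * x4 = ?a + ?s"
      "x1 * x2 * x3 + x1 * x2 * x4 + x1 * x3 * x4 + x2 * x3 * x4 = ?s"
      "x1 * x2 * x3 * x4 = ?s * ?a + ?c"
    by (rule K.quartic_splits[OF c0, of ?s ?a]) (rule that)
  define y1 y2 y3 where "y1 = x1 * x2 + x3 * x4" and "y2 = x1 * x3 + x2 * x4" and "y3 = x1 * x4 + x2 * x3"
  have fr: "?a ^ (2 ^ m) = ?a" "?s ^ (2 ^ m) = ?s" "?c ^ (2 ^ m) = ?c"
    using range by (auto simp: K.F_def)
  have perm: "x ^ (2 ^ m) \<in> {x1, x2, x3, x4}" if "x \<in> {x1, x2, x3, x4}" for x
  proof -
    have "((x\<^sup>2 + ?s) * (x\<^sup>2 + x + ?a) + ?c) ^ (2 ^ m) = 0"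
      using that roots[of x] by (simp add: power_0_left)
    then have "((x ^ (2 ^ m))\<^sup>2 + ?s) * ((x ^ (2 ^ m))\<^sup>2 + x ^ (2 ^ m) + ?a) + ?c = 0"
      by (simp only: K.frob_add power_mult_distrib fr power_mult[symmetric] mult.commute)
    then show ?thesis using roots by blast
  qed
  note types = K.quartic_types[OF dist perm, folded y1_def y2_def y3_def]
  have sums: "y1 + y2 + y3 = ?a + ?s" "y1 * y2 + y1 * y3 + y2 * y3 = ?s"
    "y1 * y2 * y3 = ?s\<^sup>2 + ?s * ?a + ?c"
    using K.resolvent_cubic[OF vieta, folded y1_def y2_def y3_def] by (simp_all add: add.assoc)
  have "(y + y1) * (y + y2) * (y + y3) =
      y ^ 3 + (y1 + y2 + y3) * y\<^sup>2 + (y1 * y2 + y1 * y3 + y2 * y3) * y + y1 * y2 * y3" for y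
    by (simp add: power2_eq_square power3_eq_cube algebra_simps)
  then have cubic: "y ^ 3 + (?a + ?s) * y\<^sup>2 + ?s * y + (?s\<^sup>2 + ?s * ?a + ?c) =
      (y + y1) * (y + y2) * (y + y3)" for y
    unfolding sums by (rule sym)
  have res_roots: "y ^ 3 + (?a + ?s) * y\<^sup>2 + ?s * y + (?s\<^sup>2 + ?s * ?a + ?c) = 0 \<longleftrightarrow>
      y \<in> {y1, y2, y3}" for y
    unfolding cubic by (simp add: K.add_eq_0_iff2)
  have "to_ac ((x\<^sup>2 + s) * (x\<^sup>2 + x + a) + c) = 0 \<longleftrightarrow> to_ac x \<in> {x1, x2, x3, x4}" for x
    unfolding roots[symmetric] by simp
  then have "rts a c s = {x. to_ac x \<in> {x1, x2, x3, x4}}"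
    unfolding rts_def to_ac_eq_0_iff by blast
  then have k: "k = K.fixed m x1 + K.fixed m x2 + K.fixed m x3 + K.fixed m x4"
    using dist by (simp only: k_def card_fixed finite.intros) simp
  have "to_ac (y ^ 3 + (a + s) * y\<^sup>2 + s * y + (s\<^sup>2 + s * a + c)) = 0 \<longleftrightarrow> to_ac y \<in> {y1, y2, y3}" for y
    unfolding res_roots[symmetric] by simp
  then have "res a c s = {y. to_ac y \<in> {y1, y2, y3}}"
    unfolding res_def to_ac_eq_0_iff by blast
  then have r: "int (card (res a c s)) = K.fixed m y1 + K.fixed m y2 + K.fixed m y3"
    using types(1-3) by (simp only: card_fixed finite.intros) simp
  define w where "w = (y1\<^sup>2 * y2 + y2\<^sup>2 * y3 + y3\<^sup>2 * y1) / ((y1 + y2) * (y2 + y3) * (y1 + y3))"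
  have E: "(?a + ?s) * ?s + (?s\<^sup>2 + ?s * ?a + ?c) = ?c"
    by (simp add: power2_eq_square algebra_simps)
  have "w\<^sup>2 + w = to_ac (beta a c s)"
    using K.berlekamp_discriminant[OF sums _ w_def] assms(1) unfolding E by (simp add: beta_def)
  \<comment> \<open>The trace of \<open>beta\<close> thus decides whether Frobenius fixes
    \<open>w\<close>, that is, the sign of its permutation of the resolvent roots.\<close>
  then have "K.tr m (to_ac (beta a c s)) = w ^ (2 ^ m) + w"
    using K.tr_artin_schreier[of m w] by simp
  moreover have "K.tr m (to_ac z) = to_ac (tr m z)" for z
    by (simp add: K.tr_def tr_def to_ac_sum)
  ultimately have "tr m (beta a c s) = 0 \<longleftrightarrow> w ^ (2 ^ m) = w"
    by (metis K.add_eq_0_iff2 to_ac_eq_0_iff)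
  then have "chi m (beta a c s) = (if int (card (res a c s)) = 1 then - 1 else 1)"
    using K.cubic_sign[OF types(1-6) w_def] r by (simp add: chi_def)
  then show ?thesis using types(7) k r by (simp only: add.commute add.left_commute)
qed

end

subsection \<open>Counting the quartics that split completely\<close>

context gf2m
begin

lemma chi_plus: "chi m (x + y) = chi m x * chi m y"
  by (rule chi_add) simp_all

lemma chi_square [simp]: "chi m (x\<^sup>2) = chi m x"
  by (rule chi_sq) simp

lemma chi_eq: "x + y = v\<^sup>2 + v \<Longrightarrow> chi m x = chi m y"
  by (rule chi_eqI[where v = v]) simp_all

lemma card_AS: "int (card {v. v\<^sup>2 + v = z}) = 1 + chi m z"
  using card_artin_schreier[of z] by simp

lemma card_quad: "p \<noteq> 0 \<Longrightarrow> int (card {d. d\<^sup>2 + p * d = e}) = 1 + chi m (e / p\<^sup>2)"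
  using card_quadratic[of e p] by simp

lemma sum_shift: "(\<Sum>x\<in>UNIV. g (x + y)) = (\<Sum>x\<in>UNIV. g (x :: 'a) :: int)"
  using sum_F_shift[of y g] by simp

text \<open>The substitution \<open>d = x\<^sup>2 + x + a\<close> hits each \<open>d\<close> exactly
  \<open>1 + chi m (d + a)\<close> times.\<close>

lemma sum_AS: "(\<Sum>x\<in>UNIV. g (x\<^sup>2 + x + a)) = (\<Sum>d\<in>UNIV. (1 + chi m (d + a)) * (g d :: int))"
proof -
  have "(\<Sum>x\<in>UNIV. g (x\<^sup>2 + x + a)) = (\<Sum>d\<in>UNIV. \<Sum>x\<in>{x \<in> UNIV. x\<^sup>2 + x + a = d}. g (x\<^sup>2 + x + a))"
    by (rule sum.group[symmetric]) simp_all
  also have "\<dots> = (\<Sum>d\<in>UNIV. int (card {x. x\<^sup>2 + x = d + a}) * g d)"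
  proof (intro sum.cong refl)
    fix d
    have "{x \<in> UNIV. x\<^sup>2 + x + a = d} = {x. x\<^sup>2 + x = d + a}"
      by (metis (no_types, opaque_lifting) UNIV_I add_swap_iff add.commute)
    then show "(\<Sum>x\<in>{x \<in> UNIV. x\<^sup>2 + x + a = d}. g (x\<^sup>2 + x + a)) =
        int (card {x. x\<^sup>2 + x = d + a}) * g d"
      by (simp flip: of_nat_mult)
  qed
  finally show ?thesis by (simp only: card_AS)
qed

lemma sum_chi_UNIV: "(\<Sum>x\<in>UNIV. chi m x) = 0"
  using sum_chi by simp

lemma sum_chi_mult_UNIV: "(\<Sum>x\<in>UNIV. chi m (y * x)) = (if y = 0 then 2 ^ m else 0)"
  using sum_chi_mult[of y] by simp

lemma sum_remove0: "(\<Sum>x\<in>UNIV - {0}. g x) = (\<Sum>x\<in>UNIV. g x) - (g (0 :: 'a) :: int)"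
  by (simp add: sum_diff1)

lemma sum_remove01: "(\<Sum>x\<in>UNIV - {0, 1}. g x) = (\<Sum>x\<in>UNIV - {0}. g x) - (g (1 :: 'a) :: int)"
proof -
  have "UNIV - {0, 1} = UNIV - {0 :: 'a} - {1}" by auto
  then show ?thesis by (simp add: sum_diff1)
qed

section \<open>The three exponential sums\<close>

definition Ksum :: "'a \<Rightarrow> int" where
  "Ksum c = (\<Sum>p\<in>UNIV - {0}. chi m (p + c / p))"

definition Tsum :: "'a \<Rightarrow> int" where
  "Tsum c = (\<Sum>x\<in>UNIV - {0}. chi m (c * x ^ 3 + c / x))"

definition Csum :: "'a \<Rightarrow> int" where
  "Csum c = (\<Sum>x\<in>UNIV. chi m (c * x ^ 3 + c * x))"

lemma abs_Ksum_le: "c \<noteq> 0 \<Longrightarrow> \<bar>real_of_int (Ksum c)\<bar> \<le> 2 * sqrt (2 ^ m)"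
  using weil_bound[of c 0 2 1] by (simp add: Ksum_def)

lemma abs_Tsum_le: "c \<noteq> 0 \<Longrightarrow> \<bar>real_of_int (Tsum c)\<bar> \<le> 4 * sqrt (2 ^ m)"
  using weil_bound[of c c 4 0] by (simp add: Tsum_def)

text \<open>Grouping by \<open>w = p + c / p\<close> gives fibres of size
  \<open>1 + chi m (c / w\<^sup>2)\<close> for \<open>w \<noteq> 0\<close>. Comparing with the
  number of nonzero \<open>p\<close> leaves products of two even factors, so the sum is q - 1 modulo
  4.\<close>

lemma Ksum_mod_4:
  assumes "c \<noteq> 0" "m \<ge> 2" shows "Ksum c mod 4 = 3"
proof -
  let ?A = "UNIV - {0 :: 'a}"
  have fib: "{p \<in> ?A. p + c / p = w} = {p. p\<^sup>2 + w * p = c}" for w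
  proof -
    have "p + c / p = w \<longleftrightarrow> p\<^sup>2 + w * p = c" if "p \<noteq> 0" for p
    proof -
      have "p + c / p = w \<longleftrightarrow> p * (p + c / p) = p * w" using that by simp
      also have "\<dots> \<longleftrightarrow> p\<^sup>2 + c = w * p" using that by (simp add: distrib_left power2_eq_square mult.commute)
      also have "\<dots> \<longleftrightarrow> p\<^sup>2 + w * p = c" by (metis add_swap_iff add.commute)
      finally show ?thesis .
    qed
    then have "p \<in> {p \<in> ?A. p + c / p = w} \<longleftrightarrow> p \<in> {p. p\<^sup>2 + w * p = c}" for p
      using assms(1) by (cases "p = 0") simp_all
    then show ?thesis by blast
  qed
  obtain s0 where s0: "s0\<^sup>2 = c" using F_sqrt[of c m] m_pos by auto
  have fib0: "{p. p\<^sup>2 + 0 * p = c} = {s0}" using s0 by auto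
  have img: "(\<Sum>p\<in>?A. g (p + c / p)) = g 0 + (\<Sum>w\<in>?A. g w * (1 + chi m (c / w\<^sup>2)))" for g :: "'a \<Rightarrow> int"
  proof -
    have "(\<Sum>p\<in>?A. g (p + c / p)) = (\<Sum>w\<in>UNIV. \<Sum>p\<in>{p \<in> ?A. p + c / p = w}. g (p + c / p))"
      by (rule sum.group[symmetric]) simp_all
    also have "\<dots> = (\<Sum>w\<in>UNIV. g w * int (card {p. p\<^sup>2 + w * p = c}))"
      by (intro sum.cong refl) (simp add: fib[symmetric])
    also have "\<dots> = g 0 + (\<Sum>w\<in>?A. g w * int (card {p. p\<^sup>2 + w * p = c}))"
      using fib0 by (simp add: sum.remove[of UNIV 0])
    finally show ?thesis by (simp add: card_quad)
  qed
  have "int (card ?A) = 1 + (\<Sum>w\<in>?A. 1 + chi m (c / w\<^sup>2))"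
    using img[of "\<lambda>_. 1"] by simp
  moreover have "int (card ?A) = 2 ^ m - 1" by (simp add: card_Diff_singleton card_UNIV of_nat_diff)
  moreover have "Ksum c = 1 + (\<Sum>w\<in>?A. chi m w * (1 + chi m (c / w\<^sup>2)))"
    using img[of "chi m"] by (simp add: Ksum_def)
  ultimately have "Ksum c - (2 ^ m - 1) = (\<Sum>w\<in>?A. (chi m w - 1) * (1 + chi m (c / w\<^sup>2)))"
    by (simp add: sum_subtractf left_diff_distrib)
  moreover have "4 dvd (chi m w - 1) * (1 + chi m v)" for w v
    using chi_cases[of m w] chi_cases[of m v] by auto
  ultimately have "4 dvd Ksum c - (2 ^ m - 1)" by (simp add: dvd_sum)
  moreover have "(4 :: int) dvd 2 ^ m"
    using le_imp_power_dvd[OF assms(2), of "2 :: int"] by simp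
  ultimately show ?thesis by presburger
qed

lemma chi_1: "odd m \<Longrightarrow> chi m 1 = - 1"
proof -
  assume "odd m"
  then have "(of_nat m :: 'a) = 1" by (auto elim: oddE)
  then show ?thesis by (simp add: chi_def tr_def)
qed

text \<open>A collision would produce a solution of v^2 + v = 1, a primitive cube root of unity;
  this is impossible because 1 has trace 1 for odd \<open>m\<close>.\<close>

lemma cube_inj: assumes "odd m" "x ^ 3 = y ^ 3" shows "x = (y :: 'a)"
proof (rule ccontr)
  assume "x \<noteq> y"
  have "y \<noteq> 0" using assms \<open>x \<noteq> y\<close> by auto
  have "(x + y) * (x\<^sup>2 + x * y + y\<^sup>2) = x ^ 3 + y ^ 3"
    by (simp add: power2_eq_square power3_eq_cube algebra_simps)
  then have "x\<^sup>2 + x * y + y\<^sup>2 = 0" using assms \<open>x \<noteq> y\<close> by (simp add: add_eq_0_iff2)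
  then have "x\<^sup>2 + x * y = y\<^sup>2" by (simp add: add_eq_0_iff2)
  then have "(x / y)\<^sup>2 + x / y = 1"
    using \<open>y \<noteq> 0\<close> by (simp add: field_simps power2_eq_square)
  then have "chi m 1 = 1" by (metis chi_artin_schreier F_UNIV UNIV_I)
  then show False using chi_1 assms by simp
qed

lemma sum_cube: "odd m \<Longrightarrow> (\<Sum>x\<in>UNIV. g (x ^ 3)) = (\<Sum>x\<in>UNIV. g (x :: 'a) :: int)"
proof -
  assume "odd m"
  then have "inj (\<lambda>x::'a. x ^ 3)" using cube_inj by (auto simp: inj_def)
  then have "bij (\<lambda>x::'a. x ^ 3)" by (simp add: bij_def finite_UNIV_inj_surj)
  then show ?thesis by (rule sum.reindex_bij_betw)
qed

text \<open>The exponent behaves like a quadratic form: its increment by \<open>h\<close> is, up to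
  Artin-Schreier terms, linear in \<open>x\<close>, so the sum over \<open>x\<close> vanishes unless
  the linear coefficient does. This happens for \<open>h = 0\<close> and the unique \<open>h\<close>
  with \<open>h ^ 3 = 1 / c\<close>, contributing q and q or -q.\<close>

lemma Csum_square:
  assumes "c \<noteq> 0" "odd m" shows "(Csum c)\<^sup>2 = 0 \<or> (Csum c)\<^sup>2 = 2 * 2 ^ m"
proof -
  have "inj (\<lambda>x::'a. x ^ 3)" using cube_inj assms by (auto simp: inj_def)
  then have "surj (\<lambda>x::'a. x ^ 3)" by (simp add: finite_UNIV_inj_surj)
  then obtain h1 where h1: "h1 ^ 3 = 1 / c" by (metis surjD)
  have "h1 \<noteq> 0" using h1 assms by auto
  let ?e = "\<lambda>x. chi m (c * x ^ 3 + c * x)"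
  have inner: "(\<Sum>x\<in>UNIV. ?e x * ?e (x + h)) = (if h = 0 \<or> h = h1 then ?e h * 2 ^ m else 0)" for h
  proof -
    \<comment> \<open>The root \<open>k\<close> linearizes the mixed term:
      \<open>c * h * x\<^sup>2\<close> is the square of \<open>k * x\<close> and has the same
      trace.\<close>
    obtain k where k: "k\<^sup>2 = c * h" using F_sqrt[of "c * h" m] m_pos by auto
    have "?e x * ?e (x + h) = ?e h * chi m ((k + c * h\<^sup>2) * x)" for x
    proof -
      have "(c * x ^ 3 + c * x) + (c * (x + h) ^ 3 + c * (x + h)) + (c * h ^ 3 + c * h) +
          (k + c * h\<^sup>2) * x = (k * x)\<^sup>2 + k * x"
        unfolding power_mult_distrib k
        by (simp add: power2_eq_square power3_eq_cube algebra_simps)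
      then have "chi m ((c * x ^ 3 + c * x) + (c * (x + h) ^ 3 + c * (x + h)) + (c * h ^ 3 + c * h) +
          (k + c * h\<^sup>2) * x) = 1" by (simp only: chi_artin_schreier F_UNIV UNIV_I)
      then have "?e x * ?e (x + h) * ?e h * chi m ((k + c * h\<^sup>2) * x) = 1"
        by (simp only: chi_plus mult.assoc)
      then show ?thesis
        using chi_cases[of m "c * h ^ 3 + c * h"] chi_cases[of m "(k + c * h\<^sup>2) * x"] by auto
    qed
    then have "(\<Sum>x\<in>UNIV. ?e x * ?e (x + h)) = ?e h * (\<Sum>x\<in>UNIV. chi m ((k + c * h\<^sup>2) * x))"
      by (simp add: sum_distrib_left)
    also have "\<dots> = (if k + c * h\<^sup>2 = 0 then ?e h * 2 ^ m else 0)"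
      by (simp add: sum_chi_mult_UNIV)
    also have "k + c * h\<^sup>2 = 0 \<longleftrightarrow> h = 0 \<or> h = h1"
    proof -
      have "k + c * h\<^sup>2 = 0 \<longleftrightarrow> k\<^sup>2 = (c * h\<^sup>2)\<^sup>2" by (simp add: add_eq_0_iff2)
      also have "\<dots> \<longleftrightarrow> c * h * 1 = c * h * (c * h ^ 3)"
        unfolding k by (simp add: power2_eq_square power3_eq_cube mult_ac)
      also have "\<dots> \<longleftrightarrow> h = 0 \<or> 1 = c * h ^ 3"
        unfolding mult_cancel_left using assms(1) by simp
      also have "1 = c * h ^ 3 \<longleftrightarrow> h ^ 3 = h1 ^ 3"
        unfolding h1 using assms(1) by (auto simp: field_simps)
      also have "\<dots> \<longleftrightarrow> h = h1" using cube_inj assms(2) by auto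
      finally show ?thesis .
    qed
    finally show ?thesis .
  qed
  have "(Csum c)\<^sup>2 = (\<Sum>x\<in>UNIV. ?e x * (\<Sum>h\<in>UNIV. ?e (h + x)))"
    unfolding sum_shift[of ?e] by (simp add: Csum_def power2_eq_square sum_distrib_right)
  also have "\<dots> = (\<Sum>x\<in>UNIV. \<Sum>h\<in>UNIV. ?e x * ?e (x + h))"
    by (simp add: sum_distrib_left add.commute)
  also have "\<dots> = (\<Sum>h\<in>UNIV. \<Sum>x\<in>UNIV. ?e x * ?e (x + h))" by (rule sum.swap)
  also have "\<dots> = (\<Sum>h\<in>{0, h1}. ?e h * 2 ^ m)"
    unfolding inner by (rule sum.mono_neutral_cong_right) auto
  also have "\<dots> = (1 + ?e h1) * 2 ^ m"
    using \<open>h1 \<noteq> 0\<close> by (simp add: algebra_simps)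
  finally show ?thesis using chi_cases[of m "c * h1 ^ 3 + c * h1"] by auto
qed

section \<open>Averages over the parameter s\<close>

lemma card_indicator: "int (card {x :: 'a. P x}) = (\<Sum>x\<in>UNIV. if P x then 1 else 0)"
  by (simp add: sum.If_cases)

text \<open>The equation is linear in \<open>s\<close>, so each \<open>x\<close> is a root for at
  most one \<open>s\<close>. Sums over \<open>s\<close> become sums over \<open>x\<close>, and root
  sets for different \<open>s\<close> are disjoint.\<close>

lemma quart_iff:
  assumes "c \<noteq> 0"
  shows "(x\<^sup>2 + s) * (x\<^sup>2 + x + a) + c = 0 \<longleftrightarrow> x\<^sup>2 + x + a \<noteq> 0 \<and> s = x\<^sup>2 + c / (x\<^sup>2 + x + (a :: 'a))"
proof (cases "x\<^sup>2 + x + a = 0")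
  case False
  then have "(x\<^sup>2 + s) * (x\<^sup>2 + x + a) + c = 0 \<longleftrightarrow> x\<^sup>2 + s = c / (x\<^sup>2 + x + a)"
    by (simp add: add_eq_0_iff2 eq_divide_eq)
  moreover have "x\<^sup>2 + s = e \<longleftrightarrow> s = x\<^sup>2 + e" for e
    by (metis add_swap_iff add.commute)
  ultimately show ?thesis using False by simp
qed (use assms in simp)

lemma sum_card_rts:
  assumes "c \<noteq> 0" shows "(\<Sum>s\<in>UNIV. int (card (rts a c s))) = 2 ^ m - 1 - chi m a"
proof -
  have "(\<Sum>s\<in>UNIV. int (card (rts a c s))) =
      (\<Sum>x\<in>UNIV. \<Sum>s\<in>UNIV. if x\<^sup>2 + x + a \<noteq> 0 \<and> s = x\<^sup>2 + c / (x\<^sup>2 + x + a) then 1 else 0)"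
    unfolding rts_def quart_iff[OF assms] card_indicator by (rule sum.swap)
  also have "\<dots> = (\<Sum>x\<in>UNIV. 1 - (if x\<^sup>2 + x = a then 1 else 0))"
    by (intro sum.cong refl) (auto simp: add_eq_0_iff2)
  also have "\<dots> = 2 ^ m - int (card {x. x\<^sup>2 + x = a})"
    by (simp add: sum_subtractf card_UNIV flip: card_indicator)
  finally show ?thesis by (simp add: card_AS)
qed

text \<open>The substitution \<open>s = p + (a + y)\<close> turns the resolvent into
  \<open>p * (y\<^sup>2 + y) + (p\<^sup>2 + a * p + c)\<close>, an Artin-Schreier equation in
  \<open>y\<close> for \<open>p \<noteq> 0\<close> and without solutions for
  \<open>p = 0\<close>.\<close>

lemma sum_card_res:
  assumes "c \<noteq> 0" shows "(\<Sum>s\<in>UNIV. int (card (res a c s))) = 2 ^ m - 1 + chi m a * Ksum c"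
proof -
  let ?R = "\<lambda>s y. y ^ 3 + (a + s) * y\<^sup>2 + s * y + (s\<^sup>2 + s * a + c)"
  have "(\<Sum>s\<in>UNIV. int (card (res a c s))) = (\<Sum>y\<in>UNIV. \<Sum>s\<in>UNIV. if ?R s y = 0 then 1 else 0)"
    unfolding res_def card_indicator by (rule sum.swap)
  also have "\<dots> = (\<Sum>y\<in>UNIV. \<Sum>p\<in>UNIV. if ?R (p + (a + y)) y = 0 then 1 else 0)"
    by (intro sum.cong refl sum_shift[symmetric])
  also have "\<dots> = (\<Sum>p\<in>UNIV. \<Sum>y\<in>UNIV. if ?R (p + (a + y)) y = 0 then 1 else 0)"
    by (rule sum.swap)
  also have "\<dots> = (\<Sum>p\<in>UNIV. if p = 0 then 0 else int (card {y. y\<^sup>2 + y = p + c / p + a}))"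
  proof (intro sum.cong refl)
    fix p
    have R: "?R (p + (a + y)) y = p * (y\<^sup>2 + y) + (p\<^sup>2 + a * p + c)" for y
      by (simp add: power2_eq_square power3_eq_cube algebra_simps)
    have "p * (y\<^sup>2 + y) + (p\<^sup>2 + a * p + c) = 0 \<longleftrightarrow> y\<^sup>2 + y = p + c / p + a" if "p \<noteq> 0" for y
    proof -
      have "p\<^sup>2 + a * p + c = p * (p + c / p + a)"
        using that by (simp add: distrib_left power2_eq_square mult.commute add_ac)
      then have "p * (y\<^sup>2 + y) + (p\<^sup>2 + a * p + c) = 0 \<longleftrightarrow> p * (y\<^sup>2 + y) = p * (p + c / p + a)"
        by (simp only: add_eq_0_iff2)
      then show ?thesis using that by simp
    qed
    then show "(\<Sum>y\<in>UNIV. if ?R (p + (a + y)) y = 0 then 1 else 0) =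
        (if p = 0 then 0 else int (card {y. y\<^sup>2 + y = p + c / p + a}))"
      unfolding R card_indicator using assms by auto
  qed
  also have "\<dots> = (\<Sum>p\<in>UNIV - {0}. 1 + chi m a * chi m (p + c / p))"
    by (rule sum.mono_neutral_cong_right) (auto simp: card_AS chi_plus mult.commute)
  also have "\<dots> = 2 ^ m - 1 + chi m a * Ksum c"
    by (simp add: sum.distrib card_Diff_singleton card_UNIV of_nat_diff Ksum_def sum_distrib_left)
  finally show ?thesis .
qed

text \<open>With \<open>s = t + a\<close>, \<open>beta\<close> differs from
  \<open>(t\<^sup>2 + t + a) ^ 3 / c\<^sup>2 + 1\<close> by an Artin-Schreier term with
  \<open>v = t ^ 3 / c\<close>; the 1 gives the sign. After \<open>sum_AS\<close> one part vanishes
  because cubing is bijective, and rescaling the other by \<open>c\<close> yields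
  \<open>Csum c\<close>.\<close>

lemma sum_chi_beta:
  assumes "c \<noteq> 0" "odd m" shows "(\<Sum>s\<in>UNIV. chi m (beta a c s)) = - (chi m a * Csum c)"
proof -
  have chi_beta: "chi m (beta a c (t + a)) = - chi m ((t\<^sup>2 + t + a) ^ 3 / c\<^sup>2)" for t
  proof -
    have "beta a c (t + a) + ((t\<^sup>2 + t + a) ^ 3 / c\<^sup>2 + 1) = (t ^ 3 / c)\<^sup>2 + t ^ 3 / c"
    proof -
      have "c\<^sup>2 * beta a c (t + a) =
          (a + (t + a)) ^ 3 * ((t + a)\<^sup>2 + (t + a) * a + c) + (t + a) ^ 3 + ((t + a)\<^sup>2 + (t + a) * a + c)\<^sup>2"
        using assms(1) by (simp add: beta_def)
      moreover have "c\<^sup>2 * ((t\<^sup>2 + t + a) ^ 3 / c\<^sup>2 + 1) = (t\<^sup>2 + t + a) ^ 3 + c\<^sup>2"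
        using assms(1) by (simp add: distrib_left)
      ultimately have "c\<^sup>2 * (beta a c (t + a) + ((t\<^sup>2 + t + a) ^ 3 / c\<^sup>2 + 1)) =
          t ^ 3 * t ^ 3 + c * t ^ 3"
        unfolding distrib_left by (simp add: power2_eq_square power3_eq_cube algebra_simps)
      moreover have "c\<^sup>2 * ((t ^ 3 / c)\<^sup>2 + t ^ 3 / c) = t ^ 3 * t ^ 3 + c * t ^ 3"
        using assms(1) by (simp add: distrib_left power2_eq_square)
      ultimately show ?thesis using assms(1) by (metis mult_cancel_left power_not_zero)
    qed
    then have "chi m (beta a c (t + a)) = chi m ((t\<^sup>2 + t + a) ^ 3 / c\<^sup>2 + 1)" by (rule chi_eq)
    then show ?thesis using chi_1[OF assms(2)] by (simp add: chi_plus)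
  qed
  have "(\<Sum>s\<in>UNIV. chi m (beta a c s)) = (\<Sum>t\<in>UNIV. - chi m ((t\<^sup>2 + t + a) ^ 3 / c\<^sup>2))"
    unfolding chi_beta[symmetric] by (rule sum_shift[symmetric])
  also have "\<dots> = - (\<Sum>z\<in>UNIV. (1 + chi m (z + a)) * chi m (z ^ 3 / c\<^sup>2))"
    by (simp add: sum_negf sum_AS[of "\<lambda>z. chi m (z ^ 3 / c\<^sup>2)"])
  also have "(\<Sum>z\<in>UNIV. (1 + chi m (z + a)) * chi m (z ^ 3 / c\<^sup>2)) =
      (\<Sum>z\<in>UNIV. chi m (z ^ 3 / c\<^sup>2)) + chi m a * (\<Sum>z\<in>UNIV. chi m (z + z ^ 3 / c\<^sup>2))"
    by (simp add: chi_plus algebra_simps sum.distrib sum_distrib_left)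
  also have "(\<Sum>z\<in>UNIV. chi m (z ^ 3 / c\<^sup>2)) = (\<Sum>z\<in>UNIV. chi m (inverse (c\<^sup>2) * z))"
    using sum_cube[OF assms(2), of "\<lambda>z. chi m (z / c\<^sup>2)"] by (simp add: divide_inverse mult.commute)
  also have "\<dots> = 0" using assms(1) by (simp add: sum_chi_mult_UNIV)
  also have "(\<Sum>z\<in>UNIV. chi m (z + z ^ 3 / c\<^sup>2)) = Csum c"
    unfolding Csum_def
    by (rule sum.reindex_bij_witness[of _ "\<lambda>z. c * z" "\<lambda>z. z / c"])
      (use assms(1) in \<open>auto simp: power2_eq_square power3_eq_cube field_simps\<close>)
  finally show ?thesis by simp
qed

section \<open>Ordered pairs of roots\<close>

lemma card_ordered_pairs:
  fixes A :: "'a set"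
  shows "int (card A) * (int (card A) - 1) =
    (\<Sum>u\<in>UNIV - {0}. \<Sum>x\<in>UNIV. if x \<in> A \<and> x + u \<in> A then 1 else 0)"
proof -
  have card_A: "int (card A) = (\<Sum>x\<in>UNIV. if x \<in> A then 1 else 0)"
    using card_indicator[of "\<lambda>x. x \<in> A"] by simp
  have "(\<Sum>u\<in>UNIV. \<Sum>x\<in>UNIV. if x \<in> A \<and> x + u \<in> A then 1 else 0) =
      (\<Sum>x\<in>UNIV. \<Sum>u\<in>UNIV. (if x \<in> A then 1 else 0) * (if u + x \<in> A then 1 else (0 :: int)))"
    by (subst sum.swap) (intro sum.cong refl, simp add: add.commute)
  also have "\<dots> = (\<Sum>x\<in>UNIV. (if x \<in> A then 1 else 0) * int (card A))"
    unfolding sum_distrib_left[symmetric] sum_shift[of "\<lambda>x. if x \<in> A then 1 else 0"] card_A ..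
  also have "\<dots> = int (card A) * int (card A)"
    unfolding sum_distrib_right[symmetric] card_A[symmetric] ..
  finally show ?thesis
    unfolding sum_remove0 by (simp add: right_diff_distrib card_A[symmetric])
qed

text \<open>Here \<open>d\<close> and \<open>d + p\<close> stand for the values of x^2 + x + a at
  \<open>x\<close> and \<open>x + u\<close>. Equality of the two parameters becomes u^2 + c p / (d
  (d + p)) = 0, from which \<open>x\<close> has disappeared; \<open>u = 1\<close> would make
  \<open>p\<close> zero and leave u^2 = 0.\<close>

lemma collision_iff:
  fixes d u x :: 'a
  assumes "c \<noteq> 0" "u \<noteq> 0"
  defines "p \<equiv> u\<^sup>2 + u"
  shows "d \<noteq> 0 \<and> d + p \<noteq> 0 \<and> x\<^sup>2 + c / d = (x + u)\<^sup>2 + c / (d + p) \<longleftrightarrow>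
    u \<noteq> 1 \<and> d\<^sup>2 + p * d = c * (u + 1) / u"
proof -
  have fac: "d\<^sup>2 + p * d = d * (d + p)" by (simp add: power2_eq_square algebra_simps)
  have p: "p = u * (u + 1)" by (simp add: p_def power2_eq_square algebra_simps)
  have eq: "x\<^sup>2 + c / d = (x + u)\<^sup>2 + c / (d + p) \<longleftrightarrow> d * (d + p) = c * (u + 1) / u"
    if "d \<noteq> 0" "d + p \<noteq> 0"
  proof -
    have "x\<^sup>2 + c / d = (x + u)\<^sup>2 + c / (d + p) \<longleftrightarrow> u\<^sup>2 + (c / d + c / (d + p)) = 0"
      unfolding add_eq_0_iff2[of "x\<^sup>2 + c / d", symmetric] by (simp add: sq_add add_ac)
    also have "c / d + c / (d + p) = c * p / (d * (d + p))"
      using that by (simp add: field_simps)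
    also have "u\<^sup>2 + c * p / (d * (d + p)) = 0 \<longleftrightarrow> u * (u * (d * (d + p))) = u * (c * (u + 1))"
      using that by (simp add: add_eq_0_iff2 eq_divide_eq p power2_eq_square mult_ac)
    also have "\<dots> \<longleftrightarrow> d * (d + p) = c * (u + 1) / u"
      using assms(2) by (simp add: eq_divide_eq mult.commute)
    finally show ?thesis .
  qed
  have "d \<noteq> 0 \<and> d + p \<noteq> 0" if "u \<noteq> 1" "d * (d + p) = c * (u + 1) / u"
  proof -
    have "c * (u + 1) / u \<noteq> 0" using that assms(1,2) by (simp add: add_eq_0_iff2)
    then show ?thesis using that(2) by auto
  qed
  moreover have "u \<noteq> 1" if "d \<noteq> 0" "d + p \<noteq> 0" "d * (d + p) = c * (u + 1) / u"
    using that by auto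
  ultimately show ?thesis unfolding fac using eq by blast
qed

lemma sum_card_pairs:
  assumes "c \<noteq> 0"
  shows "(\<Sum>s\<in>UNIV. int (card (rts a c s)) * (int (card (rts a c s)) - 1)) =
    (\<Sum>u\<in>UNIV - {0, 1}. \<Sum>d\<in>{d. d\<^sup>2 + (u\<^sup>2 + u) * d = c * (u + 1) / u}. 1 + chi m (d + a))"
proof -
  let ?D = "\<lambda>x. x\<^sup>2 + x + a" and ?f = "\<lambda>x. x\<^sup>2 + c / (x\<^sup>2 + x + a)"
  have rts: "x \<in> rts a c s \<longleftrightarrow> ?D x \<noteq> 0 \<and> s = ?f x" for x s
    unfolding rts_def mem_Collect_eq by (rule quart_iff[OF assms])
  have "(\<Sum>s\<in>UNIV. int (card (rts a c s)) * (int (card (rts a c s)) - 1)) =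
      (\<Sum>u\<in>UNIV - {0}. \<Sum>s\<in>UNIV. \<Sum>x\<in>UNIV. if x \<in> rts a c s \<and> x + u \<in> rts a c s then 1 else 0)"
    unfolding card_ordered_pairs by (rule sum.swap)
  also have "\<dots> =
      (\<Sum>u\<in>UNIV - {0}. \<Sum>x\<in>UNIV. \<Sum>s\<in>UNIV. if x \<in> rts a c s \<and> x + u \<in> rts a c s then 1 else 0)"
    by (intro sum.cong refl sum.swap)
  also have "\<dots> = (\<Sum>u\<in>UNIV - {0}. \<Sum>x\<in>UNIV.
      if u \<noteq> 1 \<and> (?D x)\<^sup>2 + (u\<^sup>2 + u) * ?D x = c * (u + 1) / u then 1 else 0)"
  proof (intro sum.cong refl)
    fix u x :: 'a assume "u \<in> UNIV - {0}"
    then have u: "u \<noteq> 0" by simp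
    have D: "?D (x + u) = ?D x + (u\<^sup>2 + u)" by (simp add: sq_add add_ac)
    have "(\<Sum>s\<in>UNIV. if x \<in> rts a c s \<and> x + u \<in> rts a c s then 1 else 0) =
        (\<Sum>s\<in>UNIV. if s = ?f x then
          (if ?D x \<noteq> 0 \<and> ?D (x + u) \<noteq> 0 \<and> ?f x = ?f (x + u) then 1 else 0) else 0)"
      unfolding rts by (intro sum.cong refl) auto
    also have "\<dots> = (if ?D x \<noteq> 0 \<and> ?D (x + u) \<noteq> 0 \<and> ?f x = ?f (x + u) then 1 else 0)"
      by (simp only: sum.delta[OF finite] UNIV_I if_True)
    finally show "(\<Sum>s\<in>UNIV. if x \<in> rts a c s \<and> x + u \<in> rts a c s then 1 else 0) =
        (if u \<noteq> 1 \<and> (?D x)\<^sup>2 + (u\<^sup>2 + u) * ?D x = c * (u + 1) / u then 1 else 0)"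
      unfolding D collision_iff[OF assms u, of "?D x" x] .
  qed
  also have "\<dots> = (\<Sum>u\<in>UNIV - {0}. \<Sum>d\<in>UNIV. (1 + chi m (d + a)) *
      (if u \<noteq> 1 \<and> d\<^sup>2 + (u\<^sup>2 + u) * d = c * (u + 1) / u then 1 else 0))"
    by (intro sum.cong refl sum_AS)
  also have "\<dots> = (\<Sum>u\<in>UNIV - {0, 1}. \<Sum>d\<in>{d. d\<^sup>2 + (u\<^sup>2 + u) * d = c * (u + 1) / u}. 1 + chi m (d + a))"
  proof (rule sum.mono_neutral_cong_right)
    fix u :: 'a assume "u \<in> UNIV - {0, 1}"
    then show "(\<Sum>d\<in>UNIV. (1 + chi m (d + a)) *
        (if u \<noteq> 1 \<and> d\<^sup>2 + (u\<^sup>2 + u) * d = c * (u + 1) / u then 1 else 0)) =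
        (\<Sum>d\<in>{d. d\<^sup>2 + (u\<^sup>2 + u) * d = c * (u + 1) / u}. 1 + chi m (d + a))"
      by (intro sum.mono_neutral_cong_right) auto
  qed auto
  finally show ?thesis .
qed

text \<open>Both right-hand arguments are the constant term divided by a square,
  \<open>?y1 = ?e / (u + 1)\<^sup>2\<close> and \<open>?y2 = ?e / u\<^sup>2\<close>. The product of
  their characters decides solvability, and each root has the character of \<open>?y1\<close>; thus
  the sum is (1 + e1 e2) e1 = e1 + e2 for signs e1, e2.\<close>

lemma sum_chi_quadratic_roots:
  fixes u :: 'a
  assumes "u \<notin> {0, 1}"
  shows "(\<Sum>d\<in>{d. d\<^sup>2 + (u\<^sup>2 + u) * d = c * (u + 1) / u}. chi m d) =
    chi m (c / (u\<^sup>2 + u)) + chi m (c * (u + 1) / u ^ 3)"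
proof -
  let ?p = "u\<^sup>2 + u" and ?e = "c * (u + 1) / u"
  let ?S = "{d. d\<^sup>2 + ?p * d = ?e}" and ?y1 = "c / (u\<^sup>2 + u)" and ?y2 = "c * (u + 1) / u ^ 3"
  have u: "u \<noteq> 0" "u + 1 \<noteq> 0" using assms by (auto simp: add_eq_0_iff2)
  have p: "?p = u * (u + 1)" by (simp add: power2_eq_square algebra_simps)
  have y1: "?y1 = ?e / (u + 1)\<^sup>2" using u unfolding p by (simp add: power2_eq_square)
  have y2: "?y2 = ?e / u\<^sup>2" using u by (simp add: power2_eq_square power3_eq_cube)
  have "1 / (u + 1)\<^sup>2 + 1 / u\<^sup>2 = (u\<^sup>2 + (u + 1)\<^sup>2) / ?p\<^sup>2"
    using u unfolding p by (simp only: power_mult_distrib add_divide_distrib) simp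
  also have "u\<^sup>2 + (u + 1)\<^sup>2 = 1" by (simp add: sq_add)
  finally have "1 / (u + 1)\<^sup>2 + 1 / u\<^sup>2 = 1 / ?p\<^sup>2" .
  then have "?y1 + ?y2 = ?e / ?p\<^sup>2"
    unfolding y1 y2 by (metis distrib_left times_divide_eq_right mult.right_neutral)
  then have prod: "chi m ?y1 * chi m ?y2 = chi m (?e / ?p\<^sup>2)" by (metis chi_plus)
  have "?p \<noteq> 0" using u unfolding p by simp
  then have card: "int (card ?S) = 1 + chi m ?y1 * chi m ?y2" using card_quad prod by simp
  have "chi m d = chi m ?y1" if "d \<in> ?S" for d
  proof (rule chi_eq)
    have "?y1 = (d\<^sup>2 + ?p * d) / (u + 1)\<^sup>2" using that unfolding y1 by simp
    also have "\<dots> = (d / (u + 1))\<^sup>2 + u * d / (u + 1)"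
      using u unfolding p by (simp add: add_divide_distrib power_divide power2_eq_square)
    also have "d + \<dots> = (d / (u + 1))\<^sup>2 + (d + u * d / (u + 1))" by (simp add: add_ac)
    also have "d + u * d / (u + 1) = d / (u + 1)"
      using u by (simp add: field_simps)
    finally show "d + ?y1 = (d / (u + 1))\<^sup>2 + d / (u + 1)" .
  qed
  then have "(\<Sum>d\<in>?S. chi m d) = int (card ?S) * chi m ?y1" by simp
  also have "\<dots> = chi m ?y1 + chi m ?y2"
    unfolding card using chi_cases[of m ?y1] chi_cases[of m ?y2] by auto
  finally show ?thesis .
qed

lemma card_minus01: "int (card (UNIV - {0, 1 :: 'a})) = 2 ^ m - 2"
  using sum_remove01[of "\<lambda>_. 1"] sum_remove0[of "\<lambda>_. 1"] card_UNIV by simp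

lemma sum_chi_Tsum_form:
  "(\<Sum>u\<in>UNIV - {0, 1}. chi m (c * (u + 1) / u / (u\<^sup>2 + u)\<^sup>2)) = Tsum c - 1"
proof -
  have "(\<Sum>u\<in>UNIV - {0, 1}. chi m (c * (u + 1) / u / (u\<^sup>2 + u)\<^sup>2)) =
      (\<Sum>x\<in>UNIV - {0, 1}. chi m (c * x ^ 3 + c / x))"
  \<comment> \<open>The map x = (u + 1) / u carries u = 0, 1, infinity to x = infinity, 0, 1. The
    value x = 1 is therefore missing; its term is \<open>chi m 0 = 1\<close>, whence the -1.\<close>
  proof (rule sum.reindex_bij_witness[of _ "\<lambda>x. 1 / (x + 1)" "\<lambda>u. 1 / u + 1"])
    fix u :: 'a assume "u \<in> UNIV - {0, 1}"
    then have u: "u \<noteq> 0" "u + 1 \<noteq> 0" by (auto simp: add_eq_0_iff2)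
    show "1 / (1 / u + 1 + 1) = u" by (simp add: add.assoc)
    have "1 / u + 1 = (u + 1) / u" using u by (simp add: field_simps)
    then show "1 / u + 1 \<in> UNIV - {0, 1}" using u by (auto simp: add_eq_0_iff2 field_simps)
    define v where "v = u + 1"
    have v: "v \<noteq> 0" "1 / u + 1 = v / u" "u\<^sup>2 + u = u * v"
      using u \<open>1 / u + 1 = (u + 1) / u\<close> by (simp_all add: v_def power2_eq_square algebra_simps)
    have "v ^ 3 * v + u * u ^ 3 = 1"
      by (simp add: v_def power3_eq_cube algebra_simps)
    then have "(v / u) ^ 3 + u / v = 1 / (u ^ 3 * v)"
      using u v by (simp add: power_divide add_frac_eq)
    then have "c * ((v / u) ^ 3 + u / v) = c * v / u / (u * v)\<^sup>2"
      using u v by (simp add: power2_eq_square power3_eq_cube)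
    then have "c * (1 / u + 1) ^ 3 + c / (1 / u + 1) = c * (u + 1) / u / (u\<^sup>2 + u)\<^sup>2"
      unfolding v(2,3) v_def[symmetric] by (simp add: distrib_left)
    then show "chi m (c * (1 / u + 1) ^ 3 + c / (1 / u + 1)) = chi m (c * (u + 1) / u / (u\<^sup>2 + u)\<^sup>2)"
      by simp
  next
    fix x :: 'a assume "x \<in> UNIV - {0, 1}"
    then have x: "x \<noteq> 0" "x + 1 \<noteq> 0" by (auto simp: add_eq_0_iff2)
    show "1 / (1 / (x + 1)) + 1 = x" by (simp add: add.assoc)
    show "1 / (x + 1) \<in> UNIV - {0, 1}" using x by (auto simp: eq_divide_eq)
  qed
  then show ?thesis by (simp add: sum_remove01 Tsum_def)
qed

lemma sum_chi_Ksum_form: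
  assumes "c \<noteq> 0" shows "(\<Sum>u\<in>UNIV - {0, 1}. chi m (c / (u\<^sup>2 + u))) = Ksum c - 1"
proof -
  define g where "g p = (if p = 0 then 0 else chi m (c / p))" for p
  have "(\<Sum>u\<in>UNIV - {0, 1}. chi m (c / (u\<^sup>2 + u))) = (\<Sum>u\<in>UNIV. g (u\<^sup>2 + u + 0))"
  proof (rule sum.mono_neutral_cong_left)
    have "u\<^sup>2 + u = u * (u + 1)" for u :: 'a by (simp add: power2_eq_square algebra_simps)
    then have z: "u\<^sup>2 + u = 0 \<longleftrightarrow> u = 0 \<or> u = 1" for u :: 'a by (simp add: add_eq_0_iff2)
    then show "\<forall>u\<in>UNIV - (UNIV - {0, 1}). g (u\<^sup>2 + u + 0) = 0" by (auto simp: g_def)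
    show "chi m (c / (u\<^sup>2 + u)) = g (u\<^sup>2 + u + 0)" if "u \<in> UNIV - {0, 1}" for u
      using that z[of u] by (simp add: g_def)
  qed auto
  also have "\<dots> = (\<Sum>p\<in>UNIV. (1 + chi m (p + 0)) * g p)" by (rule sum_AS)
  also have "\<dots> = (\<Sum>p\<in>UNIV - {0}. chi m (c / p) + chi m (p + c / p))"
    by (rule sum.mono_neutral_cong_right) (auto simp: g_def chi_plus algebra_simps)
  also have "\<dots> = (\<Sum>p\<in>UNIV - {0}. chi m (c / p)) + Ksum c"
    by (simp add: sum.distrib Ksum_def)
  also have "(\<Sum>p\<in>UNIV - {0}. chi m (c / p)) = (\<Sum>p\<in>UNIV - {0}. chi m p)"
    by (rule sum.reindex_bij_witness[of _ "\<lambda>p. c / p" "\<lambda>p. c / p"]) (use assms in auto)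
  also have "\<dots> = - 1" by (simp add: sum_remove0 sum_chi_UNIV)
  finally show ?thesis by simp
qed

lemma sum_chi_Csum_form:
  "(\<Sum>u\<in>UNIV - {0, 1}. chi m (c * (u + 1) / u ^ 3)) = Csum c - 2"
proof -
  have "(\<Sum>u\<in>UNIV - {0, 1}. chi m (c * (u + 1) / u ^ 3)) =
      (\<Sum>x\<in>UNIV - {0, 1}. chi m (c * x ^ 3 + c * x))"
  proof (rule sum.reindex_bij_witness[of _ "\<lambda>x. 1 / (x + 1)" "\<lambda>u. 1 / u + 1"])
    fix u :: 'a assume "u \<in> UNIV - {0, 1}"
    then have u: "u \<noteq> 0" "u + 1 \<noteq> 0" by (auto simp: add_eq_0_iff2)
    show "1 / (1 / u + 1 + 1) = u" by (simp add: add.assoc)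
    have e: "1 / u + 1 = (u + 1) / u" using u by (simp add: field_simps)
    then show "1 / u + 1 \<in> UNIV - {0, 1}" using u by (auto simp: add_eq_0_iff2 field_simps)
    have "c * (1 / u + 1) ^ 3 + c * (1 / u + 1) = c * (((u + 1) ^ 3 + u\<^sup>2 * (u + 1)) / u ^ 3)"
      unfolding e using u
      by (simp add: power2_eq_square power3_eq_cube add_divide_distrib distrib_left)
    also have "(u + 1) ^ 3 + u\<^sup>2 * (u + 1) = u + 1"
      by (simp add: power2_eq_square power3_eq_cube algebra_simps)
    finally show "chi m (c * (1 / u + 1) ^ 3 + c * (1 / u + 1)) = chi m (c * (u + 1) / u ^ 3)"
      by simp
  next
    fix x :: 'a assume "x \<in> UNIV - {0, 1}"
    then have x: "x \<noteq> 0" "x + 1 \<noteq> 0" by (auto simp: add_eq_0_iff2)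
    show "1 / (1 / (x + 1)) + 1 = x" by (simp add: add.assoc)
    show "1 / (x + 1) \<in> UNIV - {0, 1}" using x by (auto simp: eq_divide_eq)
  qed
  then show ?thesis by (simp add: sum_remove01 sum_remove0 Csum_def)
qed

text \<open>The pairs contribute \<open>Csum\<close> and \<open>Ksum\<close> three times each; the
  sign character takes back one \<open>Csum\<close> and the resolvent one \<open>Ksum\<close>, which
  leaves the coefficients 2.\<close>

theorem count_split_quartics:
  assumes "c \<noteq> 0" "odd m"
  shows "24 * int (card {s. card (rts a c s) = 4}) =
    2 ^ m - 5 - 6 * chi m a + 2 * chi m a * Csum c + 2 * chi m a * Ksum c + 3 * Tsum c"
proof -
  let ?k = "\<lambda>s. int (card (rts a c s))" and ?A = "UNIV - {0, 1 :: 'a}"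
  let ?S = "\<lambda>u. {d. d\<^sup>2 + (u\<^sup>2 + u) * d = c * (u + 1) / u}"
  have nz: "u\<^sup>2 + u \<noteq> 0" if "u \<in> ?A" for u
  proof -
    have "u\<^sup>2 + u = u * (u + 1)" by (simp add: power2_eq_square algebra_simps)
    then show ?thesis using that by (simp add: add_eq_0_iff2)
  qed
  have "(\<Sum>s\<in>UNIV. ?k s * (?k s - 1)) = (\<Sum>u\<in>?A. int (card (?S u)) + chi m a * (\<Sum>d\<in>?S u. chi m d))"
    unfolding sum_card_pairs[OF assms(1)]
    by (simp add: sum.distrib chi_plus sum_distrib_left mult.commute)
  also have "\<dots> = (\<Sum>u\<in>?A. 1 + chi m (c * (u + 1) / u / (u\<^sup>2 + u)\<^sup>2) +
      chi m a * (chi m (c / (u\<^sup>2 + u)) + chi m (c * (u + 1) / u ^ 3)))"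
    by (intro sum.cong refl) (simp only: card_quad[OF nz] sum_chi_quadratic_roots Diff_iff simp_thms)
  also have "\<dots> = int (card ?A) + (Tsum c - 1) + chi m a * (Ksum c - 1 + (Csum c - 2))"
    by (simp only: sum.distrib sum_distrib_left[symmetric] sum_chi_Tsum_form sum_chi_Ksum_form[OF assms(1)] sum_chi_Csum_form)
      simp
  finally have pairs: "(\<Sum>s\<in>UNIV. ?k s * (?k s - 1)) = 2 ^ m - 3 + Tsum c + chi m a * (Ksum c + Csum c - 3)"
    unfolding card_minus01 by simp
  have "24 * int (card {s. card (rts a c s) = 4}) = (\<Sum>s\<in>UNIV. 24 * (if ?k s = 4 then 1 else 0))"
    unfolding card_indicator sum_distrib_left by (intro sum.cong refl) auto
  also have "\<dots> = (\<Sum>s\<in>UNIV. 2 + chi m (beta a c s) - int (card (res a c s)) +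
      3 * (?k s * (?k s - 1)) - 3 * ?k s)"
    by (intro sum.cong refl regular_character assms)
  also have "\<dots> = 2 * 2 ^ m + (\<Sum>s\<in>UNIV. chi m (beta a c s)) - (\<Sum>s\<in>UNIV. int (card (res a c s))) +
      3 * (\<Sum>s\<in>UNIV. ?k s * (?k s - 1)) - 3 * (\<Sum>s\<in>UNIV. ?k s)"
    by (simp only: sum.distrib sum_subtractf sum_distrib_left[symmetric]) (simp add: card_UNIV)
  finally show ?thesis
    unfolding pairs sum_card_rts[OF assms(1)] sum_card_res[OF assms(1)] sum_chi_beta[OF assms]
    by (simp add: algebra_simps)
qed

end

subsection \<open>Orbits of solutions\<close>

text \<open>For injective coordinates the permutation carrying \<open>x\<close> to \<open>y\<close>
  is recovered by inverting \<open>y\<close> on the common range, so an orbit amounts to its set of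
  values.\<close>

lemma sym_orbit_eq:
  fixes x :: "'a ^ 'n"
  assumes "inj (vec_nth x)"
  shows "sym_orbit x = {y. inj (vec_nth y) \<and> range (vec_nth y) = range (vec_nth x)}"
proof (intro Set.set_eqI iffI)
  fix y assume "y \<in> sym_orbit x"
  then obtain p where p: "p permutes (UNIV :: 'n set)" "y = permute_coords p x"
    by (auto simp: sym_orbit_def)
  define r where "r = inv_into UNIV p"
  have r: "bij r" using p by (simp add: r_def permutes_bij bij_imp_bij_inv)
  have y: "vec_nth y = vec_nth x \<circ> r" using p(2) by (auto simp: permute_coords_def r_def)
  have "inj (vec_nth y)" unfolding y using assms r by (intro inj_compose) (simp_all add: bij_is_inj)
  moreover have "range (vec_nth y) = range (vec_nth x)"
    unfolding y image_comp[symmetric] using r by (simp add: bij_is_surj)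
  ultimately show "y \<in> {y. inj (vec_nth y) \<and> range (vec_nth y) = range (vec_nth x)}" by simp
next
  fix y :: "'a ^ 'n" assume "y \<in> {y. inj (vec_nth y) \<and> range (vec_nth y) = range (vec_nth x)}"
  then have y: "inj (vec_nth y)" "range (vec_nth y) = range (vec_nth x)" by auto
  define p where "p i = inv_into UNIV (vec_nth y) (vec_nth x i)" for i
  have yp: "vec_nth y (p i) = vec_nth x i" for i
    unfolding p_def using y(2) by (intro f_inv_into_f) auto
  have "inj p" using assms yp by (auto simp: inj_def) metis
  then have bij: "bij p" by (simp add: bij_def finite_UNIV_inj_surj[OF finite])
  have "p permutes UNIV" using bij by (intro bij_imp_permutes) auto
  moreover have "y = permute_coords p x"
  proof -
    have "vec_nth x (inv_into UNIV p i) = vec_nth y i" for i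
      using yp[of "inv_into UNIV p i"] bij_is_surj[OF bij] by (simp add: surj_f_inv_f)
    then show ?thesis by (simp add: permute_coords_def vec_eq_iff)
  qed
  ultimately show "y \<in> sym_orbit x" by (auto simp: sym_orbit_def)
qed

lemma card_image_eq_of_kernel_eq:
  assumes "\<And>x y. x \<in> S \<Longrightarrow> y \<in> S \<Longrightarrow> f x = f y \<longleftrightarrow> g x = g y"
  shows "card (f ` S) = card (g ` S)"
proof (rule bij_betw_same_card)
  let ?h = "\<lambda>z. g (inv_into S f z)"
  have h: "?h (f x) = g x" if "x \<in> S" for x
    using assms[of "inv_into S f (f x)" x] that by (simp add: f_inv_into_f inv_into_into)
  show "bij_betw ?h (f ` S) (g ` S)"
    unfolding bij_betw_def
  proof
    show "inj_on ?h (f ` S)" using h assms by (auto simp: inj_on_def)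
    show "?h ` f ` S = g ` S" using h by (force simp: image_iff)
  qed
qed

context gf2m
begin

lemma newton_power_sums:
  fixes x1 x2 x3 x4 :: 'a
  defines "e2 \<equiv> x1 * x2 + x1 * x3 + x1 * x4 + x2 * x3 + x2 * x4 + x3 * x4"
    and "e3 \<equiv> x1 * x2 * x3 + x1 * x2 * x4 + x1 * x3 * x4 + x2 * x3 * x4"
    and "e4 \<equiv> x1 * x2 * x3 * x4"
  assumes e1: "x1 + x2 + x3 + x4 = 1"
  shows "x1 ^ 3 + x2 ^ 3 + x3 ^ 3 + x4 ^ 3 = 1 + e2 + e3"
    and "x1 ^ 5 + x2 ^ 5 + x3 ^ 5 + x4 ^ 5 = 1 + e2 + e3 + e2\<^sup>2 + e4 + e2 * e3"
proof -
  let ?e1 = "x1 + x2 + x3 + x4"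
  have "x1 ^ 3 + x2 ^ 3 + x3 ^ 3 + x4 ^ 3 = ?e1 ^ 3 + ?e1 * e2 + e3"
    by (simp add: e2_def e3_def power3_eq_cube algebra_simps)
  then show "x1 ^ 3 + x2 ^ 3 + x3 ^ 3 + x4 ^ 3 = 1 + e2 + e3" unfolding e1 by simp
  have "x1 ^ 5 + x2 ^ 5 + x3 ^ 5 + x4 ^ 5 =
      ?e1 ^ 5 + ?e1 ^ 3 * e2 + ?e1\<^sup>2 * e3 + ?e1 * e2\<^sup>2 + ?e1 * e4 + e2 * e3"
    by (simp add: e2_def e3_def e4_def eval_nat_numeral algebra_simps)
  then show "x1 ^ 5 + x2 ^ 5 + x3 ^ 5 + x4 ^ 5 = 1 + e2 + e3 + e2\<^sup>2 + e4 + e2 * e3"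
    unfolding e1 by simp
qed

lemma rts_eq_iff_vieta:
  fixes x1 x2 x3 x4 :: 'a
  assumes "distinct [x1, x2, x3, x4]"
  shows "rts a c s = {x1, x2, x3, x4} \<longleftrightarrow> x1 + x2 + x3 + x4 = 1 \<and>
    x1 * x2 + x1 * x3 + x1 * x4 + x2 * x3 + x2 * x4 + x3 * x4 = a + s \<and>
    x1 * x2 * x3 + x1 * x2 * x4 + x1 * x3 * x4 + x2 * x3 * x4 = s \<and>
    x1 * x2 * x3 * x4 = s * a + c"
proof -
  define p where "p = [:s * a + c, s, a + s, 1, 1:]"
  define r where "r = [:x1, 1:] * ([:x2, 1:] * ([:x3, 1:] * [:x4, 1:]))"
  have r: "r = [:x1 * x2 * x3 * x4,
      x1 * x2 * x3 + x1 * x2 * x4 + x1 * x3 * x4 + x2 * x3 * x4,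
      x1 * x2 + x1 * x3 + x1 * x4 + x2 * x3 + x2 * x4 + x3 * x4, x1 + x2 + x3 + x4, 1:]"
    unfolding r_def by (simp add: algebra_simps)
  have poly_p: "poly p x = (x\<^sup>2 + s) * (x\<^sup>2 + x + a) + c" for x
    by (simp add: p_def power2_eq_square algebra_simps)
  have poly_r: "poly r x = 0 \<longleftrightarrow> x \<in> {x1, x2, x3, x4}" for x
    unfolding r_def poly_mult mult_eq_0_iff by (auto simp: add_eq_0_iff2)
  have rts: "rts a c s = {x. poly p x = 0}" by (simp add: rts_def poly_p)
  have "rts a c s = {x1, x2, x3, x4} \<longleftrightarrow> p = r"
  proof
    assume eq: "rts a c s = {x1, x2, x3, x4}"
    show "p = r"
    proof (rule poly_eqI_degree_lead_coeff)
      show "degree p \<le> 4" "degree r \<le> 4" "coeff p 4 = coeff r 4"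
        by (simp_all add: p_def r numeral_eq_Suc)
      show "card {x1, x2, x3, x4} \<ge> 4" using assms by simp
      show "poly p x = poly r x" if "x \<in> {x1, x2, x3, x4}" for x
        using that eq poly_r[of x] unfolding rts by auto
    qed
  next
    assume "p = r"
    then show "rts a c s = {x1, x2, x3, x4}" unfolding rts using poly_r by blast
  qed
  also have "\<dots> \<longleftrightarrow> x1 + x2 + x3 + x4 = 1 \<and>
    x1 * x2 + x1 * x3 + x1 * x4 + x2 * x3 + x2 * x4 + x3 * x4 = a + s \<and>
    x1 * x2 * x3 + x1 * x2 * x4 + x1 * x3 * x4 + x2 * x3 * x4 = s \<and>
    x1 * x2 * x3 * x4 = s * a + c"
    unfolding p_def r pCons_eq_iff by metis
  finally show ?thesis .
qed

text \<open>With e1 = 1 the other two equations read e2 = A + 1 + e3 and e4 = (A + 1) e3 + (A^2 + A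
  + 1 + B). Thus e3 stays free and serves as \<open>s\<close>.\<close>

lemma power_sums_iff_rts:
  fixes R :: "'a set"
  assumes "card R = 4"
  shows "(\<Sum>y\<in>R. y) = 1 \<and> (\<Sum>y\<in>R. y ^ 3) = A \<and> (\<Sum>y\<in>R. y ^ 5) = B \<longleftrightarrow>
    (\<exists>s. rts (A + 1) (A\<^sup>2 + A + 1 + B) s = R)"
proof -
  obtain x1 x2 x3 x4 where R: "R = {x1, x2, x3, x4}" and dist: "distinct [x1, x2, x3, x4]"
    using assms by (auto simp: numeral_eq_Suc card_Suc_eq)
  define e2 e3 e4 where "e2 = x1 * x2 + x1 * x3 + x1 * x4 + x2 * x3 + x2 * x4 + x3 * x4"
    and "e3 = x1 * x2 * x3 + x1 * x2 * x4 + x1 * x3 * x4 + x2 * x3 * x4"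
    and "e4 = x1 * x2 * x3 * x4"
  note newton = newton_power_sums[of x1 x2 x3 x4, folded e2_def e3_def e4_def]
  have sum_R: "(\<Sum>y\<in>R. f y) = f x1 + f x2 + f x3 + f x4" for f :: "'a \<Rightarrow> 'a"
    using dist by (simp add: R add.assoc)
  show ?thesis
    unfolding sum_R
  proof
    assume ps: "x1 + x2 + x3 + x4 = 1 \<and> x1 ^ 3 + x2 ^ 3 + x3 ^ 3 + x4 ^ 3 = A \<and>
      x1 ^ 5 + x2 ^ 5 + x3 ^ 5 + x4 ^ 5 = B"
    then have A: "A = 1 + e2 + e3" and B: "B = 1 + e2 + e3 + e2\<^sup>2 + e4 + e2 * e3"
      using newton by simp_all
    have "e2 = (A + 1) + e3" unfolding A by (simp add: add_ac)
    moreover have "e4 = e3 * (A + 1) + (A\<^sup>2 + A + 1 + B)"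
      unfolding A B by (simp add: power2_eq_square algebra_simps)
    ultimately have "rts (A + 1) (A\<^sup>2 + A + 1 + B) e3 = {x1, x2, x3, x4}"
      using rts_eq_iff_vieta[OF dist, folded e2_def e3_def e4_def] ps by simp
    then show "\<exists>s. rts (A + 1) (A\<^sup>2 + A + 1 + B) s = R" using R by blast
  next
    assume "\<exists>s. rts (A + 1) (A\<^sup>2 + A + 1 + B) s = R"
    then obtain s where "rts (A + 1) (A\<^sup>2 + A + 1 + B) s = {x1, x2, x3, x4}" using R by auto
    then have e: "x1 + x2 + x3 + x4 = 1" "e2 = A + 1 + s" "e3 = s" "e4 = s * (A + 1) + (A\<^sup>2 + A + 1 + B)"
      using rts_eq_iff_vieta[OF dist, folded e2_def e3_def e4_def] by simp_all
    have "1 + e2 + e3 = A" unfolding e by (simp add: add_ac)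
    moreover have "1 + e2 + e3 + e2\<^sup>2 + e4 + e2 * e3 = B"
      unfolding e by (simp add: power2_eq_square algebra_simps)
    ultimately show "x1 + x2 + x3 + x4 = 1 \<and> x1 ^ 3 + x2 ^ 3 + x3 ^ 3 + x4 ^ 3 = A \<and>
      x1 ^ 5 + x2 ^ 5 + x3 ^ 5 + x4 ^ 5 = B"
      using newton[OF e(1)] e(1) by simp
  qed
qed

lemma num_orbits_eq:
  fixes A B :: 'a
  assumes "A\<^sup>2 + A + 1 + B \<noteq> 0"
  shows "num_orbits A B = card {s. card (rts (A + 1) (A\<^sup>2 + A + 1 + B) s) = 4}"
proof -
  let ?c = "A\<^sup>2 + A + 1 + B" and ?DS = "distinct_solutions A B"
  let ?rts = "rts (A + 1) ?c" and ?ran = "\<lambda>x :: 'a ^ 4. range (vec_nth x)"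
  have DS: "x \<in> ?DS \<longleftrightarrow> inj (vec_nth x) \<and> (\<exists>s. ?rts s = ?ran x)" for x
  proof -
    have inj: "inj (vec_nth x) \<longleftrightarrow> (\<forall>i j. i \<noteq> j \<longrightarrow> vec_nth x i \<noteq> vec_nth x j)" by (auto simp: inj_def)
    have "x \<in> ?DS \<longleftrightarrow> (\<exists>s. ?rts s = ?ran x)" if "inj (vec_nth x)"
    proof -
      have sums: "(\<Sum>y\<in>?ran x. f y) = (\<Sum>i\<in>UNIV. f (vec_nth x i))" for f :: "'a \<Rightarrow> 'a"
        using that by (simp add: sum.reindex)
      have "card (?ran x) = 4" using that by (simp add: card_image)
      from power_sums_iff_rts[OF this, of A B, unfolded sums] show ?thesis
        using that by (simp only: distinct_solutions_def mem_Collect_eq inj[symmetric] simp_thms)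
    qed
    moreover have "x \<in> ?DS \<Longrightarrow> inj (vec_nth x)" by (simp add: distinct_solutions_def inj)
    ultimately show ?thesis by blast
  qed
  have "num_orbits A B = card (?ran ` ?DS)"
    unfolding num_orbits_def
  proof (rule card_image_eq_of_kernel_eq)
    fix x y assume "x \<in> ?DS" "y \<in> ?DS"
    then have inj: "inj (vec_nth x)" "inj (vec_nth y)" by (simp_all only: DS)
    show "sym_orbit x = sym_orbit y \<longleftrightarrow> ?ran x = ?ran y"
    proof
      assume "sym_orbit x = sym_orbit y"
      moreover have "y \<in> sym_orbit y" using inj by (simp add: sym_orbit_eq)
      ultimately have "y \<in> sym_orbit x" by simp
      then show "?ran x = ?ran y" unfolding sym_orbit_eq[OF inj(1)] by simp
    next
      assume "?ran x = ?ran y"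
      then show "sym_orbit x = sym_orbit y"
        by (simp only: sym_orbit_eq[OF inj(1)] sym_orbit_eq[OF inj(2)])
    qed
  qed
  also have "?ran ` ?DS = ?rts ` {s. card (?rts s) = 4}"
  proof (intro Set.set_eqI iffI)
    fix R assume "R \<in> ?ran ` ?DS"
    then obtain x s where x: "inj (vec_nth x)" "?rts s = ?ran x" "R = ?ran x" by (auto simp: DS)
    then have "card (?rts s) = 4" by (simp add: card_image)
    moreover have "R = ?rts s" using x by simp
    ultimately show "R \<in> ?rts ` {s. card (?rts s) = 4}" by blast
  next
    fix R assume "R \<in> ?rts ` {s. card (?rts s) = 4}"
    then obtain s where s: "R = ?rts s" "card R = 4" by auto
    then obtain h where h: "bij_betw h (UNIV :: 4 set) R"
      using finite_same_card_bij[of "UNIV :: 4 set" R] by auto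
    define x where "x = (\<chi> i. h i)"
    have x: "vec_nth x = h" by (simp add: x_def fun_eq_iff)
    have "inj h" "range h = R" using h by (auto simp: bij_betw_def)
    then have "x \<in> ?DS" "?ran x = R" using DS[of x] s unfolding x by auto
    then show "R \<in> ?ran ` ?DS" by blast
  qed
  also have "card (?rts ` {s. card (?rts s) = 4}) = card {s. card (?rts s) = 4}"
  proof (intro card_image inj_onI)
    fix s s' assume "s \<in> {s. card (?rts s) = 4}" "?rts s = ?rts s'"
    then obtain x where "x \<in> ?rts s" "x \<in> ?rts s'" by (metis (mono_tags) card.empty ex_in_conv mem_Collect_eq zero_neq_numeral)
    then show "s = s'" unfolding rts_def mem_Collect_eq quart_iff[OF assms] by simp
  qed
  finally show ?thesis .
qed

text \<open>Serves q = 2 and q = 8, where the argument modulo 8 is not applied.\<close>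

lemma Tsum_trivial_bound: "\<bar>Tsum c\<bar> \<le> 2 ^ m - 1"
proof -
  have "\<bar>Tsum c\<bar> \<le> (\<Sum>x\<in>UNIV - {0 :: 'a}. \<bar>chi m (c * x ^ 3 + c / x)\<bar>)"
    unfolding Tsum_def by (rule sum_abs)
  also have "\<dots> = (\<Sum>x\<in>UNIV - {0 :: 'a}. 1)"
    by (intro sum.cong refl) (simp add: chi_def)
  also have "\<dots> = 2 ^ m - 1" by (simp add: card_Diff_singleton card_UNIV of_nat_diff)
  finally show ?thesis .
qed

end

text \<open>The integer part of \<open>2 sqrt q\<close> loses at most one against Weil's bound for \<open>T\<close>; the congruences
  for \<open>K\<close> and \<open>T\<close> exclude the critical values.\<close>

lemma floor_bounds:
  fixes e K T k :: int
  assumes "e = 1 \<or> e = - 1" and "\<bar>K\<bar> \<le> k" "\<bar>T\<bar> \<le> 2 * k + 1"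
    and "\<bar>T\<bar> \<le> 2 * k \<or> T mod 8 = 7 \<and> K mod 4 = 3"
  shows "- 6 - 6 * e + 2 * e * K + 3 * T \<le> 8 * k" and "- 8 * k \<le> 6 - 6 * e + 2 * e * K + 3 * T"
proof -
  have lower: "- 8 * k \<le> 2 * K + 3 * T"
  proof (cases "- 2 * k \<le> T")
    case False
    then have T: "T = - 2 * k - 1" "T mod 8 = 7" "K mod 4 = 3" using assms(3,4) by auto
    \<comment> \<open>The overshoot of \<open>T\<close> costs 3, but the residues of
      \<open>k\<close> and \<open>K\<close> keep \<open>K\<close> at least 3 above -k, a gain of 6.
      In the upper case \<open>- K\<close> stays 2 below \<open>k\<close>, a gain of 4.\<close>
    then have "k mod 4 = 0" by presburger
    moreover have "- k \<le> K" using assms(2) by simp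
    ultimately have "- k + 3 \<le> K" using T(3) by presburger
    then show ?thesis using T(1) by simp
  qed (use assms(2) in simp)
  have upper: "- 2 * K + 3 * T \<le> 8 * k"
  proof (cases "T \<le> 2 * k")
    case False
    then have T: "T = 2 * k + 1" "T mod 8 = 7" "K mod 4 = 3" using assms(3,4) by auto
    then have "k mod 4 = 3" by presburger
    moreover have "- K \<le> k" using assms(2) by simp
    ultimately have "- K \<le> k - 2" using T(3) by presburger
    then show ?thesis using T(1) by simp
  qed (use assms(2) in simp)
  \<comment> \<open>Only \<open>e = - 1\<close> above and \<open>e = 1\<close> below are tight; for
    the opposite signs the constant 12 absorbs the overshoot.\<close>
  show "- 6 - 6 * e + 2 * e * K + 3 * T \<le> 8 * k" "- 8 * k \<le> 6 - 6 * e + 2 * e * K + 3 * T"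
    using assms(1-3) lower upper by auto
qed

theorem mainTheorem8:
  fixes A B :: "'a::{field, finite}" and m q :: nat
  assumes "odd m" and "q = 2 ^ m" and "CARD('a) = q"
    and "A\<^sup>2 + A + 1 + B \<noteq> 0"
  shows "(real q - 11 - 2 * sqrt (2 * real q) - 8 * real_of_int \<lfloor>2 * sqrt (real q)\<rfloor>) / 24
           \<le> real (num_orbits A B) \<and>
         real (num_orbits A B)
           \<le> (real q + 1 + 2 * sqrt (2 * real q) + 8 * real_of_int \<lfloor>2 * sqrt (real q)\<rfloor>) / 24"
proof -
  interpret gf2m "TYPE('a)" m
    using assms(1-3) by unfold_locales (auto simp: odd_pos)
  define a c where "a = A + 1" and "c = A\<^sup>2 + A + 1 + B"
  have c: "c \<noteq> 0" using assms(4) by (simp add: c_def)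
  define e where "e = chi m a"
  define N where "N = num_orbits A B"
  have count: "24 * int N = 2 ^ m - 5 - 6 * e + 2 * e * Csum c + 2 * e * Ksum c + 3 * Tsum c"
    unfolding N_def num_orbits_eq[OF assms(4)] a_def[symmetric] c_def[symmetric] e_def
    by (rule count_split_quartics[OF c assms(1)])
  have e: "e = 1 \<or> e = - 1" using chi_cases by (simp add: e_def)
  define k where "k = \<lfloor>2 * sqrt (real q)\<rfloor>"
  have sq: "sqrt (2 ^ m) = sqrt (real q)" using assms(2) by simp
  have K: "\<bar>Ksum c\<bar> \<le> k"
    using abs_Ksum_le[OF c] unfolding k_def sq le_floor_iff by simp
  have T: "\<bar>Tsum c\<bar> \<le> 2 * k + 1"
  proof -
    have "2 * sqrt (real q) < real_of_int k + 1" unfolding k_def by linarith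
    then have "4 * sqrt (real q) < 2 * (real_of_int k + 1)" by simp
    with abs_Tsum_le[OF c] have "\<bar>real_of_int (Tsum c)\<bar> < 2 * (real_of_int k + 1)"
      unfolding sq by (rule order.strict_trans1)
    then have "real_of_int \<bar>Tsum c\<bar> < real_of_int (2 * (k + 1))" by simp
    then have "\<bar>Tsum c\<bar> < 2 * (k + 1)" by (simp only: of_int_less_iff)
    then show ?thesis by simp
  qed
  have C: "\<bar>real_of_int (e * Csum c)\<bar> \<le> sqrt (2 * real q)"
  proof (rule real_le_rsqrt)
    have "(Csum c)\<^sup>2 \<le> 2 * 2 ^ m" using Csum_square[OF c assms(1)] by auto
    then have "real_of_int ((Csum c)\<^sup>2) \<le> real_of_int (2 * 2 ^ m)" by (simp only: of_int_le_iff)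
    moreover have "(e * Csum c)\<^sup>2 = (Csum c)\<^sup>2" using e by auto
    ultimately have "real_of_int ((e * Csum c)\<^sup>2) \<le> real_of_int (2 * 2 ^ m)" by (simp only:)
    moreover have "\<bar>real_of_int (e * Csum c)\<bar>\<^sup>2 = real_of_int ((e * Csum c)\<^sup>2)" by simp
    moreover have "real_of_int (2 * 2 ^ m) = 2 * real q" using assms(2) by simp
    ultimately show "\<bar>real_of_int (e * Csum c)\<bar>\<^sup>2 \<le> 2 * real q" by (simp only:)
  qed
  have "\<bar>Tsum c\<bar> \<le> 2 * k \<or> Tsum c mod 8 = 7 \<and> Ksum c mod 4 = 3"
  proof (cases "m \<ge> 5")
    case True
    have K4: "Ksum c mod 4 = 3" using Ksum_mod_4[OF c] True by simp
    have "8 dvd Csum c"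
    proof -
      obtain j where j: "m = 2 * j + 1" using assms(1) by (elim oddE)
      have "(2::int) * 2 ^ m = (2 ^ (j + 1))\<^sup>2"
        unfolding j power_mult[symmetric] power_Suc[symmetric]
        by (rule arg_cong[where f = "\<lambda>i. 2 ^ i"]) simp
      then have "(Csum c)\<^sup>2 = 0 \<or> (Csum c)\<^sup>2 = (2 ^ (j + 1))\<^sup>2"
        using Csum_square[OF c assms(1)] by simp
      then have "Csum c = 0 \<or> Csum c = 2 ^ (j + 1) \<or> Csum c = - (2 ^ (j + 1))"
        by (simp only: power2_eq_iff zero_eq_power2)
      \<comment> \<open>Here \<open>m \<ge> 5\<close> enters: the only possible nonzero values of
        \<open>Csum c\<close> are plus or minus 2^((m + 1) / 2).\<close>
      moreover have "(2::int) ^ 3 dvd 2 ^ (j + 1)" using True j by (intro le_imp_power_dvd) simp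
      ultimately show ?thesis by auto
    qed
    then obtain C' where C': "Csum c = 8 * C'" by (rule dvdE)
    have "(2::int) ^ 3 dvd 2 ^ m" using True by (intro le_imp_power_dvd) simp
    then have "(8::int) dvd 2 ^ m" by simp
    define q' where "q' = (2::int) ^ m div 8"
    have q': "(2::int) ^ m = 8 * q'"
      unfolding q'_def using \<open>8 dvd 2 ^ m\<close> by (rule dvd_mult_div_cancel[symmetric])
    \<comment> \<open>Integrality of \<open>N\<close> makes the left side of the count divisible by
      8. Writing \<open>Ksum c = 4 * l + 3\<close>, the term 6 e from 2 e K cancels - 6 e, so that 3
      T is 5 modulo 8 whatever the sign \<open>e\<close>.\<close>
    have "Tsum c mod 8 = 7"
    proof -
      have "24 * int N = 8 * q' - 5 - 6 * e + 16 * (e * C') + 2 * (e * Ksum c) + 3 * Tsum c"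
        using count unfolding C' q' by (simp add: algebra_simps)
      moreover obtain l where "Ksum c = 4 * l + 3"
        using K4 by (metis div_mult_mod_eq mult.commute)
      ultimately have "3 * Tsum c = 8 * (3 * int N - q' - 2 * (e * C') - e * l) + 5"
        using e by auto
      then show ?thesis by presburger
    qed
    then show ?thesis using K4 by blast
  next
    case False
    then have "m < 5" by simp
    then have "m = 1 \<or> m = 3" using assms(1) by presburger
    then have "\<bar>Tsum c\<bar> \<le> 2 * k"
    proof
      assume "m = 1"
      then have "1 \<le> sqrt (real q)" using assms(2) by simp
      then have "real_of_int 1 \<le> 2 * sqrt (real q)" unfolding of_int_1 by linarith
      then have "1 \<le> k" unfolding k_def le_floor_iff .
      then show ?thesis using Tsum_trivial_bound[of c] \<open>m = 1\<close> by simp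
    next
      assume "m = 3"
      then have "2 \<le> sqrt (real q)" using assms(2) by (intro real_le_rsqrt) simp
      then have "real_of_int 4 \<le> 2 * sqrt (real q)" unfolding of_int_numeral by linarith
      then have "4 \<le> k" unfolding k_def le_floor_iff .
      then show ?thesis using Tsum_trivial_bound[of c] \<open>m = 3\<close> by simp
    qed
    then show ?thesis by blast
  qed
  note bounds = floor_bounds[OF e K T this]
  have "real_of_int (- 6 - 6 * e + 2 * e * Ksum c + 3 * Tsum c) \<le> real_of_int (8 * k)"
    "real_of_int (- 8 * k) \<le> real_of_int (6 - 6 * e + 2 * e * Ksum c + 3 * Tsum c)"
    unfolding of_int_le_iff by (rule bounds)+
  moreover have "24 * real N = real q - 5 + 2 * real_of_int (e * Csum c) +
      real_of_int (- 6 * e + 2 * e * Ksum c + 3 * Tsum c)"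
    using arg_cong[OF count, of real_of_int] assms(2) by simp
  ultimately have "real q - 11 - 2 * sqrt (2 * real q) - 8 * real_of_int k \<le> 24 * real N"
    "24 * real N \<le> real q + 1 + 2 * sqrt (2 * real q) + 8 * real_of_int k"
    using C by simp_all
  then show ?thesis unfolding N_def k_def by simp
qed

end
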